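(* Let $n\ge m\ge1$ and $1\le k\le n-1$ be integers. For $x\in\mathfrak M_{n,m}$ and $t\in\mathfrak M_{n-k,m}$ put $r=x'x$, $s=t't$. (i) If $f(x)$ is radial, i.e. $f(x)=f_0(x'x)$, then $$\hat f(\xi,t)=\pi^{km/2}(I_-^{k/2}f_0)(s).$$ (ii) Let $\varphi$ be radial, i.e. $\varphi(\xi,t)=\varphi_0(t't)$, and put $\Phi_0(s)=|s|^{\delta}\varphi_0(s)$, $\delta=(n-k)/2-d$, $d=(m+1)/2$. If $1\le k\le n-m$, then for any matrix $x\in\mathfrak M_{n,m}$ of rank $m$, $$\check\varphi(x)=c\,|r|^{d-n/2}(I_+^{k/2}\Phi_0)(r),\qquad c=\pi^{km/2}\sigma_{n-k,m}/\sigma_{n,m}.$$ Both equalities hold for any locally integrable functions provided that either side exists in the Lebesgue sense.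
   Context: $\mathfrak M_{n,m}$: real $n\times m$ matrices with Lebesgue measure; $x'$ transpose; $|a|$ absolute value of the determinant. $\mathcal P_m$ is the cone of positive definite symmetric $m\times m$ matrices, $\overline{\mathcal P}_m$ its closure, $dr=\prod_{i\le j}dr_{i,j}$. $\Gamma_m(\alpha)=\pi^{m(m-1)/4}\prod_{j=0}^{m-1}\Gamma(\alpha-j/2)$. $V_{n,m}=\{v\in\mathfrak M_{n,m}:v'v=I_m\}$ is the Stiefel manifold with $O(n)$-invariant measure $dv$ normalized by $\int_{V_{n,m}}dv=\sigma_{n,m}=2^m\pi^{nm/2}/\Gamma_m(n/2)$. Radon transform: for $\xi\in V_{n,n-k}$, $t\in\mathfrak M_{n-k,m}$, $\hat f(\xi,t)=\int_{\mathfrak M_{k,m}}f\left(g_\xi\begin{bmatrix}\omega\\ t\end{bmatrix}\right)d\omega$, where $g_\xi\in SO(n)$ is any rotation with $g_\xi\begin{bmatrix}0\\ I_{n-k}\end{bmatrix}=\xi$. Dual Radon transform of a function $\varphi(\xi,t)$ on $V_{n,n-k}\times\mathfrak M_{n-k,m}$ (with $\varphi(\xi\theta',\theta t)=\varphi(\xi,t)$ for $\theta\in O(n-k)$): $\check\varphi(x)=\sigma_{n,n-k}^{-1}\int_{V_{n,n-k}}\varphi(\xi,\xi'x)\,d\xi$. Gårding–Gindikin fractional integrals of order $k/2$, with $d=(m+1)/2$: if $k\ge m$, $(I_+^{k/2}f)(s)=\frac1{\Gamma_m(k/2)}\int_{\{r\in\mathcal P_m:\,s-r\in\mathcal P_m\}}f(r)|s-r|^{k/2-d}dr$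 for $s\in\mathcal P_m$, and $(I_-^{k/2}f)(s)=\frac1{\Gamma_m(k/2)}\int_{\{r:\,r-s\in\mathcal P_m\}}f(r)|r-s|^{k/2-d}dr$ for $s\in\overline{\mathcal P}_m$; if $1\le k<m$, $(I_+^{k/2}f)(s)=\pi^{-km/2}\int_{\{\omega\in\mathfrak M_{k,m}:\,s-\omega'\omega\in\mathcal P_m\}}f(s-\omega'\omega)\,d\omega$ and $(I_-^{k/2}f)(s)=\pi^{-km/2}\int_{\mathfrak M_{k,m}}f(s+\omega'\omega)\,d\omega$. *)

theory Defs
  imports "HOL-Analysis.Analysis"
begin

text \<open>
  Real n-by-m matrices are the type \<^typ>\<open>real^'m^'n\<close>, whose \<^term>\<open>lebesgue\<close> is the product of the
  Lebesgue measures of the entries.  For the Radon transform the row index set of size n is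
  \<^typ>\<open>'k + 'l\<close> with \<^term>\<open>CARD('k) = k\<close> and \<^term>\<open>CARD('l) = n - k\<close>; as types are nonempty, this
  covers exactly the pairs with \<open>1 \<le> k \<le> n - 1\<close>.
\<close>

definition posdef_cone :: "(real^'m^'m) set" where
  "posdef_cone = {r. transpose r = r \<and> (\<forall>x. x \<noteq> 0 \<longrightarrow> 0 < x \<bullet> (r *v x))}"

text \<open>
  The measure \<open>dr = (\<Prod>i\<le>j. dr\<^bsub>i,j\<^esub>)\<close> on symmetric matrices, with the entries on and above the
  diagonal as independent coordinates.  It lives on the type of all square matrices and is
  concentrated on the symmetric ones; the completion makes it Lebesgue and not just Borel measure.
\<close>

definition lebesgue_sym :: "(real^'m::{finite,linorder}^'m::{finite,linorder}) measure" where
  "lebesgue_sym =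
     completion (distr (Pi\<^sub>M {(i, j). i \<le> j} (\<lambda>_. lborel)) borel
                       (\<lambda>r. \<chi> i j. r (min i j, max i j)))"

definition siegel_Gamma :: "nat \<Rightarrow> real \<Rightarrow> real" where
  "siegel_Gamma m \<alpha> = pi powr (real m * (real m - 1) / 4) * (\<Prod>j<m. Gamma (\<alpha> - real j / 2))"

definition stiefel_volume :: "nat \<Rightarrow> nat \<Rightarrow> real" where
  "stiefel_volume n m = 2 ^ m * pi powr (real n * real m / 2) / siegel_Gamma m (real n / 2)"

definition stiefel :: "(real^'m^'n) set" where
  "stiefel = {v. transpose v ** v = mat 1}"

definition invariant_stiefel_measure :: "(real^'m^'n) measure \<Rightarrow> bool" where
  "invariant_stiefel_measure \<mu> \<longleftrightarrow>
     sets \<mu> = sets (restrict_space borel stiefel) \<and>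
     (\<forall>g::real^'n^'n. orthogonal_matrix g \<longrightarrow> distr \<mu> \<mu> ((**) g) = \<mu>) \<and>
     emeasure \<mu> stiefel = ennreal (stiefel_volume CARD('n) CARD('m))"

definition locally_integrable_on ::
    "'a::topological_space measure \<Rightarrow> 'a set \<Rightarrow> ('a \<Rightarrow> 'b::{banach,second_countable_topology}) \<Rightarrow> bool"
  where
  "locally_integrable_on M S f \<longleftrightarrow> (\<forall>K. compact K \<and> K \<subseteq> S \<longrightarrow> set_integrable M K f)"

definition stack :: "real^'m^'k \<Rightarrow> real^'m^'l \<Rightarrow> real^'m^('k + 'l)" where
  "stack \<omega> t = (\<chi> i. case i of Inl a \<Rightarrow> \<omega> $ a | Inr b \<Rightarrow> t $ b)"

definition frame_rotations :: "real^'l^('k::finite + 'l::finite) \<Rightarrow> (real^('k + 'l)^('k + 'l)) set" where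
  "frame_rotations \<xi> = {g. rotation_matrix g \<and> g ** stack 0 (mat 1) = \<xi>}"

text \<open>
  The argument \<open>rot\<close> selects the rotation \<open>g\<^sub>\<xi>\<close>.  For a transform defined by an integral, the
  companion predicate with suffix \<open>exists\<close> says that the integral exists in the Lebesgue sense,
  i.e. converges absolutely.
\<close>

definition radon_integrand ::
    "(real^'l^('k::finite + 'l::finite) \<Rightarrow> real^('k + 'l)^('k + 'l)) \<Rightarrow>
     (real^'m^('k + 'l) \<Rightarrow> complex) \<Rightarrow> real^'l^('k + 'l) \<Rightarrow> real^'m^'l \<Rightarrow> real^'m^'k \<Rightarrow> complex" where
  "radon_integrand rot f \<xi> t = (\<lambda>\<omega>. f (rot \<xi> ** stack \<omega> t))"

definition radon_exists ::
    "(real^'l^('k::finite + 'l::finite) \<Rightarrow> real^('k + 'l)^('k + 'l)) \<Rightarrow>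
     (real^'m^('k + 'l) \<Rightarrow> complex) \<Rightarrow> real^'l^('k + 'l) \<Rightarrow> real^'m^'l \<Rightarrow> bool" where
  "radon_exists rot f \<xi> t \<longleftrightarrow> integrable lebesgue (radon_integrand rot f \<xi> t)"

definition radon ::
    "(real^'l^('k::finite + 'l::finite) \<Rightarrow> real^('k + 'l)^('k + 'l)) \<Rightarrow>
     (real^'m^('k + 'l) \<Rightarrow> complex) \<Rightarrow> real^'l^('k + 'l) \<Rightarrow> real^'m^'l \<Rightarrow> complex" where
  "radon rot f \<xi> t = integral\<^sup>L lebesgue (radon_integrand rot f \<xi> t)"

definition dual_radon_exists ::
    "(real^'l^'n) measure \<Rightarrow> ((real^'l^'n) \<times> (real^'m^'l) \<Rightarrow> complex) \<Rightarrow> real^'m^'n \<Rightarrow> bool" where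
  "dual_radon_exists \<mu> \<phi> x \<longleftrightarrow> integrable (completion \<mu>) (\<lambda>\<xi>. \<phi> (\<xi>, transpose \<xi> ** x))"

definition dual_radon ::
    "(real^'l^'n) measure \<Rightarrow> ((real^'l^'n) \<times> (real^'m^'l) \<Rightarrow> complex) \<Rightarrow> real^'m^'n \<Rightarrow> complex" where
  "dual_radon \<mu> \<phi> x =
     (1 / stiefel_volume CARD('n) CARD('l)) *\<^sub>R (LINT \<xi>|completion \<mu>. \<phi> (\<xi>, transpose \<xi> ** x))"

lemma ex_frame_rotation:
  fixes \<xi> :: "real^'l::finite^('k::finite + 'l)"
  assumes xi: "\<xi> \<in> stiefel"
  shows "\<exists>g. g \<in> frame_rotations \<xi>"
proof -
  define C where "C = columns \<xi>"
  have ip: "column a \<xi> \<bullet> column b \<xi> = (if a = b then 1 else 0)" for a b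
    using xi by (auto simp: stiefel_def vec_eq_iff matrix_matrix_mult_def transpose_def mat_def
        inner_vec_def column_def)
  have inj: "inj (\<lambda>a. column a \<xi>)"
    using ip by (metis injI zero_neq_one)
  have C: "C = range (\<lambda>a. column a \<xi>)" by (auto simp: C_def columns_def)
  have cardC: "card C = CARD('l)" unfolding C using inj by (rule card_image)
  have "pairwise orthogonal C" 
    unfolding C pairwise_def orthogonal_def using ip by fastforce
  moreover have "0 \<notin> C" unfolding C using ip by (metis (no_types, lifting) imageE inner_zero_left zero_neq_one)
  ultimately have indC: "independent C" by (rule pairwise_orthogonal_independent)
  define S where "S = {x. \<forall>y \<in> span C. orthogonal y x}"
  have "subspace S" unfolding S_def by (rule subspace_orthogonal_to_vectors)
  moreover have "dim S + dim (span C) = DIM(real^('k+'l))"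
    using dim_subspace_orthogonal_to_vectors[of "span C" UNIV] unfolding S_def by simp
  then have dimS: "dim S = CARD('k)"
    using cardC indC by (simp add: dim_eq_card_independent)
  ultimately obtain B where B: "B \<subseteq> S" "pairwise orthogonal B" "\<And>x. x \<in> B \<Longrightarrow> norm x = 1"
     "independent B" "card B = dim S" "span B = S"
    using orthonormal_basis_subspace by blast
  then obtain e :: "'k \<Rightarrow> real^('k+'l)" where e: "bij_betw e UNIV B"
    using dimS by (metis finite_same_card_bij finite independent_imp_finite)
  have eB: "e a \<in> B" for a using e by (auto simp: bij_betw_def)
  have e1: "e a \<bullet> e b = (if a = b then 1 else 0)" for a b
  proof (cases "a = b")
    case True then show ?thesis using B(3)[OF eB[of a]] by (simp add: norm_eq_1)
  next
    case False
    then have "e a \<noteq> e b" using e by (auto simp: bij_betw_def inj_on_def)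
    then show ?thesis using B(2) eB False by (simp add: pairwise_def orthogonal_def)
  qed
  have e2: "column b \<xi> \<bullet> e a = 0" for a b
    using eB[of a] B(1) C span_base[of "column b \<xi>" C] by (auto simp: S_def orthogonal_def)
  define h :: "real \<Rightarrow> real^('k+'l)^('k+'l)" where
    "h \<epsilon> = (\<chi> i j. case j of Inl a \<Rightarrow> (if a = undefined then \<epsilon> else 1) * e a $ i | Inr b \<Rightarrow> \<xi> $ i $ b)" for \<epsilon>
  have cl: "column (Inl a) (h \<epsilon>) = (if a = undefined then \<epsilon> else 1) *\<^sub>R e a"
   and cr: "column (Inr b) (h \<epsilon>) = column b \<xi>" for a b \<epsilon>
    by (simp_all add: column_def h_def vec_eq_iff)
  have orth: "orthogonal_matrix (h \<epsilon>)" if "\<epsilon> = 1 \<or> \<epsilon> = -1" for \<epsilon>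
  proof -
    have "column i (h \<epsilon>) \<bullet> column j (h \<epsilon>) = (if i = j then 1 else 0)" for i j
      using that by (cases i; cases j) (auto simp: cl cr e1 e2 ip inner_commute[of "e _" "column _ _"])
    then show ?thesis
      by (auto simp: orthogonal_matrix_orthonormal_columns norm_eq_1 orthogonal_def)
  qed
  define D :: "real^('k+'l)^('k+'l)" where 
    "D = (\<chi> i j. if i = j then (if i = Inl undefined then -1 else 1) else 0)"
  have "det D = (\<Prod>i\<in>UNIV. D $ i $ i)" by (rule det_diagonal) (simp add: D_def)
  also have "\<dots> = -1" by (simp add: D_def prod.If_cases)
  finally have dD: "det D = -1" .
  have "h (-1) = h 1 ** D"
    by (auto simp: vec_eq_iff matrix_matrix_mult_def h_def D_def if_distrib cong: if_cong split: sum.splits)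
  then have "det (h (-1)) = - det (h 1)" by (simp add: det_mul dD)
  then have "rotation_matrix (h 1) \<or> rotation_matrix (h (-1))"
    using orth[of 1] orth[of "-1"] det_orthogonal_matrix[OF orth[of 1]]
    by (auto simp: rotation_matrix_def)
  moreover have "h \<epsilon> ** stack 0 (mat 1) = \<xi>" for \<epsilon>
  proof -
    have "(\<Sum>i\<in>(UNIV::('k+'l) set). h \<epsilon> $ a $ i * (stack 0 (mat 1)::real^'l^('k+'l)) $ i $ b) = \<xi> $ a $ b" for a b
      by (subst UNIV_Plus_UNIV[symmetric], subst sum.Plus)
         (simp_all add: h_def stack_def mat_def if_distrib cong: if_cong)
    then show ?thesis by (simp add: vec_eq_iff matrix_matrix_mult_def)
  qed
  ultimately show ?thesis unfolding frame_rotations_def by blast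
qed

text \<open>
  The order enters through a type \<^typ>\<open>'k\<close> with k elements, because for \<open>k < m\<close> the integrals run
  over k-by-m matrices.
\<close>

definition gg_plus_exists ::
    "'k::finite itself \<Rightarrow> (real^'m::{finite,linorder}^'m::{finite,linorder} \<Rightarrow> complex) \<Rightarrow> real^'m::{finite,linorder}^'m::{finite,linorder} \<Rightarrow> bool" where
  "gg_plus_exists _ f s \<longleftrightarrow>
     (if CARD('m) \<le> CARD('k) then
        set_integrable lebesgue_sym {r. r \<in> posdef_cone \<and> s - r \<in> posdef_cone}
          (\<lambda>r. (\<bar>det (s - r)\<bar> powr (real CARD('k) / 2 - (real CARD('m) + 1) / 2)) *\<^sub>R f r)
      else
        set_integrable lebesgue {\<omega> :: real^'m::{finite,linorder}^'k. s - transpose \<omega> ** \<omega> \<in> posdef_cone}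
          (\<lambda>\<omega>. f (s - transpose \<omega> ** \<omega>)))"

definition gg_plus ::
    "'k::finite itself \<Rightarrow> (real^'m::{finite,linorder}^'m::{finite,linorder} \<Rightarrow> complex) \<Rightarrow> real^'m::{finite,linorder}^'m::{finite,linorder} \<Rightarrow> complex" where
  "gg_plus _ f s =
     (if CARD('m) \<le> CARD('k) then
        (1 / siegel_Gamma CARD('m) (real CARD('k) / 2)) *\<^sub>R
        (LINT r:{r. r \<in> posdef_cone \<and> s - r \<in> posdef_cone}|lebesgue_sym.
           (\<bar>det (s - r)\<bar> powr (real CARD('k) / 2 - (real CARD('m) + 1) / 2)) *\<^sub>R f r)
      else
        (pi powr (- (real CARD('k) * real CARD('m) / 2))) *\<^sub>R
        (LINT \<omega>:{\<omega> :: real^'m::{finite,linorder}^'k. s - transpose \<omega> ** \<omega> \<in> posdef_cone}|lebesgue.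
           f (s - transpose \<omega> ** \<omega>)))"

definition gg_minus_exists ::
    "'k::finite itself \<Rightarrow> (real^'m::{finite,linorder}^'m::{finite,linorder} \<Rightarrow> complex) \<Rightarrow> real^'m::{finite,linorder}^'m::{finite,linorder} \<Rightarrow> bool" where
  "gg_minus_exists _ f s \<longleftrightarrow>
     (if CARD('m) \<le> CARD('k) then
        set_integrable lebesgue_sym {r. r - s \<in> posdef_cone}
          (\<lambda>r. (\<bar>det (r - s)\<bar> powr (real CARD('k) / 2 - (real CARD('m) + 1) / 2)) *\<^sub>R f r)
      else
        integrable lebesgue (\<lambda>\<omega> :: real^'m::{finite,linorder}^'k. f (s + transpose \<omega> ** \<omega>)))"

definition gg_minus ::
    "'k::finite itself \<Rightarrow> (real^'m::{finite,linorder}^'m::{finite,linorder} \<Rightarrow> complex) \<Rightarrow> real^'m::{finite,linorder}^'m::{finite,linorder} \<Rightarrow> complex" where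
  "gg_minus _ f s =
     (if CARD('m) \<le> CARD('k) then
        (1 / siegel_Gamma CARD('m) (real CARD('k) / 2)) *\<^sub>R
        (LINT r:{r. r - s \<in> posdef_cone}|lebesgue_sym.
           (\<bar>det (r - s)\<bar> powr (real CARD('k) / 2 - (real CARD('m) + 1) / 2)) *\<^sub>R f r)
      else
        (pi powr (- (real CARD('k) * real CARD('m) / 2))) *\<^sub>R
        (LINT \<omega> :: real^'m::{finite,linorder}^'k|lebesgue. f (s + transpose \<omega> ** \<omega>)))"

end

theory Submission
  imports Defs
begin

text \<open>
  Write \<open>X = g \<cdot> stack \<omega> t\<close> with \<open>g = g\<^sub>\<xi>\<close> orthogonal; then \<open>X'X = \<omega>'\<omega> + t't\<close> and \<open>\<xi>'X = t\<close>.  Hence part (i)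
  is the statement that \<open>\<omega> \<mapsto> \<omega>'\<omega>\<close> pushes Lebesgue measure on k-by-m matrices, \<open>k \<ge> m\<close>, forward
  to \<open>\<pi>\<^bsup>km/2\<^esup> \<Gamma>\<^sub>m(k/2)\<^sup>-\<^sup>1 |r|\<^bsup>k/2-d\<^esup> dr\<close> on the cone.  This is proved by adding one column v at a time to
  linearly independent columns W: the pair \<open>(W'v, |v|\<^sup>2)\<close> has an explicit law, \<open>|v|\<^sup>2\<close> minus the squared
  length of the projection of v is a Schur complement, and the powers of the Gram determinants telescope.

  For part (ii), integrate \<open>a(X'X) \<phi>\<^sub>0(X'\<xi>\<xi>'X)\<close> over all X and \<open>\<xi>\<close>.  Integrating over X first gives, by the
  substitution above, \<open>a\<close> against the right-hand side; integrating over \<open>\<xi>\<close> first gives \<open>a\<close> against the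
  dual transform, which depends on \<open>X'X\<close> only.  As \<open>a\<close> is arbitrary, both sides agree for almost all X.
  Applied to a countable generator of the Borel sets this yields one X for which the two sides agree as
  measures in \<open>\<phi>\<^sub>0\<close>, and both sides transform in the same way under \<open>X \<mapsto> g X A\<close>.

  Completed measures need care, since \<open>f\<^sub>0\<close> and \<open>\<phi>\<^sub>0\<close> are arbitrary functions: by inner regularity,
  \<open>F \<circ> q\<close> is measurable for the completion of a measure if and only if F is measurable for the completion
  of its image under the continuous map q.
\<close>

section \<open>Lebesgue measure on vectors and matrices\<close>

text \<open>The computations are made with nonnegative Borel integrands and then packaged as
  equalities of measures. Both existence and value of the complex integrals follow from these: a
  function that is not integrable for one description of a measure is not integrable for the other.
  The constants: a column added to j independent ones is free in a complement of dimension k - j and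
  contributes pi^((k-j)/2) / Gamma((k-j)/2); the product over the columns is pi^(km/2) /
  Gamma_m(k/2). In (ii) the Gram law is used for t with n - k rows and for X with n rows. The
  quotient of the two constants is sigma_(n-k,m) / sigma_(n,m), while the volume sigma_(n,n-k) of
  the frames cancels against the normalization of the dual transform. The obstacle in (ii) is that
  the duality argument gives almost all X, with an exceptional set that depends on the test
  function, whereas the claim concerns each x of rank m. The law of X'\<xi>\<xi>'X is therefore the
  right object: the maps X -> g X A act transitively on matrices of rank m, and the homogeneities
  match because n - m - 1 = (n - k - m - 1) + k. For k < m this law is singular, so it is kept as an
  image from k-by-m matrices.\<close>

lemma borel_measurable_vec_lambda [measurable (raw)]:
  fixes f :: "'n::finite \<Rightarrow> 'a \<Rightarrow> 'b::euclidean_space"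
  assumes "\<And>i. f i \<in> borel_measurable M"
  shows "(\<lambda>x. \<chi> i. f i x) \<in> borel_measurable M"
proof (subst borel_measurable_euclidean_space, intro ballI)
  fix b :: "'b^'n" assume "b \<in> Basis"
  then obtain i u where "b = axis i u" by (auto simp: Basis_vec_def)
  then show "(\<lambda>x. (\<chi> i. f i x) \<bullet> b) \<in> borel_measurable M"
    using assms by (auto simp: inner_axis)
qed

lemma borel_measurable_vec_nth [measurable (raw)]:
  fixes f :: "'a \<Rightarrow> 'b::euclidean_space^'n"
  assumes "f \<in> borel_measurable M"
  shows "(\<lambda>x. f x $ i) \<in> borel_measurable M"
  by (rule borel_measurable_continuous_on[OF _ assms]) (intro continuous_intros)

lemma prod_Basis_vec:
  "(\<Prod>b\<in>(Basis :: ('b::euclidean_space^'n) set). g b) = (\<Prod>i\<in>UNIV. \<Prod>u\<in>Basis. g (axis i u))"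
proof -
  have "(\<Prod>b\<in>(Basis :: ('b^'n) set). g b) = (\<Prod>p\<in>UNIV \<times> Basis. g (case p of (i, u) \<Rightarrow> axis i u))"
    by (rule prod.reindex_bij_betw[symmetric])
       (auto simp: bij_betw_def inj_on_def Basis_vec_def axis_eq_axis)
  also have "\<dots> = (\<Prod>i\<in>UNIV. \<Prod>u\<in>Basis. g (axis i u))"
    by (simp add: prod.cartesian_product split_def)
  finally show ?thesis .
qed

lemma mem_box_vec: "x \<in> box l u \<longleftrightarrow> (\<forall>i. x $ i \<in> box (l $ i) (u $ i))"
  for x :: "'b::euclidean_space^'n"
  by (auto simp: mem_box Basis_vec_def inner_axis)

text \<open>Boxes factor over the coordinates and their volumes determine \<open>lborel\<close>. The
  entry type is an arbitrary Euclidean space, so that a matrix can be treated as a family of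
  rows.\<close>

lemma lborel_vec_eq_distr_PiM:
  "(lborel :: ('b::euclidean_space^'n) measure) = distr (Pi\<^sub>M UNIV (\<lambda>_. lborel)) borel vec_lambda"
proof (rule lborel_eqI)
  interpret product_sigma_finite "\<lambda>_ :: 'n. lborel :: 'b measure" by standard
  have [measurable]: "(vec_lambda :: ('n \<Rightarrow> 'b) \<Rightarrow> _) \<in> borel_measurable (Pi\<^sub>M UNIV (\<lambda>_. lborel))"
    by (rule borel_measurable_vec_lambda) simp
  fix l u :: "'b^'n" assume le: "\<And>b. b \<in> Basis \<Longrightarrow> l \<bullet> b \<le> u \<bullet> b"
  have le': "l $ i \<bullet> v \<le> u $ i \<bullet> v" if "v \<in> Basis" for i v
    using le[of "axis i v"] that by (auto simp: Basis_vec_def inner_axis)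
  have "emeasure (distr (Pi\<^sub>M UNIV (\<lambda>_. lborel)) borel vec_lambda) (box l u)
      = emeasure (Pi\<^sub>M UNIV (\<lambda>_. lborel)) (Pi\<^sub>E UNIV (\<lambda>i. box (l $ i) (u $ i)))"
    by (subst emeasure_distr) (auto intro!: arg_cong[where f="emeasure _"]
          simp: mem_box_vec space_PiM PiE_def Pi_def extensional_def)
  also have "\<dots> = (\<Prod>i\<in>UNIV. emeasure lborel (box (l $ i) (u $ i)))"
    by (subst emeasure_PiM) auto
  also have "\<dots> = ennreal (\<Prod>b\<in>Basis. (u - l) \<bullet> b)"
    unfolding prod_Basis_vec using le'
    by (subst prod_ennreal[symmetric]) (auto simp: inner_axis inner_diff_left intro!: prod_nonneg)
  finally show "emeasure (distr (Pi\<^sub>M UNIV (\<lambda>_. lborel)) borel vec_lambda) (box l u)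
      = ennreal (\<Prod>b\<in>Basis. (u - l) \<bullet> b)" .
qed simp

lemma nn_integral_lborel_vec:
  fixes f :: "'b::euclidean_space^'n \<Rightarrow> ennreal"
  assumes [measurable]: "f \<in> borel_measurable borel"
  shows "(\<integral>\<^sup>+x. f x \<partial>lborel) = (\<integral>\<^sup>+w. f (vec_lambda w) \<partial>Pi\<^sub>M UNIV (\<lambda>_. lborel))"
proof -
  have [measurable]: "(vec_lambda :: ('n \<Rightarrow> 'b) \<Rightarrow> _) \<in> borel_measurable (Pi\<^sub>M UNIV (\<lambda>_. lborel))"
    by (rule borel_measurable_vec_lambda) simp
  show ?thesis by (subst lborel_vec_eq_distr_PiM) (simp add: nn_integral_distr)
qed

text \<open>Serves to permute coordinates and to exchange index sets: a subset of one type for a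
  whole type, unordered pairs for ordered ones. Image and product measure agree on rectangles; the
  restriction to \<open>B\<close> keeps the reindexed family extensional, hence inside the product
  space.\<close>

lemma nn_integral_PiM_reindex:
  assumes M: "sigma_finite_measure M" and h: "bij_betw h A B" and A: "finite A"
    and f: "f \<in> borel_measurable (Pi\<^sub>M B (\<lambda>_. M))"
  shows "(\<integral>\<^sup>+w. f w \<partial>Pi\<^sub>M B (\<lambda>_. M)) = (\<integral>\<^sup>+w. f (\<lambda>b\<in>B. w (inv_into A h b)) \<partial>Pi\<^sub>M A (\<lambda>_. M))"
proof -
  interpret sigma_finite_measure M by (rule M)
  interpret product_sigma_finite "\<lambda>_ . M" by standard
  have B: "finite B" using h A by (simp add: bij_betw_finite)
  let ?g = "inv_into A h"
  have g: "?g b \<in> A" if "b \<in> B" for b using h that by (metis bij_betw_def inv_into_into)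
  have hh: "h a \<in> B" "?g (h a) = a" if "a \<in> A" for a
    using h that by (auto simp: bij_betw_def)
  have hg: "h (?g b) = b" if "b \<in> B" for b using h that by (metis bij_betw_def f_inv_into_f)
  have m: "(\<lambda>w. \<lambda>b\<in>B. w (?g b)) \<in> Pi\<^sub>M A (\<lambda>_. M) \<rightarrow>\<^sub>M Pi\<^sub>M B (\<lambda>_. M)"
    using g by (intro measurable_restrict measurable_component_singleton) auto
  have "distr (Pi\<^sub>M A (\<lambda>_. M)) (Pi\<^sub>M B (\<lambda>_. M)) (\<lambda>w. \<lambda>b\<in>B. w (?g b)) = Pi\<^sub>M B (\<lambda>_. M)"
  proof (rule PiM_eqI)
    fix X assume X: "\<And>i. i \<in> B \<Longrightarrow> X i \<in> sets M"
    have sub: "X i \<subseteq> space M" if "i \<in> B" for i using X[OF that] sets.sets_into_space by auto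
    have "(\<lambda>w. \<lambda>b\<in>B. w (?g b)) -` Pi\<^sub>E B X \<inter> space (Pi\<^sub>M A (\<lambda>_. M)) = Pi\<^sub>E A (\<lambda>a. X (h a))"
    proof (intro equalityI subsetI)
      fix w assume "w \<in> (\<lambda>w. \<lambda>b\<in>B. w (?g b)) -` Pi\<^sub>E B X \<inter> space (Pi\<^sub>M A (\<lambda>_. M))"
      then have w: "\<And>b. b \<in> B \<Longrightarrow> w (?g b) \<in> X b" and e: "w \<in> extensional A"
        by (auto simp: PiE_iff space_PiM)
      show "w \<in> Pi\<^sub>E A (\<lambda>a. X (h a))" using w[OF hh(1)] hh(2) e by (auto simp: PiE_iff)
    next
      fix w assume w: "w \<in> Pi\<^sub>E A (\<lambda>a. X (h a))"
      have "w (?g b) \<in> X b" if "b \<in> B" for b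
        using w g[OF that] hg[OF that] by (fastforce simp: PiE_iff)
      moreover have "w a \<in> space M" if "a \<in> A" for a
        using w that sub[OF hh(1)[OF that]] by (auto simp: PiE_iff)
      ultimately show "w \<in> (\<lambda>w. \<lambda>b\<in>B. w (?g b)) -` Pi\<^sub>E B X \<inter> space (Pi\<^sub>M A (\<lambda>_. M))"
        using w by (auto simp: PiE_iff space_PiM)
    qed
    then have "emeasure (distr (Pi\<^sub>M A (\<lambda>_. M)) (Pi\<^sub>M B (\<lambda>_. M)) (\<lambda>w. \<lambda>b\<in>B. w (?g b))) (Pi\<^sub>E B X)
       = emeasure (Pi\<^sub>M A (\<lambda>_. M)) (Pi\<^sub>E A (\<lambda>a. X (h a)))"
      using X B m by (subst emeasure_distr) auto
    also have "\<dots> = (\<Prod>a\<in>A. emeasure M (X (h a)))"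
      using X hh A by (subst emeasure_PiM) auto
    also have "\<dots> = (\<Prod>b\<in>B. emeasure M (X b))"
      by (rule prod.reindex_bij_betw[OF h])
    finally show "emeasure (distr (Pi\<^sub>M A (\<lambda>_. M)) (Pi\<^sub>M B (\<lambda>_. M)) (\<lambda>w. \<lambda>b\<in>B. w (?g b))) (Pi\<^sub>E B X)
      = (\<Prod>b\<in>B. emeasure M (X b))" .
  qed (use B in auto)
  then show ?thesis using m f by (metis (no_types, lifting) nn_integral_cong nn_integral_distr)
qed

text \<open>\<open>D i\<close> is the reciprocal Jacobian of \<open>T i\<close>. By Fubini one
  coordinate is substituted with the others fixed, and the induction hypothesis treats the rest.
  Applied to the rows of a matrix and to the independent entries of a symmetric matrix.\<close>

lemma nn_integral_PiM_componentwise: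
  fixes D :: "'i \<Rightarrow> ennreal"
  assumes M: "\<And>i. sigma_finite_measure (M i)"
    and T: "\<And>i. i \<in> J \<Longrightarrow> T i \<in> M i \<rightarrow>\<^sub>M M i"
    and D: "\<And>i g. i \<in> J \<Longrightarrow> g \<in> borel_measurable (M i) \<Longrightarrow> (\<integral>\<^sup>+x. g (T i x) \<partial>M i) = D i * (\<integral>\<^sup>+x. g x \<partial>M i)"
    and J: "finite J"
    and f: "f \<in> borel_measurable (Pi\<^sub>M J M)"
  shows "(\<integral>\<^sup>+w. f (\<lambda>i\<in>J. T i (w i)) \<partial>Pi\<^sub>M J M) = (\<Prod>i\<in>J. D i) * (\<integral>\<^sup>+w. f w \<partial>Pi\<^sub>M J M)"
  using J T D f
proof (induction J arbitrary: f)
  case empty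
  then show ?case by (simp add: restrict_def PiM_empty nn_integral_count_space_finite)
next
  case (insert a J)
  interpret product_sigma_finite M using M by (simp add: product_sigma_finite_def)
  interpret J: sigma_finite_measure "Pi\<^sub>M J M" by (rule sigma_finite) fact
  interpret a: sigma_finite_measure "M a" by (rule M)
  note [measurable] = insert.prems(3)
  have [measurable]: "T a \<in> M a \<rightarrow>\<^sub>M M a" using insert.prems(1) by simp
  have Tm: "(\<lambda>w. \<lambda>i\<in>insert a J. T i (w i)) \<in> Pi\<^sub>M (insert a J) M \<rightarrow>\<^sub>M Pi\<^sub>M (insert a J) M"
    by (rule measurable_restrict, rule measurable_compose[OF measurable_component_singleton])
       (auto intro: insert.prems(1))
  have TJ: "(\<lambda>w. \<lambda>i\<in>J. T i (w i)) \<in> Pi\<^sub>M J M \<rightarrow>\<^sub>M Pi\<^sub>M J M"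
    by (rule measurable_restrict, rule measurable_compose[OF measurable_component_singleton])
       (auto intro: insert.prems(1))
  have fm: "(\<lambda>(w, y). f (w(a := y))) \<in> borel_measurable (Pi\<^sub>M J M \<Otimes>\<^sub>M M a)"
    by measurable
  have "(\<integral>\<^sup>+w. f (\<lambda>i\<in>insert a J. T i (w i)) \<partial>Pi\<^sub>M (insert a J) M)
      = (\<integral>\<^sup>+w. \<integral>\<^sup>+y. f (\<lambda>i\<in>insert a J. T i ((w(a := y)) i)) \<partial>M a \<partial>Pi\<^sub>M J M)"
    using insert.hyps Tm by (subst product_nn_integral_insert) auto
  also have "\<dots> = (\<integral>\<^sup>+w. \<integral>\<^sup>+y. f ((\<lambda>i\<in>J. T i (w i))(a := T a y)) \<partial>M a \<partial>Pi\<^sub>M J M)"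
    using insert.hyps(2)
    by (intro nn_integral_cong arg_cong[where f=f]) (auto simp: fun_eq_iff restrict_def)
  also have "\<dots> = (\<integral>\<^sup>+w. D a * (\<integral>\<^sup>+y. f ((\<lambda>i\<in>J. T i (w i))(a := y)) \<partial>M a) \<partial>Pi\<^sub>M J M)"
  proof (intro nn_integral_cong)
    fix w assume "w \<in> space (Pi\<^sub>M J M)"
    then have "(\<lambda>i\<in>J. T i (w i)) \<in> space (Pi\<^sub>M J M)" using TJ by (auto dest: measurable_space)
    then have "(\<lambda>y. f ((\<lambda>i\<in>J. T i (w i))(a := y))) \<in> borel_measurable (M a)"
      using measurable_compose[OF measurable_component_update[OF _ insert.hyps(2)] insert.prems(3)] by simp
    from insert.prems(2)[OF _ this] show "(\<integral>\<^sup>+y. f ((\<lambda>i\<in>J. T i (w i))(a := T a y)) \<partial>M a)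
       = D a * (\<integral>\<^sup>+y. f ((\<lambda>i\<in>J. T i (w i))(a := y)) \<partial>M a)" by simp
  qed
  also have "\<dots> = D a * (\<integral>\<^sup>+w. (\<integral>\<^sup>+y. f ((\<lambda>i\<in>J. T i (w i))(a := y)) \<partial>M a) \<partial>Pi\<^sub>M J M)"
    using measurable_compose[OF TJ sigma_finite_measure.borel_measurable_nn_integral[OF M fm]]
    by (subst nn_integral_cmult) simp_all
  also have "(\<integral>\<^sup>+w. (\<integral>\<^sup>+y. f ((\<lambda>i\<in>J. T i (w i))(a := y)) \<partial>M a) \<partial>Pi\<^sub>M J M)
     = (\<Prod>i\<in>J. D i) * (\<integral>\<^sup>+w. (\<integral>\<^sup>+y. f (w(a := y)) \<partial>M a) \<partial>Pi\<^sub>M J M)"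
    using sigma_finite_measure.borel_measurable_nn_integral[OF M fm] insert.prems(1,2)
    by (intro insert.IH) (simp_all del: fun_upd_apply)
  also have "(\<integral>\<^sup>+w. (\<integral>\<^sup>+y. f (w(a := y)) \<partial>M a) \<partial>Pi\<^sub>M J M) = (\<integral>\<^sup>+w. f w \<partial>Pi\<^sub>M (insert a J) M)"
    using insert.hyps by (subst product_nn_integral_insert) auto
  finally show ?case using insert.hyps by (simp add: mult.assoc)
qed

lemma nn_integral_lborel_vec_componentwise:
  fixes f :: "'b::euclidean_space^'n \<Rightarrow> ennreal" and D :: "'n \<Rightarrow> ennreal" and T :: "'n \<Rightarrow> 'b \<Rightarrow> 'b"
  assumes T: "\<And>i. T i \<in> borel \<rightarrow>\<^sub>M borel"
    and D: "\<And>i g. g \<in> borel_measurable borel \<Longrightarrow> (\<integral>\<^sup>+x. g (T i x) \<partial>lborel) = D i * (\<integral>\<^sup>+x. g x \<partial>lborel)"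
    and f[measurable]: "f \<in> borel_measurable borel"
  shows "(\<integral>\<^sup>+x. f (\<chi> i. T i (x $ i)) \<partial>lborel) = (\<Prod>i\<in>UNIV. D i) * (\<integral>\<^sup>+x. f x \<partial>lborel)"
proof -
  note [measurable] = T
  have [measurable]: "(vec_lambda :: ('n \<Rightarrow> 'b) \<Rightarrow> _) \<in> borel_measurable (Pi\<^sub>M UNIV (\<lambda>_. lborel))"
    by (rule borel_measurable_vec_lambda) simp
  have "(\<integral>\<^sup>+x. f (\<chi> i. T i (x $ i)) \<partial>lborel)
      = (\<integral>\<^sup>+w. f (vec_lambda (\<lambda>i\<in>UNIV. T i (w i))) \<partial>Pi\<^sub>M UNIV (\<lambda>_. lborel))"
    by (subst nn_integral_lborel_vec) (auto simp: restrict_def)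
  also have "\<dots> = (\<Prod>i\<in>UNIV. D i) * (\<integral>\<^sup>+w. f (vec_lambda w) \<partial>Pi\<^sub>M UNIV (\<lambda>_. lborel))"
    by (rule nn_integral_PiM_componentwise[where M="\<lambda>_. lborel" and J=UNIV and T=T and D=D and f="\<lambda>w. f (vec_lambda w)"]) (auto intro: T D lborel.sigma_finite_measure_axioms)
  finally show ?thesis by (simp add: nn_integral_lborel_vec)
qed

lemma nn_integral_lborel_vec_split:
  fixes f :: "'b::euclidean_space^'n \<Rightarrow> ennreal"
  assumes [measurable]: "f \<in> borel_measurable borel"
  shows "(\<integral>\<^sup>+x. f x \<partial>lborel) = (\<integral>\<^sup>+w. \<integral>\<^sup>+z. f (\<chi> i. if i \<in> J then w i else z i)
      \<partial>Pi\<^sub>M (- J) (\<lambda>_. lborel) \<partial>Pi\<^sub>M J (\<lambda>_. lborel))"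
proof -
  interpret product_sigma_finite "\<lambda>_ :: 'n. lborel :: 'b measure" by standard
  have [measurable]: "(vec_lambda :: ('n \<Rightarrow> 'b) \<Rightarrow> _) \<in> borel_measurable (Pi\<^sub>M UNIV (\<lambda>_. lborel))"
    by (rule borel_measurable_vec_lambda) simp
  have J: "J \<union> - J = UNIV" by auto
  have m: "(\<lambda>w. f (vec_lambda w)) \<in> borel_measurable (Pi\<^sub>M (J \<union> - J) (\<lambda>_. lborel))"
    unfolding J by measurable
  have "(\<integral>\<^sup>+x. f x \<partial>lborel) = (\<integral>\<^sup>+w. f (vec_lambda w) \<partial>Pi\<^sub>M (J \<union> - J) (\<lambda>_. lborel))"
    unfolding J by (rule nn_integral_lborel_vec) simp
  also have "\<dots> = (\<integral>\<^sup>+w. \<integral>\<^sup>+z. f (vec_lambda (merge J (- J) (w, z)))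
      \<partial>Pi\<^sub>M (- J) (\<lambda>_. lborel) \<partial>Pi\<^sub>M J (\<lambda>_. lborel))"
    using m by (subst product_nn_integral_fold) auto
  also have "\<dots> = (\<integral>\<^sup>+w. \<integral>\<^sup>+z. f (\<chi> i. if i \<in> J then w i else z i)
      \<partial>Pi\<^sub>M (- J) (\<lambda>_. lborel) \<partial>Pi\<^sub>M J (\<lambda>_. lborel))"
    by (intro nn_integral_cong arg_cong[where f=f]) (auto simp: merge_def vec_eq_iff)
  finally show ?thesis .
qed

section \<open>Linear substitutions in nonnegative integrals\<close>

lemma nn_integral_lborel_scale:
  fixes f :: "real \<Rightarrow> ennreal"
  assumes [measurable]: "f \<in> borel_measurable borel" and c: "c \<noteq> 0"
  shows "(\<integral>\<^sup>+x. f (c * x) \<partial>lborel) = ennreal (1 / \<bar>c\<bar>) * (\<integral>\<^sup>+x. f x \<partial>lborel)"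
proof -
  have "(\<integral>\<^sup>+x. f x \<partial>lborel) = ennreal \<bar>c\<bar> * (\<integral>\<^sup>+x. f (c * x) \<partial>lborel)"
    using nn_integral_real_affine[of f c 0] c by simp
  then have "ennreal (1 / \<bar>c\<bar>) * (\<integral>\<^sup>+x. f x \<partial>lborel)
      = ennreal (1 / \<bar>c\<bar> * \<bar>c\<bar>) * (\<integral>\<^sup>+x. f (c * x) \<partial>lborel)"
    by (simp only: ennreal_mult mult.assoc abs_ge_zero zero_le_divide_1_iff)
  then show ?thesis using c by simp
qed

text \<open>The claim is multiplicative in \<open>A\<close>, which reduces it to generating
  matrices. A zero row is excluded by the determinant, a diagonal matrix scales each coordinate, a
  swap permutes the factors of the product measure, and a shear is a translation of one coordinate
  while the others are held fixed.\<close>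

lemma nn_integral_lborel_matrix:
  fixes A :: "real^'n^'n" and f :: "real^'n \<Rightarrow> ennreal"
  assumes "det A \<noteq> 0" and f: "f \<in> borel_measurable borel"
  shows "(\<integral>\<^sup>+x. f x \<partial>lborel) = ennreal \<bar>det A\<bar> * (\<integral>\<^sup>+x. f (A *v x) \<partial>lborel)"
proof -
  have Am: "(*v) A \<in> borel_measurable borel" for A :: "real^'n^'n"
    by (intro borel_measurable_continuous_onI) (auto intro: linear_continuous_on matrix_vector_mul_bounded_linear)
  have "det A \<noteq> 0 \<longrightarrow> (\<forall>f \<in> borel_measurable borel.
      (\<integral>\<^sup>+x. f x \<partial>lborel) = ennreal \<bar>det A\<bar> * (\<integral>\<^sup>+x. f (A *v x) \<partial>lborel))"
  proof (induction A rule: induct_matrix_elementary_alt)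
    case (1 A B)
    show ?case
    proof (intro impI ballI)
      fix f :: "real^'n \<Rightarrow> ennreal" assume d: "det (A ** B) \<noteq> 0" and f: "f \<in> borel_measurable borel"
      have fA: "(\<lambda>x. f (A *v x)) \<in> borel_measurable borel"
        by (rule measurable_compose[OF Am f])
      have "(\<integral>\<^sup>+x. f x \<partial>lborel) = ennreal \<bar>det A\<bar> * (\<integral>\<^sup>+x. f (A *v x) \<partial>lborel)"
        using 1(1) d f by (simp add: det_mul)
      also have "(\<integral>\<^sup>+x. f (A *v x) \<partial>lborel) = ennreal \<bar>det B\<bar> * (\<integral>\<^sup>+x. f (A *v (B *v x)) \<partial>lborel)"
        using 1(2) d fA by (simp add: det_mul)
      finally show "(\<integral>\<^sup>+x. f x \<partial>lborel) = ennreal \<bar>det (A ** B)\<bar> * (\<integral>\<^sup>+x. f (A ** B *v x) \<partial>lborel)"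
        by (simp add: det_mul abs_mult ennreal_mult matrix_vector_mul_assoc mult.assoc)
    qed
  next
    case (2 A i)
    then show ?case using det_zero_row(2)[of i A] by simp
  next
    case (3 A)
    show ?case
    proof (intro impI ballI)
      fix f :: "real^'n \<Rightarrow> ennreal" assume d: "det A \<noteq> 0" and [measurable]: "f \<in> borel_measurable borel"
      have dA: "det A = (\<Prod>i\<in>UNIV. A $ i $ i)" using 3 by (intro det_diagonal) auto
      then have nz: "A $ i $ i \<noteq> 0" for i using d by (auto simp: prod_zero_iff)
      have "A *v x = (\<chi> i. A $ i $ i * x $ i)" for x
      proof -
        have "(\<Sum>j\<in>UNIV. A $ i $ j * x $ j) = (\<Sum>j\<in>UNIV. if j = i then A $ i $ j * x $ j else 0)" for i
          using 3 by (intro sum.cong) auto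
        then show ?thesis by (simp add: vec_eq_iff matrix_vector_mult_def)
      qed
      then have "(\<integral>\<^sup>+x. f (A *v x) \<partial>lborel) = (\<integral>\<^sup>+x. f (\<chi> i. A $ i $ i * x $ i) \<partial>lborel)"
        by simp
      also have "\<dots> = (\<Prod>i\<in>UNIV. ennreal (1 / \<bar>A $ i $ i\<bar>)) * (\<integral>\<^sup>+x. f x \<partial>lborel)"
        using nz by (intro nn_integral_lborel_vec_componentwise[where T="\<lambda>i y. A $ i $ i * y"]
            nn_integral_lborel_scale) auto
      also have "(\<Prod>i\<in>UNIV. ennreal (1 / \<bar>A $ i $ i\<bar>)) = ennreal (1 / \<bar>det A\<bar>)"
        by (subst prod_ennreal) (auto simp: dA prod_dividef abs_prod)
      finally have "ennreal \<bar>det A\<bar> * (\<integral>\<^sup>+x. f (A *v x) \<partial>lborel)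
          = ennreal (\<bar>det A\<bar> * (1 / \<bar>det A\<bar>)) * (\<integral>\<^sup>+x. f x \<partial>lborel)"
        by (simp only: ennreal_mult mult.assoc abs_ge_zero zero_le_divide_1_iff)
      then show "(\<integral>\<^sup>+x. f x \<partial>lborel) = ennreal \<bar>det A\<bar> * (\<integral>\<^sup>+x. f (A *v x) \<partial>lborel)"
        using d by simp
    qed
  next
    case (4 m n)
    let ?A = "(\<chi> i j. mat 1 $ i $ Transposition.transpose m n j) :: real^'n^'n"
    have Ax: "?A *v x = (\<chi> i. x $ Transposition.transpose m n i)" for x
    proof -
      have "(\<Sum>j\<in>UNIV. mat 1 $ i $ Transposition.transpose m n j * x $ j)
          = (\<Sum>j\<in>UNIV. if j = Transposition.transpose m n i then x $ j else 0)" for i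
        by (intro sum.cong) (auto simp: mat_def)
      then show ?thesis by (simp add: vec_eq_iff matrix_vector_mult_def)
    qed
    have "\<bar>det ?A\<bar> = 1"
      using det_permute_columns[OF permutes_swap_id[of m UNIV n], of "mat 1 :: real^'n^'n"] by (simp add: sign_def)
    moreover have "(\<integral>\<^sup>+x. f x \<partial>lborel) = (\<integral>\<^sup>+x. f (?A *v x) \<partial>lborel)"
      if [measurable]: "f \<in> borel_measurable borel" for f :: "real^'n \<Rightarrow> ennreal"
    proof -
      have [measurable]: "(vec_lambda :: ('n \<Rightarrow> real) \<Rightarrow> _) \<in> borel_measurable (Pi\<^sub>M UNIV (\<lambda>_. lborel))"
        by (rule borel_measurable_vec_lambda) simp
      have "(\<integral>\<^sup>+x. f x \<partial>lborel) = (\<integral>\<^sup>+w. f (vec_lambda w) \<partial>Pi\<^sub>M UNIV (\<lambda>_. lborel))"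
        by (rule nn_integral_lborel_vec) simp
      also have "\<dots> = (\<integral>\<^sup>+w. f (vec_lambda (\<lambda>b\<in>UNIV. w (inv_into UNIV (Transposition.transpose m n) b)))
           \<partial>Pi\<^sub>M UNIV (\<lambda>_. lborel))"
        by (rule nn_integral_PiM_reindex) (auto intro: lborel.sigma_finite_measure_axioms)
      also have "\<dots> = (\<integral>\<^sup>+x. f (\<chi> i. x $ Transposition.transpose m n i) \<partial>lborel)"
        by (subst nn_integral_lborel_vec) (auto simp: restrict_def)
      finally show ?thesis by (simp add: Ax)
    qed
    ultimately show ?case by simp
  next
    case (5 m n)
    let ?A = "(\<chi> i j. of_bool (i = m \<and> j = n \<or> i = j)) :: real^'n^'n"
    have Ax: "?A *v x = (\<chi> i. if i = m then x $ m + x $ n else x $ i)" for x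
    proof -
      have "(\<Sum>j\<in>UNIV. of_bool (i = m \<and> j = n \<or> i = j) * x $ j)
         = (\<Sum>j\<in>UNIV. (if j = n then if i = m then x $ j else 0 else 0) + (if j = i then x $ j else 0))" for i
        using 5 by (intro sum.cong) auto
      then show ?thesis by (auto simp: vec_eq_iff matrix_vector_mult_def sum.distrib)
    qed
    have A: "?A = (\<chi> k. if k = m then row m (mat 1) + 1 *s row n (mat 1) else row k (mat 1))"
      using 5 by (auto simp: vec_eq_iff row_def mat_def)
    have "det ?A = 1"
      using det_row_operation[OF 5, of "mat 1 :: real^'n^'n" 1] unfolding A by simp
    moreover have "(\<integral>\<^sup>+x. f x \<partial>lborel) = (\<integral>\<^sup>+x. f (?A *v x) \<partial>lborel)"
      if [measurable]: "f \<in> borel_measurable borel" for f :: "real^'n \<Rightarrow> ennreal"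
    proof -
      have [measurable]: "(vec_lambda :: ('n \<Rightarrow> real) \<Rightarrow> _) \<in> borel_measurable (Pi\<^sub>M UNIV (\<lambda>_. lborel))"
        by (rule borel_measurable_vec_lambda) simp
      interpret product_sigma_finite "\<lambda>_ :: 'n. lborel :: real measure" by standard
      have U: "UNIV = insert m (UNIV - {m})" by auto
      have "(\<integral>\<^sup>+x. f (?A *v x) \<partial>lborel) = (\<integral>\<^sup>+w. f (\<chi> i. if i = m then w m + w n else w i) \<partial>Pi\<^sub>M UNIV (\<lambda>_. lborel))"
        unfolding Ax by (subst nn_integral_lborel_vec) (auto cong: if_cong)
      also have "\<dots> = (\<integral>\<^sup>+w. \<integral>\<^sup>+y. f (\<chi> i. if i = m then w n + 1 * y else w i) \<partial>lborel \<partial>Pi\<^sub>M (UNIV - {m}) (\<lambda>_. lborel))"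
        using 5 by (subst U, subst product_nn_integral_insert)
          (auto simp: U[symmetric] intro!: nn_integral_cong arg_cong[where f=f] simp: vec_eq_iff)
      also have "\<dots> = (\<integral>\<^sup>+w. \<integral>\<^sup>+y. f (\<chi> i. if i = m then y else w i) \<partial>lborel \<partial>Pi\<^sub>M (UNIV - {m}) (\<lambda>_. lborel))"
      proof (rule nn_integral_cong)
        fix w :: "'n \<Rightarrow> real"
        have "(\<lambda>y. f (\<chi> i. if i = m then y else w i)) \<in> borel_measurable borel" by measurable
        from nn_integral_real_affine[OF this, of 1 "w n"]
        show "(\<integral>\<^sup>+y. f (\<chi> i. if i = m then w n + 1 * y else w i) \<partial>lborel)
          = (\<integral>\<^sup>+y. f (\<chi> i. if i = m then y else w i) \<partial>lborel)" by simp
      qed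
      also have "\<dots> = (\<integral>\<^sup>+w. f (vec_lambda w) \<partial>Pi\<^sub>M UNIV (\<lambda>_. lborel))"
        by (subst U, subst product_nn_integral_insert)
          (auto simp: U[symmetric] intro!: nn_integral_cong arg_cong[where f=f] simp: vec_eq_iff)
      also have "\<dots> = (\<integral>\<^sup>+x. f x \<partial>lborel)" by (subst nn_integral_lborel_vec) auto
      finally show ?thesis ..
    qed
    ultimately show ?case by simp
  qed
  then show ?thesis using assms by blast
qed

section \<open>Positive definite matrices\<close>

lemma inner_matrix_vector_transpose: "(A *v x) \<bullet> y = x \<bullet> (transpose A *v y)"
  for A :: "real^'m^'n"
  by (metis dot_lmul_matrix transpose_matrix_vector inner_commute)

lemma posdef_cone_symmetric: "r \<in> posdef_cone \<Longrightarrow> r $ i $ j = r $ j $ i"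
  by (auto simp: posdef_cone_def transpose_def vec_eq_iff)

lemma posdef_cone_det_nonzero:
  fixes r :: "real^'m^'m"
  assumes "r \<in> posdef_cone" shows "det r \<noteq> 0"
proof
  assume "det r = 0"
  then have "\<not> (\<exists>B. B ** r = mat 1)" using invertible_det_nz invertible_left_inverse by blast
  then obtain x where "x \<noteq> 0" "r *v x = 0" by (auto simp: matrix_left_invertible_ker)
  then show False using assms by (force simp: posdef_cone_def)
qed

text \<open>Two closed conditions and an open one, which makes the cone a Borel set. For the
  inclusion from right to left: if a nonnegative form vanished at x although y = r x is nonzero, a
  small step from x in direction -y would make it negative.\<close>

lemma posdef_cone_alt:
  "posdef_cone = {r :: real^'m^'m. transpose r = r} \<inter> {r. \<forall>x. 0 \<le> x \<bullet> (r *v x)} \<inter> {r. det r \<noteq> 0}"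
proof (intro equalityI subsetI)
  fix r :: "real^'m^'m" assume r: "r \<in> posdef_cone"
  then have "0 \<le> x \<bullet> (r *v x)" for x by (cases "x = 0") (auto simp: posdef_cone_def less_imp_le)
  with r show "r \<in> {r. transpose r = r} \<inter> {r. \<forall>x. 0 \<le> x \<bullet> (r *v x)} \<inter> {r. det r \<noteq> 0}"
    by (simp add: posdef_cone_det_nonzero) (simp add: posdef_cone_def)
next
  fix r :: "real^'m^'m"
  assume "r \<in> {r. transpose r = r} \<inter> {r. \<forall>x. 0 \<le> x \<bullet> (r *v x)} \<inter> {r. det r \<noteq> 0}"
  then have s: "transpose r = r" and p: "\<And>x. 0 \<le> x \<bullet> (r *v x)" and d: "det r \<noteq> 0" by auto
  have "0 < x \<bullet> (r *v x)" if "x \<noteq> 0" for x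
  proof (rule ccontr)
    assume "\<not> 0 < x \<bullet> (r *v x)"
    then have x0: "x \<bullet> (r *v x) = 0" using p[of x] by simp
    define y where "y = r *v x"
    have yn: "y \<noteq> 0"
      using d that unfolding y_def by (metis invertible_det_nz invertible_left_inverse matrix_left_invertible_ker)
    \<comment> \<open>The form at x - t y equals t (t y'ry - 2 |y|^2), so t must satisfy t y'ry < 2
      |y|^2. The summand 1 keeps the denominator positive when y'ry = 0.\<close>
    define t where "t = (y \<bullet> y) / (y \<bullet> (r *v y) + 1)"
    have den: "0 < y \<bullet> (r *v y) + 1" using p[of y] by simp
    have t: "0 < t" unfolding t_def using yn den by simp
    have e1: "x \<bullet> (r *v y) = y \<bullet> y"
      using inner_matrix_vector_transpose[of r x y] s by (simp add: y_def inner_commute)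
    have "(x - t *\<^sub>R y) \<bullet> (r *v (x - t *\<^sub>R y)) = t * (t * (y \<bullet> (r *v y)) - 2 * (y \<bullet> y))"
      using x0 e1 by (simp add: matrix_vector_mult_diff_distrib matrix_vector_mult_scaleR inner_diff_left
          inner_diff_right y_def[symmetric] algebra_simps)
    also have "\<dots> < 0"
    proof -
      have "t * (y \<bullet> (r *v y)) < t * (y \<bullet> (r *v y) + 1)" using t by simp
      also have "\<dots> = y \<bullet> y" unfolding t_def using den by simp
      finally have "t * (y \<bullet> (r *v y)) - 2 * (y \<bullet> y) < 0" using inner_ge_zero[of y] by linarith
      then show ?thesis using t by (simp add: mult_pos_neg)
    qed
    finally show False using p[of "x - t *\<^sub>R y"] by simp
  qed
  then show "r \<in> posdef_cone" using s by (simp add: posdef_cone_def)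
qed

lemma continuous_on_det [continuous_intros]:
  fixes f :: "'a::topological_space \<Rightarrow> real^'m^'m"
  assumes "continuous_on S f" shows "continuous_on S (\<lambda>x. det (f x))"
  unfolding det_def using assms by (intro continuous_intros)

lemma continuous_on_matrix_mult [continuous_intros]:
  fixes f :: "'a::topological_space \<Rightarrow> real^'m^'n" and g :: "'a \<Rightarrow> real^'p^'m"
  assumes "continuous_on S f" "continuous_on S g" shows "continuous_on S (\<lambda>x. f x ** g x)"
  unfolding matrix_matrix_mult_def using assms by (intro continuous_intros)

lemma continuous_on_transpose [continuous_intros]:
  fixes f :: "'a::topological_space \<Rightarrow> real^'m^'n"
  assumes "continuous_on S f" shows "continuous_on S (\<lambda>x. transpose (f x))"
  unfolding transpose_def using assms by (intro continuous_intros)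

lemma continuous_on_matrix_vector_mult [continuous_intros]:
  fixes f :: "'a::topological_space \<Rightarrow> real^'m^'n" and g :: "'a \<Rightarrow> real^'m"
  assumes "continuous_on S f" "continuous_on S g" shows "continuous_on S (\<lambda>x. f x *v g x)"
  unfolding matrix_vector_mult_def using assms by (intro continuous_intros)

lemma borel_measurable_det [measurable (raw)]:
  fixes f :: "'a \<Rightarrow> real^'m^'m"
  assumes "f \<in> borel_measurable M" shows "(\<lambda>x. det (f x)) \<in> borel_measurable M"
  by (rule borel_measurable_continuous_on[OF _ assms]) (intro continuous_intros)

lemma borel_measurable_matrix_mult [measurable (raw)]:
  fixes f :: "'a \<Rightarrow> real^'m^'n" and g :: "'a \<Rightarrow> real^'p^'m"
  assumes "f \<in> borel_measurable M" "g \<in> borel_measurable M" shows "(\<lambda>x. f x ** g x) \<in> borel_measurable M"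
  by (rule borel_measurable_continuous_Pair[OF assms]) (intro continuous_intros)

lemma borel_measurable_transpose [measurable (raw)]:
  fixes f :: "'a \<Rightarrow> real^'m^'n"
  assumes "f \<in> borel_measurable M" shows "(\<lambda>x. transpose (f x)) \<in> borel_measurable M"
  by (rule borel_measurable_continuous_on[OF _ assms]) (intro continuous_intros)

lemma posdef_cone_borel [measurable]: "(posdef_cone :: (real^'m^'m) set) \<in> sets borel"
proof -
  have "closed {r :: real^'m^'m. transpose r = r}"
    by (rule closed_Collect_eq; intro continuous_intros)
  moreover have "closed {r :: real^'m^'m. \<forall>x. 0 \<le> x \<bullet> (r *v x)}"
    by (rule closed_Collect_all, rule closed_Collect_le; intro continuous_intros)
  moreover have "open {r :: real^'m^'m. det r \<noteq> 0}"
    by (rule open_Collect_neq; intro continuous_intros)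
  ultimately show ?thesis unfolding posdef_cone_alt by (intro sets.Int borel_closed borel_open) auto
qed

lemma quadratic_form_congruence:
  "x \<bullet> ((transpose A ** r ** A) *v x) = (A *v x) \<bullet> (r *v (A *v x))" for A :: "real^'m^'n"
  by (simp add: inner_matrix_vector_transpose matrix_vector_mul_assoc matrix_mul_assoc)

lemma posdef_cone_congruence:
  fixes A :: "real^'m^'m"
  assumes "det A \<noteq> 0"
  shows "transpose A ** r ** A \<in> posdef_cone \<longleftrightarrow> r \<in> posdef_cone"
proof -
  have imp: "transpose A ** r ** A \<in> posdef_cone" if "det A \<noteq> 0" "r \<in> posdef_cone" for A r :: "real^'m^'m"
  proof -
    have "A *v x \<noteq> 0" if "x \<noteq> 0" for x
      using \<open>det A \<noteq> 0\<close> that by (metis invertible_det_nz invertible_left_inverse matrix_left_invertible_ker)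
    then show ?thesis
      using that(2) unfolding posdef_cone_def
      by (simp add: quadratic_form_congruence) (simp add: matrix_transpose_mul matrix_mul_assoc)
  qed
  obtain B where B: "A ** B = mat 1" "B ** A = mat 1"
    using assms invertible_det_nz unfolding invertible_def by blast
  have "det B \<noteq> 0" using B(1) by (metis det_I det_mul mult_zero_right zero_neq_one)
  have "r = transpose B ** (transpose A ** r ** A) ** B"
    by (metis B(1) matrix_mul_assoc matrix_mul_lid matrix_mul_rid matrix_transpose_mul transpose_mat)
  with imp[OF \<open>det B \<noteq> 0\<close>] imp[OF assms] show ?thesis by metis
qed

lemma matrix_inv_right:
  fixes A :: "real^'n^'n"
  assumes "det A \<noteq> 0" shows "A ** matrix_inv A = mat 1"
  using assms someI_ex[of "\<lambda>B. A ** B = mat 1 \<and> B ** A = mat 1"]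
  by (auto simp: invertible_det_nz[symmetric] invertible_def matrix_inv_def)

text \<open>Row \<open>a\<close> of \<open>G\<close> is a unit row, an empty slot that
  \<open>G'\<close> fills with the border \<beta> and the corner s. With y = G^-1 \<beta> and U = I
  + y e_a' one gets G' = U' D U, where D is \<open>G\<close> with corner s - Q. As det U = 1,
  positivity and determinant can be read off from D.\<close>

lemma
  fixes G :: "real^'k^'k" and \<beta> :: "real^'k"
  assumes G: "G \<in> posdef_cone" and Ga: "\<And>j. G $ a $ j = (if j = a then 1 else 0)"
    and \<beta>: "\<beta> $ a = 0"
    and G': "G' = (\<chi> i j. if i = a \<and> j = a then s else if i = a then \<beta> $ j else if j = a then \<beta> $ i else G $ i $ j)"
    and Q: "Q = \<beta> \<bullet> (matrix_inv G *v \<beta>)"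
  shows schur_complement_posdef: "G' \<in> posdef_cone \<longleftrightarrow> Q < s"
    and schur_complement_det: "det G' = det G * (s - Q)"
proof -
  have Ga': "G $ j $ a = (if j = a then 1 else 0)" for j
    using Ga posdef_cone_symmetric[OF G] by metis
  define y where "y = matrix_inv G *v \<beta>"
  have Gy: "G *v y = \<beta>" unfolding y_def
    using G by (simp add: matrix_vector_mul_assoc matrix_inv_right posdef_cone_det_nonzero)
  have "(\<Sum>j\<in>UNIV. G $ a $ j * y $ j) = y $ a" by (simp add: Ga if_distrib[of "\<lambda>c. c * _"] cong: if_cong)
  \<comment> \<open>Row \<open>a\<close> of G y = \<beta> says that y_a = \<beta>_a = 0. Hence
    changing the corner of \<open>G\<close> to s - Q does not affect the product with y.\<close>
  then have ya: "y $ a = 0" using Gy \<beta> by (auto simp: matrix_vector_mult_def vec_eq_iff)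
  have Gyi: "(\<Sum>j\<in>UNIV. G $ i $ j * y $ j) = \<beta> $ i" for i
    using Gy by (auto simp: matrix_vector_mult_def vec_eq_iff)
  have Qy: "(\<Sum>j\<in>UNIV. y $ j * \<beta> $ j) = Q" by (simp add: Q y_def[symmetric] inner_vec_def mult.commute)
  define U :: "real^'k^'k" where "U = (\<chi> i j. (if i = j then 1 else 0) + (if j = a then y $ i else 0))"
  define D :: "real^'k^'k" where "D = (\<chi> i j. if i = a \<and> j = a then s - Q else G $ i $ j)"
  have Dy: "(\<Sum>j\<in>UNIV. D $ i $ j * y $ j) = \<beta> $ i" for i
    unfolding Gyi[symmetric] by (intro sum.cong) (auto simp: D_def ya)
  have Dy': "(\<Sum>j\<in>UNIV. y $ j * D $ j $ i) = \<beta> $ i" for i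
    unfolding Gyi[symmetric] by (intro sum.cong) (auto simp: D_def ya posdef_cone_symmetric[OF G])
  have DU: "(D ** U) $ i $ j = D $ i $ j + (if j = a then \<beta> $ i else 0)" for i j
  proof -
    have "(D ** U) $ i $ j = (\<Sum>k\<in>UNIV. (if k = j then D $ i $ k else 0) + (if j = a then D $ i $ k * y $ k else 0))"
      unfolding matrix_matrix_mult_def U_def by (auto intro!: sum.cong simp: algebra_simps)
    then show ?thesis by (simp add: sum.distrib Dy)
  qed
  have "(transpose U ** (D ** U)) $ i $ j = G' $ i $ j" for i j
  proof -
    have "(transpose U ** M) $ i $ j = (\<Sum>k\<in>UNIV. (if k = i then M $ k $ j else 0)
        + (if i = a then y $ k * M $ k $ j else 0))" for M :: "real^'k^'k"
      unfolding matrix_matrix_mult_def U_def by (auto intro!: sum.cong simp: algebra_simps transpose_def)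
    from this[of "D ** U"] have "(transpose U ** (D ** U)) $ i $ j = (\<Sum>k\<in>UNIV. (if k = i then (D ** U) $ k $ j else 0)
        + (if i = a then y $ k * (D ** U) $ k $ j else 0))" .
    also have "\<dots> = D $ i $ j + (if j = a then \<beta> $ i else 0) + (if i = a then \<beta> $ j + (if j = a then Q else 0) else 0)"
      by (simp add: sum.distrib DU distrib_left Dy' Qy if_distrib[of "\<lambda>c. _ * c"] cong: if_cong)
    also have "\<dots> = G' $ i $ j" using \<beta> by (auto simp: G' D_def Ga Ga')
    finally show ?thesis .
  qed
  then have eq: "G' = transpose U ** D ** U" by (simp add: vec_eq_iff matrix_mul_assoc)
  have "det (transpose U) = 1"
  proof -
    have "transpose U = (\<chi> i. if i = a then row a (mat 1) + y else row i (mat 1))"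
      by (auto simp: U_def transpose_def vec_eq_iff row_def mat_def)
    moreover have "(\<chi> i. if i = a then row a (mat 1) else row i (mat 1)) = (mat 1 :: real^'k^'k)"
      by (auto simp: vec_eq_iff row_def)
    moreover have "det ((\<chi> i. if i = a then y else row i (mat 1)) :: real^'k^'k) = 0"
      by (rule det_zero_column(2)[of a]) (auto simp: column_def vec_eq_iff ya row_def mat_def)
    ultimately show ?thesis by (simp add: det_row_add)
  qed
  then have dU: "det U = 1" by simp
  have "D = (\<chi> i. if i = a then (s - Q) *s row a G else row i G)"
    by (auto simp: D_def vec_eq_iff row_def Ga)
  moreover have "(\<chi> i. if i = a then row a G else row i G) = G" by (auto simp: vec_eq_iff row_def)
  ultimately have dD: "det D = (s - Q) * det G" by (simp add: det_row_mul)
  show "det G' = det G * (s - Q)" by (simp add: eq det_mul dU dD)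
  have "D \<in> posdef_cone \<longleftrightarrow> Q < s"
  proof
    have "D *v axis a 1 = (s - Q) *\<^sub>R axis a 1"
      by (auto simp: vec_eq_iff matrix_vector_mult_def D_def axis_def Ga' if_distrib[of "\<lambda>c. _ * c"] cong: if_cong)
    moreover assume "D \<in> posdef_cone"
    then have "0 < axis a 1 \<bullet> (D *v axis a 1)" by (auto simp: posdef_cone_def axis_eq_0_iff)
    ultimately show "Q < s" by (simp add: inner_axis_axis)
  next
    assume s: "Q < s"
    have "0 < x \<bullet> (D *v x)" if "x \<noteq> 0" for x
    proof -
      define z where "z = x - x $ a *\<^sub>R axis a 1"
      have za: "z $ a = 0" by (simp add: z_def)
      have x: "x = z + x $ a *\<^sub>R axis a 1" by (simp add: z_def)
      have "(\<Sum>j\<in>UNIV. D $ i $ j * x $ j) = (\<Sum>j\<in>UNIV. G $ i $ j * z $ j + (if j = a then (if i = a then (s - Q) * x $ a else 0) else 0))" for i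
        by (intro sum.cong) (auto simp: D_def z_def axis_def Ga')
      then have Dx: "D *v x = G *v z + ((s - Q) * x $ a) *\<^sub>R axis a 1"
        by (auto simp: vec_eq_iff matrix_vector_mult_def sum.distrib axis_def)
      have "(\<Sum>j\<in>UNIV. G $ a $ j * z $ j) = 0" by (simp add: Ga za if_distrib[of "\<lambda>c. c * _"] cong: if_cong)
      then have "(G *v z) $ a = 0" by (simp add: matrix_vector_mult_def)
      then have "x \<bullet> (D *v x) = z \<bullet> (G *v z) + (s - Q) * (x $ a)\<^sup>2"
        unfolding Dx by (subst x) (simp add: inner_add_left inner_add_right inner_axis inner_axis' za
            inner_axis_axis power2_eq_square algebra_simps)
      moreover have "0 \<le> z \<bullet> (G *v z)" using G by (auto simp: posdef_cone_alt)
      moreover have "0 < z \<bullet> (G *v z) \<or> x $ a \<noteq> 0" using G x that by (auto simp: posdef_cone_def)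
      moreover have "0 \<le> (s - Q) * (x $ a)\<^sup>2" using s by simp
      moreover have "0 < (s - Q) * (x $ a)\<^sup>2" if "x $ a \<noteq> 0" using s that by simp
      ultimately show ?thesis by linarith
    qed
    moreover have "transpose D = D" using posdef_cone_symmetric[OF G] by (auto simp: D_def transpose_def vec_eq_iff)
    ultimately show "D \<in> posdef_cone" by (simp add: posdef_cone_def)
  qed
  then show "G' \<in> posdef_cone \<longleftrightarrow> Q < s" unfolding eq using posdef_cone_congruence[of U D] dU by simp
qed

text \<open>The form of \<open>G\<close> at x is the form of \<open>G'\<close> at x with its
  coordinate \<open>a\<close> set to 0, plus the square of that coordinate. In the induction on
  columns this shows that a bad Gram block stays bad after bordering.\<close>

lemma posdef_cone_remove_row:
  fixes G' :: "real^'k^'k"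
  assumes G': "G' \<in> posdef_cone"
    and G: "G = (\<chi> i j. if i = a \<or> j = a then if i = j then 1 else 0 else G' $ i $ j)"
  shows "G \<in> posdef_cone"
proof -
  have "0 < x \<bullet> (G *v x)" if "x \<noteq> 0" for x
  proof -
    define z where "z = x - x $ a *\<^sub>R axis a 1"
    have za: "z $ a = 0" by (simp add: z_def)
    have x: "x = z + x $ a *\<^sub>R axis a 1" by (simp add: z_def)
    have "(\<Sum>j\<in>UNIV. G $ i $ j * x $ j) = (if i = a then x $ a else (\<Sum>j\<in>UNIV. G' $ i $ j * z $ j))" for i
    proof (cases "i = a")
      case True
      then have "(\<Sum>j\<in>UNIV. G $ i $ j * x $ j) = (\<Sum>j\<in>UNIV. if j = a then x $ j else 0)"
        by (intro sum.cong) (auto simp: G)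
      then show ?thesis using True by simp
    next
      case False
      then have "(\<Sum>j\<in>UNIV. G $ i $ j * x $ j) = (\<Sum>j\<in>UNIV. G' $ i $ j * z $ j)"
        by (intro sum.cong) (auto simp: G z_def axis_def)
      then show ?thesis using False by simp
    qed
    then have "x \<bullet> (G *v x) = (\<Sum>i\<in>UNIV. x $ i * (if i = a then x $ a else (\<Sum>j\<in>UNIV. G' $ i $ j * z $ j)))"
      by (simp add: inner_vec_def matrix_vector_mult_def)
    also have "\<dots> = (\<Sum>i\<in>UNIV. (if i = a then (x $ a)\<^sup>2 else 0) + z $ i * (\<Sum>j\<in>UNIV. G' $ i $ j * z $ j))"
      by (intro sum.cong refl) (auto simp: za power2_eq_square z_def axis_def)
    also have "\<dots> = z \<bullet> (G' *v z) + (x $ a)\<^sup>2"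
      by (simp add: sum.distrib inner_vec_def matrix_vector_mult_def)
    finally have "x \<bullet> (G *v x) = z \<bullet> (G' *v z) + (x $ a)\<^sup>2" .
    moreover have "0 \<le> z \<bullet> (G' *v z)" using G' by (auto simp: posdef_cone_alt)
    moreover have "0 < z \<bullet> (G' *v z) \<or> x $ a \<noteq> 0" using G' x that by (auto simp: posdef_cone_def)
    ultimately show ?thesis by (smt (verit) zero_less_power2 zero_le_power2)
  qed
  moreover have "transpose G = G" using posdef_cone_symmetric[OF G'] by (auto simp: G transpose_def vec_eq_iff)
  ultimately show ?thesis by (simp add: posdef_cone_def)
qed

section \<open>Completing vectors to a square matrix\<close>

text \<open>The missing rows are taken from an orthonormal basis of the orthogonal complement of the
  span of the given ones. Dependent vectors only enlarge that complement, so there are always enough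
  of them. The Gram matrix of the rows is then the padded one; for orthonormal \<open>w\<close> it
  is the identity.\<close>

lemma ex_orthonormal_rows_completion:
  fixes w :: "'k::finite \<Rightarrow> real^'k"
  shows "\<exists>B :: real^'k^'k. (\<forall>i\<in>J. B $ i = w i) \<and>
     B ** transpose B = (\<chi> i j. if i \<in> J \<and> j \<in> J then w i \<bullet> w j else if i = j then 1 else 0)"
proof -
  define S where "S = {x. \<forall>y \<in> span (w ` J). orthogonal y x}"
  have "subspace S" unfolding S_def by (rule subspace_orthogonal_to_vectors)
  then obtain C where C: "C \<subseteq> S" "pairwise orthogonal C" "\<And>x. x \<in> C \<Longrightarrow> norm x = 1"
     "independent C" "card C = dim S" "span C = S"
    using orthonormal_basis_subspace[of S] by metis
  have "dim S + dim (span (w ` J)) = CARD('k)"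
    using dim_subspace_orthogonal_to_vectors[of "span (w ` J)" UNIV] unfolding S_def by simp
  moreover have "dim (span (w ` J)) \<le> card J"
    using dim_le_card'[of "w ` J"] card_image_le[of J w] by (simp add: le_trans)
  moreover have "card (- J) = CARD('k) - card J" by (simp add: Compl_eq_Diff_UNIV card_Diff_subset)
  ultimately have "card (- J) \<le> card C" using C(5) by simp
  then obtain u where u: "u ` (- J) \<subseteq> C" "inj_on u (- J)"
    using card_le_inj[of "- J" C] C(4) independent_imp_finite by auto
  define B :: "real^'k^'k" where "B = (\<chi> i. if i \<in> J then w i else u i)"
  have uu: "u i \<bullet> u j = (if i = j then 1 else 0)" if "i \<notin> J" "j \<notin> J" for i j
  proof (cases "i = j")
    case True then show ?thesis using C(3)[of "u i"] u(1) that by (auto simp: norm_eq_1)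
  next
    case False
    then have "u i \<noteq> u j" using u(2) that by (auto simp: inj_on_def)
    then show ?thesis using C(2) u(1) that False by (auto simp: pairwise_def orthogonal_def image_subset_iff)
  qed
  have uw: "w j \<bullet> u i = 0" if "i \<notin> J" "j \<in> J" for i j
  proof -
    have "u i \<in> S" using u(1) C(1) that by auto
    then show ?thesis using that span_base[of "w j" "w ` J"] by (auto simp: S_def orthogonal_def)
  qed
  have "B ** transpose B = (\<chi> i j. B $ i \<bullet> B $ j)"
    by (simp add: vec_eq_iff matrix_matrix_mult_def transpose_def inner_vec_def)
  also have "\<dots> = (\<chi> i j. if i \<in> J \<and> j \<in> J then w i \<bullet> w j else if i = j then 1 else 0)"
    by (auto simp: vec_eq_iff B_def uu uw inner_commute[of "u _" "w _"])
  finally show ?thesis by (intro exI[of _ B]) (simp add: B_def)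
qed

text \<open>The inverse of BB' expresses the old norm in the new coordinates y = B v, because it is
  the inverse transpose of B times the inverse of B.\<close>

lemma inner_self_via_gram:
  fixes B :: "real^'k^'k"
  assumes "det B \<noteq> 0"
  shows "v \<bullet> v = (B *v v) \<bullet> (matrix_inv (B ** transpose B) *v (B *v v))"
proof -
  let ?G = "B ** transpose B"
  define z where "z = matrix_inv ?G *v (B *v v)"
  have "?G *v z = B *v v" unfolding z_def
    using assms by (simp add: matrix_vector_mul_assoc[of ?G] matrix_inv_right det_mul)
  then have "B *v (transpose B *v z) = B *v v"
    by (simp add: matrix_vector_mul_assoc del: transpose_matrix_vector)
  then have "transpose B *v z = v"
    using assms by (metis invertible_det_nz invertible_def matrix_vector_mul_assoc matrix_vector_mul_lid)
  then show ?thesis unfolding z_def[symmetric] inner_matrix_vector_transpose by simp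
qed

section \<open>The law of a Gram matrix\<close>

lemma nn_integral_powr_from_0:
  assumes "a > -1" "R \<ge> 0"
  shows "(\<integral>\<^sup>+x. ennreal (x powr a) * indicator {0<..R} x \<partial>lborel) = ennreal (R powr (a + 1) / (a + 1))"
proof -
  have "ennreal (R powr (a + 1) / (a + 1)) = (\<integral>\<^sup>+x. indicator {0..R} x * (x powr a) \<partial>lborel)"
    by (rule nn_integral_has_integral_lebesgue[symmetric, OF _ has_integral_powr_from_0])
       (use assms in auto)
  also have "\<dots> = (\<integral>\<^sup>+x. ennreal (x powr a) * indicator {0<..R} x \<partial>lborel)"
    by (intro nn_integral_cong) (auto simp: indicator_def)
  finally show ?thesis ..
qed

text \<open>The density of \<open>|z|\<^sup>2\<close> for z in Euclidean p-space is this constant times \<open>s\<^bsup>p/2-1\<^esup>\<close>, for \<open>p > 0\<close>.\<close>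

definition sphere_half_area :: "nat \<Rightarrow> real" where
  "sphere_half_area p = pi powr (real p / 2) / Gamma (real p / 2)"

text \<open>A ball of squared radius R in dimension p has volume pi^(p/2) R^(p/2) / Gamma(p/2 + 1);
  differentiating in R gives the density, since Gamma(p/2 + 1) = (p/2) Gamma(p/2). Agreement on all
  half-lines suffices.\<close>

lemma distr_PiM_sum_squares:
  fixes I :: "'i set"
  assumes I: "finite I" "I \<noteq> {}"
  shows "distr (Pi\<^sub>M I (\<lambda>_. lborel)) borel (\<lambda>z. \<Sum>i\<in>I. (z i)\<^sup>2)
    = density lborel (\<lambda>s. ennreal (sphere_half_area (card I) * s powr (real (card I) / 2 - 1)) * indicator {0<..} s)"
    (is "?D = density lborel ?h")
proof -
  interpret product_sigma_finite "\<lambda>_ :: 'i. lborel :: real measure" by standard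
  define p where "p = card I"
  have p: "p > 0" using I by (simp add: p_def card_gt_0_iff)
  have \<kappa>: "sphere_half_area p \<ge> 0" unfolding sphere_half_area_def using p by (simp add: Gamma_real_pos less_imp_le)
  have eq: "emeasure ?D {..R} = ennreal (unit_ball_vol (real p) * R powr (real p / 2))" if R: "R \<ge> 0" for R
  proof -
    have [measurable]: "(\<lambda>z. \<Sum>i\<in>I. (z i)\<^sup>2) \<in> borel_measurable (Pi\<^sub>M I (\<lambda>_. lborel :: real measure))"
      by measurable
    have "emeasure ?D {..R} = emeasure (Pi\<^sub>M I (\<lambda>_. lborel)) ((\<lambda>z. \<Sum>i\<in>I. (z i)\<^sup>2) -` {..R} \<inter> space (Pi\<^sub>M I (\<lambda>_. lborel)))"
      by (subst emeasure_distr) auto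
    also have "\<dots> = ennreal (unit_ball_vol (real p) * R powr (real p / 2))"
    proof (cases "R = 0")
      \<comment> \<open>The ball formula is for positive radii. At R = 0 the set is a single point,
        which is null because \<open>I\<close> is nonempty.\<close>
      case True
      have "(\<lambda>z. \<Sum>i\<in>I. (z i)\<^sup>2) -` {..R} \<inter> space (Pi\<^sub>M I (\<lambda>_. lborel)) = Pi\<^sub>E I (\<lambda>_. {0::real})"
      proof (rule set_eqI)
        fix z :: "'i \<Rightarrow> real"
        have "(\<Sum>i\<in>I. (z i)\<^sup>2) \<le> 0 \<longleftrightarrow> (\<forall>i\<in>I. z i = 0)"
          using sum_nonneg_eq_0_iff[OF I(1), of "\<lambda>i. (z i)\<^sup>2"] sum_nonneg[of I "\<lambda>i. (z i)\<^sup>2"] by auto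
        then show "z \<in> (\<lambda>z. \<Sum>i\<in>I. (z i)\<^sup>2) -` {..R} \<inter> space (Pi\<^sub>M I (\<lambda>_. lborel)) \<longleftrightarrow> z \<in> Pi\<^sub>E I (\<lambda>_. {0::real})"
          using True by (auto simp: PiE_iff space_PiM extensional_def)
      qed
      then have "emeasure (Pi\<^sub>M I (\<lambda>_. lborel)) ((\<lambda>z. \<Sum>i\<in>I. (z i)\<^sup>2) -` {..R} \<inter> space (Pi\<^sub>M I (\<lambda>_. lborel)))
          = emeasure (Pi\<^sub>M I (\<lambda>_. lborel)) (Pi\<^sub>E I (\<lambda>_. {0::real}))"
        by (rule arg_cong)
      also have "\<dots> = 0" using I by (subst emeasure_PiM) auto
      finally show ?thesis using True p by simp
    next
      case False
      then have "(\<lambda>z. \<Sum>i\<in>I. (z i)\<^sup>2) -` {..R} \<inter> space (Pi\<^sub>M I (\<lambda>_. lborel))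
          = {f. sqrt (\<Sum>i\<in>I. (f i)\<^sup>2) \<le> sqrt R} \<inter> space (Pi\<^sub>M I (\<lambda>_. lborel))"
        by auto
      moreover have "sqrt R ^ card I = R powr (real p / 2)"
        using R False by (simp add: p_def powr_half_sqrt[symmetric] powr_powr powr_realpow[symmetric])
      ultimately show ?thesis using emeasure_cball_aux[OF I(1), of "sqrt R"] R False by (simp add: p_def)
    qed
    finally show ?thesis .
  qed
  have eq': "emeasure (density lborel ?h) {..R} = ennreal (unit_ball_vol (real p) * R powr (real p / 2))" if R: "R \<ge> 0" for R
  proof -
    have "emeasure (density lborel ?h) {..R} = (\<integral>\<^sup>+s. ennreal (sphere_half_area p) * (ennreal (s powr (real p / 2 - 1)) * indicator {0<..R} s) \<partial>lborel)"
      using \<kappa> by (subst emeasure_density)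
        (auto intro!: nn_integral_cong simp: p_def[symmetric] ennreal_mult indicator_def mult.assoc)
    also have "\<dots> = ennreal (sphere_half_area p) * ennreal (R powr (real p / 2) / (real p / 2))"
      using nn_integral_powr_from_0[of "real p / 2 - 1" R] p R by (subst nn_integral_cmult) auto
    also have "\<dots> = ennreal (sphere_half_area p * (R powr (real p / 2) / (real p / 2)))"
      using \<kappa> by (simp add: ennreal_mult'[symmetric])
    also have "sphere_half_area p * (R powr (real p / 2) / (real p / 2)) = unit_ball_vol (real p) * R powr (real p / 2)"
    proof -
      have "real p / 2 \<notin> \<int>\<^sub>\<le>\<^sub>0" using p by (auto elim!: nonpos_Ints_cases)
      then have "Gamma (real p / 2 + 1) = real p / 2 * Gamma (real p / 2)" by (rule Gamma_plus1)
      then show ?thesis unfolding sphere_half_area_def unit_ball_vol_def by (simp only: ) (simp add: ac_simps)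
    qed
    finally show ?thesis .
  qed
  have neg: "emeasure ?D {..R} = emeasure (density lborel ?h) {..R}" for R
  proof (cases "R \<ge> 0")
    case True then show ?thesis by (simp add: eq eq')
  next
    case False
    have m: "emeasure N {..R} = 0" if "sets N = sets borel" "emeasure N {..0} = 0" for N :: "real measure"
      by (rule emeasure_eq_0[OF _ that(2)]) (use False that(1) in auto)
    have "emeasure ?D {..R} = 0" by (rule m) (use eq[of 0] p in auto)
    moreover have "emeasure (density lborel ?h) {..R} = 0" by (rule m) (use eq'[of 0] p in auto)
    ultimately show ?thesis by (rule trans[OF _ sym])
  qed
  show ?thesis
  proof (rule measure_eqI_generator_eq[where E="range atMost" and \<Omega>=UNIV and A="\<lambda>n. {..real n}"])
    show "Int_stable (range (atMost :: real \<Rightarrow> _))"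
      by (auto simp: Int_stable_def intro!: image_eqI[of _ _ "min _ _"])
    show "(\<Union>n. {..real n}) = UNIV" using real_arch_simple by auto
    show "emeasure ?D {..real n} \<noteq> \<infinity>" for n using eq[of "real n"] by simp
    show "sets ?D = sigma_sets UNIV (range atMost)"
      by (simp add: borel_eq_atMost)
    show "sets (density lborel ?h) = sigma_sets UNIV (range atMost)"
      by (simp add: borel_eq_atMost)
  qed (auto simp: neg)
qed

lemma nn_integral_PiM_sum_squares:
  fixes I :: "'i set"
  assumes "finite I" "I \<noteq> {}" and [measurable]: "h \<in> borel_measurable borel"
  shows "(\<integral>\<^sup>+z. h (\<Sum>i\<in>I. (z i)\<^sup>2) \<partial>Pi\<^sub>M I (\<lambda>_. lborel))
    = ennreal (sphere_half_area (card I)) * (\<integral>\<^sup>+s. ennreal (s powr (real (card I) / 2 - 1)) * indicator {0<..} s * h s \<partial>lborel)"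
proof -
  have \<kappa>: "sphere_half_area (card I) \<ge> 0" unfolding sphere_half_area_def using assms
    by (simp add: Gamma_real_pos less_imp_le card_gt_0_iff)
  have "(\<integral>\<^sup>+z. h (\<Sum>i\<in>I. (z i)\<^sup>2) \<partial>Pi\<^sub>M I (\<lambda>_. lborel))
     = (\<integral>\<^sup>+s. h s \<partial>distr (Pi\<^sub>M I (\<lambda>_. lborel)) borel (\<lambda>z. \<Sum>i\<in>I. (z i)\<^sup>2))"
    by (subst nn_integral_distr) auto
  also have "\<dots> = (\<integral>\<^sup>+s. ennreal (sphere_half_area (card I)) * (ennreal (s powr (real (card I) / 2 - 1)) * indicator {0<..} s * h s) \<partial>lborel)"
    using \<kappa> by (subst distr_PiM_sum_squares[OF assms(1,2)], subst nn_integral_density)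
      (auto intro!: nn_integral_cong simp: ennreal_mult mult.assoc)
  finally show ?thesis by (subst (asm) nn_integral_cmult) auto
qed

text \<open>
  Gram entries are indexed by unordered pairs, so that no order on the index type is needed.  A Gram
  matrix of the vectors in J is padded by an identity block, so that all determinants of the induction on J
  live in one type.
\<close>

definition pairs :: "'k set \<Rightarrow> 'k set set" where
  "pairs J = {{i, j} |i j. i \<in> J \<and> j \<in> J}"

text \<open>The value is well defined because the inner product is symmetric; a singleton {i} stands
  for the diagonal entry.\<close>

definition gram :: "('i \<Rightarrow> 'a::real_inner) \<Rightarrow> 'i set \<Rightarrow> real" where
  "gram w e = (THE c. \<exists>i j. e = {i, j} \<and> c = w i \<bullet> w j)"

definition padded :: "'k set \<Rightarrow> ('k set \<Rightarrow> real) \<Rightarrow> real^'k^'k" where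
  "padded J r = (\<chi> i j. if i \<in> J \<and> j \<in> J then r {i, j} else if i = j then 1 else 0)"

text \<open>Here \<open>r\<close> holds the old entries, \<open>b\<close> the products with the new
  vector and \<open>s\<close> its squared length. An entry {i, a} finds its index i back through
  \<open>inv_into\<close>, since i -> {i, a} is injective.\<close>

definition bordered :: "'k \<Rightarrow> 'k set \<Rightarrow> ('k set \<Rightarrow> real) \<Rightarrow> ('k \<Rightarrow> real) \<Rightarrow> real \<Rightarrow> 'k set \<Rightarrow> real" where
  "bordered a J r b s = (\<lambda>e\<in>pairs (insert a J). if e \<in> pairs J then r e else if e = {a} then s
     else b (inv_into J (\<lambda>i. {i, a}) e))"

lemma gram_doubleton [simp]: "gram w {i, j} = w i \<bullet> w j"
  unfolding gram_def by (rule the_equality) (auto simp: doubleton_eq_iff inner_commute)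

lemma pairs_doubleton [simp]: "{i, j} \<in> pairs J \<longleftrightarrow> i \<in> J \<and> j \<in> J"
  by (auto simp: pairs_def doubleton_eq_iff)

lemma pairs_singleton [simp]: "{i} \<in> pairs J \<longleftrightarrow> i \<in> J"
  using pairs_doubleton[of i i J] by simp

lemma pairsE: assumes "e \<in> pairs J" obtains i j where "e = {i, j}" "i \<in> J" "j \<in> J"
  using assms by (auto simp: pairs_def)

lemma finite_pairs [simp]: "finite J \<Longrightarrow> finite (pairs J)"
  by (rule finite_subset[of _ "(\<lambda>(i, j). {i, j}) ` (J \<times> J)"]) (auto simp: pairs_def)

lemma pairs_insert: "pairs (insert a J) = pairs J \<union> insert {a} ((\<lambda>i. {i, a}) ` J)"
  by (auto simp: pairs_def doubleton_eq_iff)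

lemma inj_on_doubleton: "inj_on (\<lambda>i. {i, a}) J"
  by (auto simp: inj_on_def doubleton_eq_iff)

lemma
  assumes "a \<notin> J"
  shows bordered_old: "e \<in> pairs J \<Longrightarrow> bordered a J r b s e = r e"
    and bordered_corner: "bordered a J r b s {a} = s"
    and bordered_border: "i \<in> J \<Longrightarrow> bordered a J r b s {i, a} = b i"
  using assms by (auto simp: bordered_def pairs_insert inv_into_f_f[OF inj_on_doubleton] doubleton_eq_iff)

lemma padded_restrict [simp]: "padded J (restrict r (pairs J)) = padded J r"
  by (simp add: padded_def vec_eq_iff)

lemma padded_bordered:
  assumes a: "a \<notin> J"
  shows "padded (insert a J) (bordered a J r b s) =
     (\<chi> i j. if i = a \<and> j = a then s else if i = a then (\<chi> l. if l \<in> J then b l else 0) $ j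
        else if j = a then (\<chi> l. if l \<in> J then b l else 0) $ i else padded J r $ i $ j)"
proof -
  have "bordered a J r b s {a, i} = b i" if "i \<in> J" for i
    using bordered_border[OF a that] by (simp add: insert_commute)
  then show ?thesis using a
    by (auto simp: vec_eq_iff padded_def bordered_old[OF a] bordered_corner[OF a] bordered_border[OF a])
qed

lemma gram_bordered:
  assumes a: "a \<notin> J"
  shows "restrict (gram (w(a := v))) (pairs (insert a J)) =
     bordered a J (restrict (gram w) (pairs J)) (\<lambda>i\<in>J. w i \<bullet> v) (v \<bullet> v)"
proof
  fix e
  show "restrict (gram (w(a := v))) (pairs (insert a J)) e =
     bordered a J (restrict (gram w) (pairs J)) (\<lambda>i\<in>J. w i \<bullet> v) (v \<bullet> v) e"
  proof (cases "e \<in> pairs (insert a J)")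
    case False then show ?thesis by (simp add: bordered_def)
  next
    case True
    then consider "e \<in> pairs J" | "e = {a}" | i where "i \<in> J" "e = {i, a}" by (auto simp: pairs_insert)
    then show ?thesis
    proof cases
      case 1
      then obtain i j where "e = {i, j}" "i \<in> J" "j \<in> J" by (rule pairsE)
      with 1 True a show ?thesis by (auto simp: bordered_old)
    next
      case 2
      with True a show ?thesis using gram_doubleton[of "w(a := v)" a a] by (auto simp: bordered_corner)
    next
      case 3
      with True a show ?thesis by (auto simp: bordered_border)
    qed
  qed
qed

lemma measurable_gram [measurable]:
  fixes w :: "'i \<Rightarrow> 'a::euclidean_space"
  shows "(\<lambda>w. restrict (gram w) (pairs J)) \<in> Pi\<^sub>M J (\<lambda>_. lborel :: 'a measure) \<rightarrow>\<^sub>M Pi\<^sub>M (pairs J) (\<lambda>_. lborel)"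
proof (rule measurable_restrict)
  fix e assume "e \<in> pairs J"
  then obtain i j where e: "e = {i, j}" and [measurable]: "i \<in> J" "j \<in> J" by (rule pairsE)
  show "(\<lambda>w. gram w e) \<in> Pi\<^sub>M J (\<lambda>_. lborel :: 'a measure) \<rightarrow>\<^sub>M lborel"
    unfolding e gram_doubleton by measurable
qed

lemma measurable_padded [measurable]: "padded J \<in> Pi\<^sub>M (pairs J) (\<lambda>_. lborel) \<rightarrow>\<^sub>M borel"
proof -
  have "(\<lambda>r. if i \<in> J \<and> j \<in> J then r {i, j} else if i = j then 1 else 0)
     \<in> borel_measurable (Pi\<^sub>M (pairs J) (\<lambda>_. lborel :: real measure))" for i j
    by (cases "i \<in> J \<and> j \<in> J") auto
  then show ?thesis unfolding padded_def by measurable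
qed

lemma measurable_bordered [measurable (raw)]:
  assumes "r \<in> M \<rightarrow>\<^sub>M Pi\<^sub>M (pairs J) (\<lambda>_. lborel)" "b \<in> M \<rightarrow>\<^sub>M Pi\<^sub>M J (\<lambda>_. lborel)" "s \<in> M \<rightarrow>\<^sub>M borel"
  shows "(\<lambda>x. bordered a J (r x) (b x) (s x)) \<in> M \<rightarrow>\<^sub>M Pi\<^sub>M (pairs (insert a J)) (\<lambda>_. lborel)"
  unfolding bordered_def
proof (rule measurable_restrict)
  fix e assume e: "e \<in> pairs (insert a J)"
  have "inv_into J (\<lambda>i. {i, a}) e \<in> J" if "e \<notin> pairs J" "e \<noteq> {a}"
    using e that inv_into_into[of e "\<lambda>i. {i, a}" J] by (auto simp: pairs_insert)
  then show "(\<lambda>x. if e \<in> pairs J then r x e else if e = {a} then s x else b x (inv_into J (\<lambda>i. {i, a}) e)) \<in> M \<rightarrow>\<^sub>M lborel"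
    using measurable_compose[OF assms(1) measurable_component_singleton[of e]] assms(3)
      measurable_compose[OF assms(2) measurable_component_singleton[of "inv_into J (\<lambda>i. {i, a}) e"]]
    by (cases "e \<in> pairs J"; cases "e = {a}") simp_all
qed

text \<open>The pairs of the enlarged set fall into three disjoint groups: the old pairs, the corner
  {a}, and the pairs {i, a}, which are indexed by \<open>J\<close> itself. Fubini separates the
  groups.\<close>

lemma nn_integral_PiM_pairs_insert:
  assumes J: "finite J" "a \<notin> J" and [measurable]: "f \<in> borel_measurable (Pi\<^sub>M (pairs (insert a J)) (\<lambda>_. lborel))"
  shows "(\<integral>\<^sup>+\<rho>. f \<rho> \<partial>Pi\<^sub>M (pairs (insert a J)) (\<lambda>_. lborel)) =
    (\<integral>\<^sup>+r. \<integral>\<^sup>+b. \<integral>\<^sup>+s. f (bordered a J r b s) \<partial>lborel \<partial>Pi\<^sub>M J (\<lambda>_. lborel) \<partial>Pi\<^sub>M (pairs J) (\<lambda>_. lborel))"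
proof -
  interpret product_sigma_finite "\<lambda>_ :: 'a set. lborel :: real measure" by standard
  let ?h = "\<lambda>i. {i, a}"
  define K where "K = ?h ` J"
  have h: "bij_betw ?h J K" unfolding K_def by (rule inj_on_imp_bij_betw[OF inj_on_doubleton])
  have P: "pairs (insert a J) = pairs J \<union> insert {a} K" by (simp add: pairs_insert K_def)
  have disj: "pairs J \<inter> insert {a} K = {}" using J by (auto simp: K_def)
  have aK: "{a} \<notin> K" using J by (auto simp: K_def)
  have K: "finite K" using J by (simp add: K_def)
  have fP: "f \<in> borel_measurable (Pi\<^sub>M (pairs J \<union> insert {a} K) (\<lambda>_. lborel))"
    using assms(3) unfolding P .
  have mm: "(\<lambda>x. f (merge (pairs J) (insert {a} K) (r, x))) \<in> borel_measurable (Pi\<^sub>M (insert {a} K) (\<lambda>_. lborel))"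
    if r: "r \<in> space (Pi\<^sub>M (pairs J) (\<lambda>_. lborel))" for r
    by (rule measurable_compose[OF measurable_compose[OF measurable_Pair1'[OF r] measurable_merge] fP])
  have "(\<integral>\<^sup>+\<rho>. f \<rho> \<partial>Pi\<^sub>M (pairs (insert a J)) (\<lambda>_. lborel)) =
     (\<integral>\<^sup>+r. \<integral>\<^sup>+x. f (merge (pairs J) (insert {a} K) (r, x)) \<partial>Pi\<^sub>M (insert {a} K) (\<lambda>_. lborel) \<partial>Pi\<^sub>M (pairs J) (\<lambda>_. lborel))"
    unfolding P by (rule product_nn_integral_fold[OF disj _ _ fP]) (use J K in auto)
  also have "\<dots> = (\<integral>\<^sup>+r. \<integral>\<^sup>+b. \<integral>\<^sup>+s. f (bordered a J r b s) \<partial>lborel \<partial>Pi\<^sub>M J (\<lambda>_. lborel) \<partial>Pi\<^sub>M (pairs J) (\<lambda>_. lborel))"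
  proof (rule nn_integral_cong)
    fix r assume r: "r \<in> space (Pi\<^sub>M (pairs J) (\<lambda>_. lborel :: real measure))"
    note [measurable] = mm[OF r]
    have fm: "(\<lambda>(x, y). f (merge (pairs J) (insert {a} K) (r, x({a} := y)))) \<in>
        borel_measurable (Pi\<^sub>M K (\<lambda>_. lborel) \<Otimes>\<^sub>M lborel)"
      using aK by measurable
    have "(\<integral>\<^sup>+x. f (merge (pairs J) (insert {a} K) (r, x)) \<partial>Pi\<^sub>M (insert {a} K) (\<lambda>_. lborel))
       = (\<integral>\<^sup>+x. \<integral>\<^sup>+s. f (merge (pairs J) (insert {a} K) (r, x({a} := s))) \<partial>lborel \<partial>Pi\<^sub>M K (\<lambda>_. lborel))"
      using K aK by (intro product_nn_integral_insert) auto
    also have "\<dots> = (\<integral>\<^sup>+b. \<integral>\<^sup>+s. f (merge (pairs J) (insert {a} K) (r, (\<lambda>e\<in>K. b (inv_into J ?h e))({a} := s))) \<partial>lborel \<partial>Pi\<^sub>M J (\<lambda>_. lborel))"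
      by (rule nn_integral_PiM_reindex[OF _ h J(1) lborel.borel_measurable_nn_integral[OF fm]])
         (rule lborel.sigma_finite_measure_axioms)
    also have "\<dots> = (\<integral>\<^sup>+b. \<integral>\<^sup>+s. f (bordered a J r b s) \<partial>lborel \<partial>Pi\<^sub>M J (\<lambda>_. lborel))"
    proof -
      have "merge (pairs J) (insert {a} K) (r, (\<lambda>e\<in>K. b (inv_into J ?h e))({a} := s)) = bordered a J r b s" for b s
        using disj r by (auto simp: fun_eq_iff merge_def bordered_def P)
      then show ?thesis by simp
    qed
    finally show "(\<integral>\<^sup>+x. f (merge (pairs J) (insert {a} K) (r, x)) \<partial>Pi\<^sub>M (insert {a} K) (\<lambda>_. lborel))
       = (\<integral>\<^sup>+b. \<integral>\<^sup>+s. f (bordered a J r b s) \<partial>lborel \<partial>Pi\<^sub>M J (\<lambda>_. lborel))" .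
  qed
  finally show ?thesis .
qed

text \<open>Complete the \<open>w i\<close> to an invertible B whose remaining rows are orthonormal
  and orthogonal to them, and substitute y = B v. Then BB' = G, so the Jacobian is |det G|^(-1/2).
  The coordinates of y in \<open>J\<close> are the inner products b, and |v|^2 is
  \<open>Q b\<close>, the squared length of the projection of v to the span of the
  \<open>w i\<close>, plus the squared length of the other p coordinates, whose density is
  known.\<close>

lemma nn_integral_inner_products:
  fixes w :: "'k::finite \<Rightarrow> real^'k" and H :: "('k \<Rightarrow> real) \<Rightarrow> real \<Rightarrow> ennreal"
  assumes J: "a \<notin> J" and G: "G = padded J (gram w)" "G \<in> posdef_cone"
    and H: "(\<lambda>(b, s). H b s) \<in> borel_measurable (Pi\<^sub>M J (\<lambda>_. lborel) \<Otimes>\<^sub>M borel)"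
  defines "Q \<equiv> \<lambda>b. (\<chi> l. if l \<in> J then b l else 0) \<bullet> (matrix_inv G *v (\<chi> l. if l \<in> J then b l else 0))"
    and "p \<equiv> CARD('k) - card J"
  shows "(\<integral>\<^sup>+v. H (\<lambda>i\<in>J. w i \<bullet> v) (v \<bullet> v) \<partial>lborel) =
     ennreal (\<bar>det G\<bar> powr (- 1 / 2) * sphere_half_area p) *
     (\<integral>\<^sup>+b. \<integral>\<^sup>+s. indicator {Q b<..} s * ennreal ((s - Q b) powr (real p / 2 - 1)) * H b s \<partial>lborel \<partial>Pi\<^sub>M J (\<lambda>_. lborel))"
proof -
  obtain B :: "real^'k^'k" where Bw: "\<And>i. i \<in> J \<Longrightarrow> B $ i = w i" and
    BB: "B ** transpose B = (\<chi> i j. if i \<in> J \<and> j \<in> J then w i \<bullet> w j else if i = j then 1 else 0)"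
    using ex_orthonormal_rows_completion[of J w] by blast
  have BG: "B ** transpose B = G" unfolding BB G by (simp add: padded_def vec_eq_iff)
  have dG: "det G = (det B)\<^sup>2" unfolding BG[symmetric] by (simp add: det_mul power2_eq_square)
  have dB: "det B \<noteq> 0" using posdef_cone_det_nonzero[OF G(2)] dG by simp
  have dB': "\<bar>det B\<bar> = \<bar>det G\<bar> powr (1 / 2)" by (simp add: dG powr_half_sqrt)
  have Gsym: "transpose G = G" using G(2) by (simp add: posdef_cone_def)
  define K where "K y = H (\<lambda>i\<in>J. y $ i) (y \<bullet> (matrix_inv G *v y))" for y
  have [measurable]: "(\<lambda>y :: real^'k. y \<bullet> (matrix_inv G *v y)) \<in> borel_measurable borel"
    by (intro borel_measurable_continuous_onI continuous_intros)
  have Kpair: "(\<lambda>y. (\<lambda>i\<in>J. y $ i, y \<bullet> (matrix_inv G *v y))) \<in> borel \<rightarrow>\<^sub>M (Pi\<^sub>M J (\<lambda>_. lborel) \<Otimes>\<^sub>M borel)"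
    by (intro measurable_Pair measurable_restrict) auto
  have K[measurable]: "K \<in> borel_measurable borel"
    using measurable_compose[OF Kpair H] unfolding K_def by simp
  have "(\<integral>\<^sup>+v. H (\<lambda>i\<in>J. w i \<bullet> v) (v \<bullet> v) \<partial>lborel) = (\<integral>\<^sup>+v. K (B *v v) \<partial>lborel)"
  proof (rule nn_integral_cong)
    fix v :: "real^'k"
    have "(\<lambda>i\<in>J. w i \<bullet> v) = (\<lambda>i\<in>J. (B *v v) $ i)"
      by (auto simp: fun_eq_iff matrix_vector_mul_component Bw)
    then show "H (\<lambda>i\<in>J. w i \<bullet> v) (v \<bullet> v) = K (B *v v)"
      using inner_self_via_gram[OF dB, of v] by (simp add: K_def BG)
  qed
  also have "\<dots> = ennreal (1 / \<bar>det B\<bar>) * (\<integral>\<^sup>+y. K y \<partial>lborel)"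
  proof -
    have "ennreal (1 / \<bar>det B\<bar>) * (\<integral>\<^sup>+y. K y \<partial>lborel) = ennreal (1 / \<bar>det B\<bar> * \<bar>det B\<bar>) * (\<integral>\<^sup>+v. K (B *v v) \<partial>lborel)"
      by (simp only: nn_integral_lborel_matrix[OF dB K] ennreal_mult mult.assoc abs_ge_zero zero_le_divide_1_iff)
    then show ?thesis using dB by simp
  qed
  also have "(\<integral>\<^sup>+y. K y \<partial>lborel) = (\<integral>\<^sup>+b. \<integral>\<^sup>+z. K (\<chi> i. if i \<in> J then b i else z i)
      \<partial>Pi\<^sub>M (- J) (\<lambda>_. lborel) \<partial>Pi\<^sub>M J (\<lambda>_. lborel))"
    by (rule nn_integral_lborel_vec_split) simp
  also have "\<dots> = (\<integral>\<^sup>+b. ennreal (sphere_half_area p) *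
     (\<integral>\<^sup>+s. indicator {Q b<..} s * ennreal ((s - Q b) powr (real p / 2 - 1)) * H b s \<partial>lborel) \<partial>Pi\<^sub>M J (\<lambda>_. lborel))"
  proof (rule nn_integral_cong)
    fix b assume b: "b \<in> space (Pi\<^sub>M J (\<lambda>_. lborel :: real measure))"
    define \<beta> :: "real^'k" where "\<beta> = (\<chi> l. if l \<in> J then b l else 0)"
    have Qb: "Q b = \<beta> \<bullet> (matrix_inv G *v \<beta>)" by (simp add: Q_def \<beta>_def)
    have [measurable]: "H b \<in> borel_measurable borel"
      using measurable_compose[OF measurable_Pair1'[OF b] H] by simp
    have Kz: "K (\<chi> i. if i \<in> J then b i else z i) = H b (Q b + (\<Sum>i\<in>-J. (z i)\<^sup>2))" for z
    proof -
      define \<zeta> :: "real^'k" where "\<zeta> = (\<chi> l. if l \<in> J then 0 else z l)"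
      have y: "(\<chi> i. if i \<in> J then b i else z i) = \<beta> + \<zeta>" by (auto simp: vec_eq_iff \<beta>_def \<zeta>_def)
      \<comment> \<open>\<open>G\<close> acts as the identity outside \<open>J\<close>, so \<zeta>
        is fixed by \<open>G\<close> and by its inverse. This removes the cross terms between
        \<beta> and \<zeta>.\<close>
      have "(\<Sum>j\<in>UNIV. G $ i $ j * \<zeta> $ j) = (\<Sum>j\<in>UNIV. if j = i then \<zeta> $ i else 0)" for i
        by (intro sum.cong) (auto simp: G padded_def \<zeta>_def)
      then have G\<zeta>: "G *v \<zeta> = \<zeta>" by (simp add: matrix_vector_mult_def vec_eq_iff)
      have inv\<zeta>: "matrix_inv G *v \<zeta> = \<zeta>"
      proof -
        have "matrix_inv G ** G = mat 1"
          using matrix_inv_right[OF posdef_cone_det_nonzero[OF G(2)]] matrix_left_right_inverse by blast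
        then show ?thesis by (metis G\<zeta> matrix_vector_mul_assoc matrix_vector_mul_lid)
      qed
      have o: "\<beta> \<bullet> \<zeta> = 0" by (auto simp: \<beta>_def \<zeta>_def inner_vec_def intro!: sum.neutral)
      have "\<zeta> \<bullet> (matrix_inv G *v \<beta>) = (G *v \<zeta>) \<bullet> (matrix_inv G *v \<beta>)" by (simp add: G\<zeta>)
      also have "\<dots> = \<zeta> \<bullet> ((G ** matrix_inv G) *v \<beta>)"
        by (subst inner_matrix_vector_transpose) (simp add: Gsym matrix_vector_mul_assoc)
      also have "\<dots> = 0"
        using o by (simp add: matrix_inv_right[OF posdef_cone_det_nonzero[OF G(2)]] inner_commute)
      finally have "\<zeta> \<bullet> (matrix_inv G *v \<beta>) = 0" .
      then have q: "(\<beta> + \<zeta>) \<bullet> (matrix_inv G *v (\<beta> + \<zeta>)) = Q b + \<zeta> \<bullet> \<zeta>"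
        by (simp add: Qb matrix_vector_right_distrib inner_add_left inner_add_right inv\<zeta> o)
      have "\<zeta> \<bullet> \<zeta> = (\<Sum>i\<in>UNIV. if i \<in> - J then (z i)\<^sup>2 else 0)"
        by (auto simp: inner_vec_def \<zeta>_def power2_eq_square intro!: sum.cong)
      also have "\<dots> = (\<Sum>i\<in>-J. (z i)\<^sup>2)" by (simp add: sum.If_cases Collect_neg_eq)
      finally have "\<zeta> \<bullet> \<zeta> = (\<Sum>i\<in>-J. (z i)\<^sup>2)" .
      moreover have "(\<lambda>i\<in>J. (\<beta> + \<zeta>) $ i) = b"
        using b by (auto simp: space_PiM PiE_iff extensional_def fun_eq_iff \<beta>_def \<zeta>_def)
      ultimately show ?thesis unfolding K_def y q by (simp only: )
    qed
    have p: "card (- J) = p" by (simp add: p_def Compl_eq_Diff_UNIV card_Diff_subset)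
    have "(\<integral>\<^sup>+z. K (\<chi> i. if i \<in> J then b i else z i) \<partial>Pi\<^sub>M (- J) (\<lambda>_. lborel))
      = ennreal (sphere_half_area p) *
        (\<integral>\<^sup>+s. ennreal (s powr (real p / 2 - 1)) * indicator {0<..} s * H b (Q b + s) \<partial>lborel)"
      unfolding Kz using J by (subst nn_integral_PiM_sum_squares) (auto simp: p)
    also have "(\<integral>\<^sup>+s. ennreal (s powr (real p / 2 - 1)) * indicator {0<..} s * H b (Q b + s) \<partial>lborel)
       = (\<integral>\<^sup>+s. indicator {Q b<..} s * ennreal ((s - Q b) powr (real p / 2 - 1)) * H b s \<partial>lborel)"
      by (subst (2) nn_integral_real_affine[where c=1 and t="Q b"])
         (auto intro!: nn_integral_cong simp: indicator_def)
    finally show "(\<integral>\<^sup>+z. K (\<chi> i. if i \<in> J then b i else z i) \<partial>Pi\<^sub>M (- J) (\<lambda>_. lborel))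
      = ennreal (sphere_half_area p) *
       (\<integral>\<^sup>+s. indicator {Q b<..} s * ennreal ((s - Q b) powr (real p / 2 - 1)) * H b s \<partial>lborel)" .
  qed
  also have "\<dots> = ennreal (sphere_half_area p) * (\<integral>\<^sup>+b.
     (\<integral>\<^sup>+s. indicator {Q b<..} s * ennreal ((s - Q b) powr (real p / 2 - 1)) * H b s \<partial>lborel) \<partial>Pi\<^sub>M J (\<lambda>_. lborel))"
  proof (rule nn_integral_cmult)
    have "(\<lambda>b. (\<chi> l. if l \<in> J then b l else 0) :: real^'k) \<in> borel_measurable (Pi\<^sub>M J (\<lambda>_. lborel))"
    proof (rule borel_measurable_vec_lambda)
      show "(\<lambda>b. if l \<in> J then b l else 0 :: real) \<in> borel_measurable (Pi\<^sub>M J (\<lambda>_. lborel))" for l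
        by (cases "l \<in> J") auto
    qed
    then have [measurable]: "Q \<in> borel_measurable (Pi\<^sub>M J (\<lambda>_. lborel))"
      unfolding Q_def by measurable
    note [measurable] = H
    have [measurable]: "(\<lambda>x. H (fst x) (snd x)) \<in> borel_measurable (Pi\<^sub>M J (\<lambda>_. lborel) \<Otimes>\<^sub>M lborel)"
      using H by (simp add: split_def cong: measurable_cong_sets)
    have "(\<lambda>(b, s). indicator {Q b<..} s * ennreal ((s - Q b) powr (real p / 2 - 1)) * H b s)
        = (\<lambda>x. (if Q (fst x) < snd x then 1 else 0) * ennreal ((snd x - Q (fst x)) powr (real p / 2 - 1)) * H (fst x) (snd x))"
      by (auto simp: fun_eq_iff indicator_def)
    then show "(\<lambda>b. \<integral>\<^sup>+s. indicator {Q b<..} s * ennreal ((s - Q b) powr (real p / 2 - 1)) * H b s \<partial>lborel)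
       \<in> borel_measurable (Pi\<^sub>M J (\<lambda>_. lborel))"
      by (intro lborel.borel_measurable_nn_integral) simp
  qed
  finally have "(\<integral>\<^sup>+v. H (\<lambda>i\<in>J. w i \<bullet> v) (v \<bullet> v) \<partial>lborel) = ennreal (1 / \<bar>det B\<bar>) * (ennreal (sphere_half_area p) * (\<integral>\<^sup>+b.
     (\<integral>\<^sup>+s. indicator {Q b<..} s * ennreal ((s - Q b) powr (real p / 2 - 1)) * H b s \<partial>lborel) \<partial>Pi\<^sub>M J (\<lambda>_. lborel)))" .
  moreover have "ennreal (\<bar>det G\<bar> powr (- 1 / 2) * sphere_half_area p) = ennreal (1 / \<bar>det B\<bar>) * ennreal (sphere_half_area p)"
    by (simp add: dB' powr_minus_divide ennreal_mult'[symmetric])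
  ultimately show ?thesis by (simp only: mult.assoc)
qed

text \<open>Column number j, counted from 0, is free in the complement of the preceding j columns,
  of dimension k - j. The truncated difference is the true one for m \<le> k;
  \<open>gram_const_eq\<close> gives the closed form.\<close>

definition gram_const :: "nat \<Rightarrow> nat \<Rightarrow> real" where
  "gram_const k m = (\<Prod>j<m. sphere_half_area (k - j))"

lemma sphere_half_area_pos: "p > 0 \<Longrightarrow> sphere_half_area p > 0"
  by (simp add: sphere_half_area_def Gamma_real_pos)

lemma gram_const_pos: "m \<le> k \<Longrightarrow> gram_const k m > 0"
  by (auto simp: gram_const_def intro!: prod_pos sphere_half_area_pos)

text \<open>Let j = card J and e = (k - j)/2 - 1. The induction hypothesis gives |G|^((k-j-1)/2),
  the Jacobian of the new column |G|^(-1/2), and the density of the squared distance to the old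
  columns (|G'| / |G|)^e. The first two exponents add up to e, so all powers of |G| cancel and
  |G'|^e remains; e is the exponent belonging to j + 1.\<close>

lemma nn_integral_gram:
  fixes J :: "'k::finite set"
  assumes "F \<in> borel_measurable (Pi\<^sub>M (pairs J) (\<lambda>_. lborel))"
  shows "(\<integral>\<^sup>+w. F (restrict (gram w) (pairs J)) \<partial>Pi\<^sub>M J (\<lambda>_. lborel :: (real^'k) measure)) =
    ennreal (gram_const CARD('k) (card J)) *
    (\<integral>\<^sup>+r. indicator posdef_cone (padded J r) *
       ennreal (\<bar>det (padded J r)\<bar> powr ((real CARD('k) - real (card J) - 1) / 2)) * F r
      \<partial>Pi\<^sub>M (pairs J) (\<lambda>_. lborel))"
  using finite[of J] assms
proof (induction J arbitrary: F)
  case empty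
  have "pairs {} = ({} :: 'k set set)" by (auto simp: pairs_def)
  moreover have "padded {} r = (mat 1 :: real^'k^'k)" for r by (simp add: padded_def mat_def)
  moreover have "(mat 1 :: real^'k^'k) \<in> posdef_cone" by (simp add: posdef_cone_def)
  ultimately show ?case by (simp add: PiM_empty nn_integral_count_space_finite gram_const_def restrict_def)
next
  case (insert a J)
  interpret product_sigma_finite "\<lambda>_ :: 'k. lborel :: (real^'k) measure" by standard
  interpret JJ: product_sigma_finite "\<lambda>_ :: 'k. lborel :: real measure" by standard
  interpret PJ: sigma_finite_measure "Pi\<^sub>M J (\<lambda>_. lborel :: real measure)" by (rule JJ.sigma_finite) fact
  note a = \<open>a \<notin> J\<close> and Fm[measurable] = insert.prems
  define p where "p = CARD('k) - card J"
  have cJ: "card J < CARD('k)"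
    using a by (intro psubset_card_mono) auto
  then have p: "real p = real CARD('k) - real (card J)" "p > 0" by (simp_all add: p_def)
  define e where "e = real p / 2 - 1"
  have sp: "sphere_half_area p \<ge> 0" using sphere_half_area_pos[OF p(2)] by simp
  let ?G = "padded J"
  let ?G' = "\<lambda>r b s. padded (insert a J) (bordered a J r b s)"
  let ?R = "\<lambda>w. restrict (gram w) (pairs J)"
  \<comment> \<open>The integral over the new column depends on the old columns only through their
    Gram entries. \<Psi> is this dependence, stated with determinants so that the induction
    hypothesis can be applied to it.\<close>
  define \<Psi> where "\<Psi> r = ennreal (\<bar>det (?G r)\<bar> powr (- 1 / 2) * sphere_half_area p) *
      (\<integral>\<^sup>+b. \<integral>\<^sup>+s. indicator posdef_cone (?G' r b s) * ennreal ((\<bar>det (?G' r b s)\<bar> / \<bar>det (?G r)\<bar>) powr e) *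
         F (bordered a J r b s) \<partial>lborel \<partial>Pi\<^sub>M J (\<lambda>_. lborel))" for r
  have [measurable]: "Measurable.pred borel (\<lambda>x. x \<in> (posdef_cone :: (real^'k^'k) set))" by measurable
  have \<Psi>[measurable]: "\<Psi> \<in> borel_measurable (Pi\<^sub>M (pairs J) (\<lambda>_. lborel))"
    unfolding \<Psi>_def by measurable
  \<comment> \<open>The induction hypothesis for the indicator of the complement of the cone: its
    right-hand side vanishes, so linearly dependent families are null.\<close>
  have null: "AE w in Pi\<^sub>M J (\<lambda>_. lborel :: (real^'k) measure). ?G (gram w) \<in> posdef_cone"
  proof -
    have "(\<integral>\<^sup>+w. indicator (- posdef_cone) (?G (?R w)) \<partial>Pi\<^sub>M J (\<lambda>_. lborel :: (real^'k) measure)) = 0"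
      by (subst insert.IH) (auto simp: indicator_def intro!: nn_integral_0_iff_AE[THEN iffD2])
    moreover have "(\<lambda>w. indicator (- posdef_cone) (?G (?R w)) :: ennreal) \<in> borel_measurable (Pi\<^sub>M J (\<lambda>_. lborel :: (real^'k) measure))"
      by measurable
    ultimately have "AE w in Pi\<^sub>M J (\<lambda>_. lborel :: (real^'k) measure). indicator (- posdef_cone) (?G (?R w)) = (0 :: ennreal)"
      using nn_integral_0_iff_AE by blast
    then show ?thesis by eventually_elim (auto simp: indicator_def split: if_splits)
  qed
  have "(\<integral>\<^sup>+w. F (restrict (gram w) (pairs (insert a J))) \<partial>Pi\<^sub>M (insert a J) (\<lambda>_. lborel :: (real^'k) measure))
      = (\<integral>\<^sup>+w. \<integral>\<^sup>+v. F (restrict (gram (w(a := v))) (pairs (insert a J))) \<partial>lborel \<partial>Pi\<^sub>M J (\<lambda>_. lborel :: (real^'k) measure))"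
    using insert.hyps by (intro product_nn_integral_insert) auto
  also have "\<dots> = (\<integral>\<^sup>+w. \<integral>\<^sup>+v. F (bordered a J (?R w) (\<lambda>i\<in>J. w i \<bullet> v) (v \<bullet> v)) \<partial>lborel \<partial>Pi\<^sub>M J (\<lambda>_. lborel :: (real^'k) measure))"
    by (simp only: gram_bordered[OF a])
  also have "\<dots> = (\<integral>\<^sup>+w. \<Psi> (?R w) \<partial>Pi\<^sub>M J (\<lambda>_. lborel :: (real^'k) measure))"
  proof (rule nn_integral_cong_AE, use null AE_space in eventually_elim)
    fix w :: "'k \<Rightarrow> real^'k"
    assume pd: "?G (gram w) \<in> posdef_cone" and w: "w \<in> space (Pi\<^sub>M J (\<lambda>_. lborel :: (real^'k) measure))"
    have Rw: "?R w \<in> space (Pi\<^sub>M (pairs J) (\<lambda>_. lborel))" using measurable_space[OF measurable_gram w] .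
    have H: "(\<lambda>(b, s). F (bordered a J (?R w) b s)) \<in> borel_measurable (Pi\<^sub>M J (\<lambda>_. lborel) \<Otimes>\<^sub>M borel)"
      using Rw by measurable
    define Q where "Q b = (\<chi> l. if l \<in> J then b l else 0) \<bullet> (matrix_inv (?G (gram w)) *v (\<chi> l. if l \<in> J then b l else 0))" for b
    \<comment> \<open>By the Schur complement, s - Q b is the quotient of the bordered and the old
      determinant, and it is positive exactly when the bordered matrix is positive definite.\<close>
    have "indicator {Q b<..} s * ennreal ((s - Q b) powr (real p / 2 - 1)) =
        indicator posdef_cone (?G' (?R w) b s) * ennreal ((\<bar>det (?G' (?R w) b s)\<bar> / \<bar>det (?G (?R w))\<bar>) powr e)" for b s
    proof -
      define \<beta> :: "real^'k" where "\<beta> = (\<chi> l. if l \<in> J then b l else 0)"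
      have Ga: "?G (gram w) $ a $ j = (if j = a then 1 else 0)" for j using a by (simp add: padded_def)
      have \<beta>a: "\<beta> $ a = 0" using a by (simp add: \<beta>_def)
      have G': "?G' (?R w) b s = (\<chi> i j. if i = a \<and> j = a then s else if i = a then \<beta> $ j
          else if j = a then \<beta> $ i else ?G (gram w) $ i $ j)"
        unfolding padded_bordered[OF a] padded_restrict \<beta>_def ..
      have Q\<beta>: "Q b = \<beta> \<bullet> (matrix_inv (?G (gram w)) *v \<beta>)" by (simp add: Q_def \<beta>_def)
      have "?G' (?R w) b s \<in> posdef_cone \<longleftrightarrow> Q b < s" "det (?G' (?R w) b s) = det (?G (gram w)) * (s - Q b)"
        by (rule schur_complement_posdef[OF pd Ga \<beta>a G' Q\<beta>], rule schur_complement_det[OF pd Ga \<beta>a G' Q\<beta>])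
      then show ?thesis using posdef_cone_det_nonzero[OF pd] by (auto simp: indicator_def e_def abs_mult)
    qed
    then show "(\<integral>\<^sup>+v. F (bordered a J (?R w) (\<lambda>i\<in>J. w i \<bullet> v) (v \<bullet> v)) \<partial>lborel) = \<Psi> (?R w)"
      using nn_integral_inner_products[OF a refl pd H] by (simp add: \<Psi>_def p_def[symmetric] Q_def)
  qed
  also have "\<dots> = ennreal (gram_const CARD('k) (card J)) *
    (\<integral>\<^sup>+r. indicator posdef_cone (?G r) * ennreal (\<bar>det (?G r)\<bar> powr ((real CARD('k) - real (card J) - 1) / 2)) * \<Psi> r
      \<partial>Pi\<^sub>M (pairs J) (\<lambda>_. lborel))"
    by (rule insert.IH) simp
  also have "(\<integral>\<^sup>+r. indicator posdef_cone (?G r) * ennreal (\<bar>det (?G r)\<bar> powr ((real CARD('k) - real (card J) - 1) / 2)) * \<Psi> r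
      \<partial>Pi\<^sub>M (pairs J) (\<lambda>_. lborel))
    = (\<integral>\<^sup>+r. ennreal (sphere_half_area p) * (\<integral>\<^sup>+b. \<integral>\<^sup>+s. indicator posdef_cone (?G' r b s) * ennreal (\<bar>det (?G' r b s)\<bar> powr e) *
         F (bordered a J r b s) \<partial>lborel \<partial>Pi\<^sub>M J (\<lambda>_. lborel)) \<partial>Pi\<^sub>M (pairs J) (\<lambda>_. lborel))"
  proof (rule nn_integral_cong)
    fix r assume r: "r \<in> space (Pi\<^sub>M (pairs J) (\<lambda>_. lborel :: real measure))"
    show "indicator posdef_cone (?G r) * ennreal (\<bar>det (?G r)\<bar> powr ((real CARD('k) - real (card J) - 1) / 2)) * \<Psi> r
      = ennreal (sphere_half_area p) * (\<integral>\<^sup>+b. \<integral>\<^sup>+s. indicator posdef_cone (?G' r b s) * ennreal (\<bar>det (?G' r b s)\<bar> powr e) *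
         F (bordered a J r b s) \<partial>lborel \<partial>Pi\<^sub>M J (\<lambda>_. lborel))"
    proof (cases "?G r \<in> posdef_cone")
      case False
      \<comment> \<open>Outside the cone both sides vanish: no bordering of such a matrix is
        positive definite.\<close>
      have rem: "?G r = (\<chi> i j. if i = a \<or> j = a then if i = j then 1 else 0 else ?G' r b s $ i $ j)" for b s
        using a by (auto simp: vec_eq_iff padded_def bordered_old)
      have "?G' r b s \<notin> posdef_cone" for b s using posdef_cone_remove_row[OF _ rem, of b s] False by blast
      then show ?thesis using False by simp
    next
      case True
      have d: "det (?G r) \<noteq> 0" using posdef_cone_det_nonzero[OF True] .
      let ?D = "\<bar>det (?G r)\<bar>"
      have "indicator posdef_cone (?G r) * ennreal (?D powr ((real CARD('k) - real (card J) - 1) / 2)) * \<Psi> r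
        = ennreal (?D powr ((real CARD('k) - real (card J) - 1) / 2) * ?D powr (- 1 / 2) * sphere_half_area p) *
         (\<integral>\<^sup>+b. \<integral>\<^sup>+s. indicator posdef_cone (?G' r b s) * ennreal ((\<bar>det (?G' r b s)\<bar> / ?D) powr e) *
         F (bordered a J r b s) \<partial>lborel \<partial>Pi\<^sub>M J (\<lambda>_. lborel))"
        using True sp by (simp add: \<Psi>_def ennreal_mult mult.assoc)
      also have "?D powr ((real CARD('k) - real (card J) - 1) / 2) * ?D powr (- 1 / 2) = ?D powr e"
      proof -
        have "(real CARD('k) - real (card J) - 1) / 2 + - 1 / 2 = e" by (simp add: e_def p field_simps)
        then show ?thesis by (simp only: powr_add[symmetric])
      qed
      also have "ennreal (?D powr e * sphere_half_area p) *
         (\<integral>\<^sup>+b. \<integral>\<^sup>+s. indicator posdef_cone (?G' r b s) * ennreal ((\<bar>det (?G' r b s)\<bar> / ?D) powr e) *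
         F (bordered a J r b s) \<partial>lborel \<partial>Pi\<^sub>M J (\<lambda>_. lborel))
         = ennreal (sphere_half_area p) * (\<integral>\<^sup>+b. ennreal (?D powr e) * (\<integral>\<^sup>+s. indicator posdef_cone (?G' r b s) * ennreal ((\<bar>det (?G' r b s)\<bar> / ?D) powr e) *
         F (bordered a J r b s) \<partial>lborel) \<partial>Pi\<^sub>M J (\<lambda>_. lborel))"
        using r sp by (subst nn_integral_cmult) (auto simp: ennreal_mult mult_ac)
      also have "\<dots> = ennreal (sphere_half_area p) * (\<integral>\<^sup>+b. (\<integral>\<^sup>+s. ennreal (?D powr e) * (indicator posdef_cone (?G' r b s) * ennreal ((\<bar>det (?G' r b s)\<bar> / ?D) powr e) *
         F (bordered a J r b s)) \<partial>lborel) \<partial>Pi\<^sub>M J (\<lambda>_. lborel))"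
        using r by (intro arg_cong[where f="(*) _"] nn_integral_cong nn_integral_cmult[symmetric]) measurable
      also have "\<dots> = ennreal (sphere_half_area p) * (\<integral>\<^sup>+b. \<integral>\<^sup>+s. indicator posdef_cone (?G' r b s) * ennreal (\<bar>det (?G' r b s)\<bar> powr e) *
         F (bordered a J r b s) \<partial>lborel \<partial>Pi\<^sub>M J (\<lambda>_. lborel))"
      proof -
        have h: "ennreal (?D powr e) * ennreal ((\<bar>det (?G' r b s)\<bar> / ?D) powr e) = ennreal (\<bar>det (?G' r b s)\<bar> powr e)" for b s
          using d by (simp add: ennreal_mult[symmetric] powr_divide)
        have "ennreal (?D powr e) * (indicator posdef_cone (?G' r b s) * ennreal ((\<bar>det (?G' r b s)\<bar> / ?D) powr e) * F (bordered a J r b s))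
          = indicator posdef_cone (?G' r b s) * ennreal (\<bar>det (?G' r b s)\<bar> powr e) * F (bordered a J r b s)" for b s
          by (subst h[symmetric]) (simp only: mult_ac)
        then show ?thesis by (simp only: )
      qed
      finally show ?thesis .
    qed
  qed
  also have "\<dots> = ennreal (sphere_half_area p) * (\<integral>\<^sup>+r. \<integral>\<^sup>+b. \<integral>\<^sup>+s. indicator posdef_cone (?G' r b s) * ennreal (\<bar>det (?G' r b s)\<bar> powr e) *
         F (bordered a J r b s) \<partial>lborel \<partial>Pi\<^sub>M J (\<lambda>_. lborel) \<partial>Pi\<^sub>M (pairs J) (\<lambda>_. lborel))"
    by (rule nn_integral_cmult) measurable
  also have "(\<integral>\<^sup>+r. \<integral>\<^sup>+b. \<integral>\<^sup>+s. indicator posdef_cone (?G' r b s) * ennreal (\<bar>det (?G' r b s)\<bar> powr e) *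
         F (bordered a J r b s) \<partial>lborel \<partial>Pi\<^sub>M J (\<lambda>_. lborel) \<partial>Pi\<^sub>M (pairs J) (\<lambda>_. lborel))
    = (\<integral>\<^sup>+\<rho>. indicator posdef_cone (padded (insert a J) \<rho>) * ennreal (\<bar>det (padded (insert a J) \<rho>)\<bar> powr e) * F \<rho>
        \<partial>Pi\<^sub>M (pairs (insert a J)) (\<lambda>_. lborel))"
    by (rule nn_integral_PiM_pairs_insert[OF insert.hyps, symmetric]) measurable
  also have "ennreal (gram_const CARD('k) (card J)) * (ennreal (sphere_half_area p) * X)
      = ennreal (gram_const CARD('k) (card (insert a J))) * X" for X
    using insert.hyps sp gram_const_pos[of "card J" "CARD('k)"] cJ
    by (simp add: gram_const_def p_def[symmetric] ennreal_mult mult.assoc)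
  also have "e = (real CARD('k) - real (card (insert a J)) - 1) / 2"
    using insert.hyps by (simp add: e_def p field_simps)
  finally show ?case .
qed

section \<open>From padded matrices over \<open>'k\<close> to symmetric matrices over
  \<open>'m\<close>\<close>

text \<open>In the Leibniz formula a permutation that moves an index outside the range of \<iota>
  meets a zero entry of the identity block. The others are the images of permutations of
  \<open>'m\<close>, with the same sign.\<close>

lemma det_block_reindex:
  fixes S :: "real^'m^'m" and \<iota> :: "'m::finite \<Rightarrow> 'k::finite"
  assumes \<iota>: "inj \<iota>"
  shows "det ((\<chi> a b. if a \<in> range \<iota> \<and> b \<in> range \<iota> then S $ inv \<iota> a $ inv \<iota> b else if a = b then 1 else 0) :: real^'k^'k) = det S"
    (is "det ?A = _")
proof -
  let ?J = "range \<iota>"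
  define A where "A = ?A"
  have A0: "A $ i $ j = 0" if "i \<notin> ?J" "i \<noteq> j" for i j using that by (auto simp: A_def)
  have A1: "A $ i $ i = 1" if "i \<notin> ?J" for i using that by (auto simp: A_def)
  have AJ: "A $ \<iota> i $ \<iota> j = S $ i $ j" for i j using \<iota> by (simp add: A_def)
  have bij: "bij_betw \<iota> UNIV ?J" using \<iota> by (rule inj_on_imp_bij_betw)
  have bij': "bij_betw (inv \<iota>) ?J UNIV" using bij by (rule bij_betw_inv_into)
  have "det A = (\<Sum>p\<in>{p. p permutes UNIV}. of_int (sign p) * (\<Prod>i\<in>UNIV. A $ i $ p i))"
    by (simp only: det_def)
  also have "\<dots> = (\<Sum>p\<in>{p. p permutes ?J}. of_int (sign p) * (\<Prod>i\<in>UNIV. A $ i $ p i))"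
  proof (rule sum.mono_neutral_right)
    show "finite {p :: 'k \<Rightarrow> 'k. p permutes UNIV}" by (rule finite_permutations) simp
    show "{p. p permutes ?J} \<subseteq> {p. p permutes UNIV}" by (auto intro: permutes_subset)
    show "\<forall>p\<in>{p. p permutes UNIV} - {p. p permutes ?J}. of_int (sign p) * (\<Prod>i\<in>UNIV. A $ i $ p i) = 0"
    proof
      fix p assume "p \<in> {p. p permutes UNIV} - {p. p permutes ?J}"
      then obtain i where i: "i \<notin> ?J" "p i \<noteq> i"
        by (auto simp: permutes_def)
      have "(\<Prod>i\<in>UNIV. A $ i $ p i) = 0"
        using A0[OF i(1), of "p i"] i(2) by (intro prod_zero bexI[of _ i]) auto
      then show "of_int (sign p) * (\<Prod>i\<in>UNIV. A $ i $ p i) = 0" by simp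
    qed
  qed
  also have "\<dots> = (\<Sum>p\<in>{p. p permutes ?J}. of_int (sign p) * (\<Prod>i\<in>?J. A $ i $ p i))"
  proof (rule sum.cong[OF refl])
    fix p assume "p \<in> {p. p permutes ?J}"
    then have "p i = i" if "i \<notin> ?J" for i using that by (auto simp: permutes_def)
    then have "(\<Prod>i\<in>UNIV. A $ i $ p i) = (\<Prod>i\<in>?J. A $ i $ p i)"
      using A1 by (intro prod.mono_neutral_right) auto
    then show "of_int (sign p) * (\<Prod>i\<in>UNIV. A $ i $ p i) = of_int (sign p) * (\<Prod>i\<in>?J. A $ i $ p i)"
      by (simp only: )
  qed
  also have "\<dots> = (\<Sum>q\<in>{q. q permutes UNIV}. of_int (sign q) * (\<Prod>i\<in>UNIV. S $ i $ q i))"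
  proof (rule sum.reindex_bij_witness[where i="map_permutation UNIV \<iota>" and j="map_permutation ?J (inv \<iota>)"])
    fix p assume "p \<in> {p. p permutes ?J}"
    then have p: "p permutes ?J" by simp
    show m: "map_permutation UNIV \<iota> (map_permutation ?J (inv \<iota>) p) = p"
      by (rule map_permutation_compose_inv[OF bij' p]) (auto simp: f_inv_into_f)
    show "map_permutation ?J (inv \<iota>) p \<in> {q. q permutes UNIV}"
      using map_permutation_permutes[OF bij' p] by simp
    have s: "sign (map_permutation ?J (inv \<iota>) p) = sign p"
      using bij' p by (intro sign_map_permutation) (auto simp: bij_betw_def)
    have "(\<Prod>i\<in>?J. A $ i $ p i) = (\<Prod>i\<in>UNIV. A $ \<iota> i $ p (\<iota> i))"
      using \<iota> by (subst prod.reindex) (auto simp: o_def)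
    also have "\<dots> = (\<Prod>i\<in>UNIV. S $ i $ map_permutation ?J (inv \<iota>) p i)"
    proof (rule prod.cong[OF refl])
      fix i
      have "map_permutation ?J (inv \<iota>) p (inv \<iota> (\<iota> i)) = inv \<iota> (p (\<iota> i))"
        using bij' by (intro map_permutation_apply) (auto simp: bij_betw_def)
      moreover have "\<iota> (inv \<iota> (p (\<iota> i))) = p (\<iota> i)"
        using p by (intro f_inv_into_f) (simp add: permutes_in_image)
      ultimately show "A $ \<iota> i $ p (\<iota> i) = S $ i $ map_permutation ?J (inv \<iota>) p i"
        using AJ \<iota> by (metis inv_f_f)
    qed
    finally show "of_int (sign (map_permutation ?J (inv \<iota>) p)) * (\<Prod>i\<in>UNIV. S $ i $ map_permutation ?J (inv \<iota>) p i)
       = of_int (sign p) * (\<Prod>i\<in>?J. A $ i $ p i)" by (simp only: s)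
  next
    fix q :: "'m \<Rightarrow> 'm" assume "q \<in> {q. q permutes UNIV}"
    then have q: "q permutes UNIV" by simp
    show "map_permutation ?J (inv \<iota>) (map_permutation UNIV \<iota> q) = q"
      by (rule map_permutation_compose_inv[OF bij q]) (use \<iota> in auto)
    show "map_permutation UNIV \<iota> q \<in> {p. p permutes ?J}"
      using map_permutation_permutes[OF bij q] by simp
  qed
  also have "\<dots> = det S" by (simp only: det_def)
  finally show ?thesis by (simp only: A_def)
qed

text \<open>The quadratic form of the padded matrix is that of \<open>S\<close> in the coordinates
  from \<iota> plus the sum of squares of the other coordinates.\<close>

lemma posdef_cone_block_reindex:
  fixes S :: "real^'m^'m" and \<iota> :: "'m::finite \<Rightarrow> 'k::finite"
  assumes \<iota>: "inj \<iota>"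
  shows "((\<chi> a b. if a \<in> range \<iota> \<and> b \<in> range \<iota> then S $ inv \<iota> a $ inv \<iota> b else if a = b then 1 else 0) :: real^'k^'k)
    \<in> posdef_cone \<longleftrightarrow> S \<in> posdef_cone" (is "?A \<in> _ \<longleftrightarrow> _")
proof -
  let ?J = "range \<iota>"
  define A where "A = ?A"
  have AI: "A $ a $ b = (if a = b then 1 else 0)" if "a \<notin> ?J" for a b using that by (auto simp: A_def)
  have AI': "A $ a $ b = (if a = b then 1 else 0)" if "b \<notin> ?J" for a b using that by (auto simp: A_def)
  have AJ: "A $ \<iota> i $ \<iota> j = S $ i $ j" for i j using \<iota> by (simp add: A_def)
  have q: "x \<bullet> (A *v x) = (\<chi> i. x $ \<iota> i) \<bullet> (S *v (\<chi> i. x $ \<iota> i)) + (\<Sum>a\<in>-?J. (x $ a)\<^sup>2)" for x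
  proof -
    have U: "(\<Sum>a\<in>UNIV. g a) = (\<Sum>i\<in>UNIV. g (\<iota> i)) + (\<Sum>a\<in>-?J. g a)" for g :: "'k \<Rightarrow> real"
    proof -
      have "(\<Sum>a\<in>UNIV. g a) = (\<Sum>a\<in>?J \<union> -?J. g a)" by simp
      also have "\<dots> = (\<Sum>a\<in>?J. g a) + (\<Sum>a\<in>-?J. g a)" by (rule sum.union_disjoint) auto
      also have "(\<Sum>a\<in>?J. g a) = (\<Sum>i\<in>UNIV. g (\<iota> i))" using \<iota> by (subst sum.reindex) auto
      finally show ?thesis .
    qed
    have "(\<Sum>b\<in>UNIV. A $ \<iota> i $ b * x $ b) = (\<Sum>j\<in>UNIV. S $ i $ j * x $ \<iota> j)" for i
      by (subst U) (auto simp: AJ AI' intro!: sum.neutral)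
    moreover have "(\<Sum>b\<in>UNIV. A $ a $ b * x $ b) = x $ a" if "a \<notin> ?J" for a
    proof -
      have "(\<Sum>b\<in>UNIV. A $ a $ b * x $ b) = (\<Sum>b\<in>UNIV. if b = a then x $ b else 0)"
        using that by (intro sum.cong) (auto simp: AI)
      then show ?thesis by simp
    qed
    ultimately have "x \<bullet> (A *v x) = (\<Sum>i\<in>UNIV. x $ \<iota> i * (\<Sum>j\<in>UNIV. S $ i $ j * x $ \<iota> j)) + (\<Sum>a\<in>-?J. x $ a * x $ a)"
      unfolding inner_vec_def matrix_vector_mult_def by (subst U) (simp cong: if_cong)
    then show ?thesis by (simp add: inner_vec_def matrix_vector_mult_def power2_eq_square)
  qed
  have sym: "transpose A = A \<longleftrightarrow> transpose S = S"
  proof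
    assume "transpose A = A"
    then have "A $ a $ b = A $ b $ a" for a b unfolding transpose_def vec_eq_iff by simp
    then show "transpose S = S" using AJ unfolding transpose_def vec_eq_iff by (metis vec_lambda_beta)
  next
    assume "transpose S = S"
    then have "S $ a $ b = S $ b $ a" for a b unfolding transpose_def vec_eq_iff by simp
    then show "transpose A = A" unfolding transpose_def vec_eq_iff by (auto simp: A_def)
  qed
  have "A \<in> posdef_cone \<longleftrightarrow> S \<in> posdef_cone"
  proof
    assume A: "A \<in> posdef_cone"
    have "0 < y \<bullet> (S *v y)" if "y \<noteq> 0" for y
    proof -
      define x :: "real^'k" where "x = (\<chi> a. if a \<in> ?J then y $ inv \<iota> a else 0)"
      have y: "(\<chi> i. x $ \<iota> i) = y" using \<iota> by (simp add: x_def)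
      have "x \<noteq> 0"
      proof
        assume "x = 0"
        then have "y = 0" by (subst y[symmetric]) (simp add: vec_eq_iff)
        with that show False ..
      qed
      then have "0 < x \<bullet> (A *v x)" using A by (auto simp: posdef_cone_def)
      also have "x \<bullet> (A *v x) = y \<bullet> (S *v y)" unfolding q y by (auto simp: x_def)
      finally show ?thesis .
    qed
    then show "S \<in> posdef_cone" using A sym by (simp add: posdef_cone_def)
  next
    assume S: "S \<in> posdef_cone"
    have "0 < x \<bullet> (A *v x)" if "x \<noteq> 0" for x
    proof (cases "\<forall>i. x $ \<iota> i = 0")
      case True
      obtain a where a: "x $ a \<noteq> 0" using \<open>x \<noteq> 0\<close> by (auto simp: vec_eq_iff)
      with True have a': "a \<in> -?J" by auto
      have "0 < (\<Sum>a\<in>-?J. (x $ a)\<^sup>2)" using a a' by (intro sum_pos2[of _ a]) auto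
      moreover have "0 \<le> (\<chi> i. x $ \<iota> i) \<bullet> (S *v (\<chi> i. x $ \<iota> i))"
        using S by (auto simp: posdef_cone_alt)
      ultimately show ?thesis unfolding q by linarith
    next
      case False
      then have "(\<chi> i. x $ \<iota> i) \<noteq> 0" by (auto simp: vec_eq_iff)
      then have "0 < (\<chi> i. x $ \<iota> i) \<bullet> (S *v (\<chi> i. x $ \<iota> i))"
        using S by (auto simp: posdef_cone_def)
      moreover have "0 \<le> (\<Sum>a\<in>-?J. (x $ a)\<^sup>2)" by (intro sum_nonneg) auto
      ultimately show ?thesis unfolding q by linarith
    qed
    then show "A \<in> posdef_cone" using S sym by (simp add: posdef_cone_def)
  qed
  then show ?thesis by (simp only: A_def)
qed

text \<open>A matrix is a family of rows as a type, whereas its Gram matrix concerns the columns;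
  transposition turns one into the other and merely permutes the entries.\<close>

lemma lborel_distr_transpose: "distr lborel borel transpose = (lborel :: (real^'m^'n) measure)"
proof (rule lborel_eqI[symmetric])
  fix l u :: "real^'m^'n" assume le: "\<And>b. b \<in> Basis \<Longrightarrow> l \<bullet> b \<le> u \<bullet> b"
  have le': "l $ i $ j \<le> u $ i $ j" for i j
    using le[of "axis i (axis j 1)"] by (auto simp: inner_axis axis_in_Basis_iff)
  have "transpose -` box l u = box (transpose l) (transpose u)"
    by (auto simp: mem_box_vec transpose_def)
  then have "emeasure (distr lborel borel transpose) (box l u) = emeasure lborel (box (transpose l) (transpose u))"
    by (subst emeasure_distr) auto
  also have "\<dots> = ennreal (\<Prod>b\<in>Basis. (transpose u - transpose l) \<bullet> b)"
    by (rule emeasure_lborel_box) (auto simp: Basis_vec_def inner_axis transpose_def le')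
  also have "(\<Prod>b\<in>Basis. (transpose u - transpose l) \<bullet> b) = (\<Prod>b\<in>Basis. (u - l) \<bullet> b)"
    unfolding prod_Basis_vec by (subst prod.swap) (simp add: inner_axis transpose_def)
  finally show "emeasure (distr lborel borel transpose) (box l u) = ennreal (\<Prod>b\<in>Basis. (u - l) \<bullet> b)" .
qed simp

lemma nn_integral_lborel_transpose:
  assumes [measurable]: "f \<in> borel_measurable borel"
  shows "(\<integral>\<^sup>+\<omega>. f (transpose \<omega>) \<partial>lborel) = (\<integral>\<^sup>+V. f V \<partial>(lborel :: (real^'m^'n) measure))"
  by (subst lborel_distr_transpose[symmetric]) (simp add: nn_integral_distr)

text \<open>The Borel measure whose completion is \<open>lebesgue_sym\<close>. Densities and image
  measures are computed here, and the completion is taken afterwards.\<close>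

definition lborel_sym :: "(real^'m::{finite,linorder}^'m::{finite,linorder}) measure" where
  "lborel_sym = distr (Pi\<^sub>M {(i, j). i \<le> j} (\<lambda>_. lborel)) borel (\<lambda>r. \<chi> i j. r (min i j, max i j))"

lemma measurable_sym_matrix [measurable]:
  "(\<lambda>r. (\<chi> i j. r (min i j, max i j)) :: real^'m::{finite,linorder}^'m::{finite,linorder})
     \<in> borel_measurable (Pi\<^sub>M {(i, j). i \<le> j} (\<lambda>_. lborel))"
proof (intro borel_measurable_vec_lambda)
  fix i j :: 'm
  have "(min i j, max i j) \<in> {(i, j). i \<le> j}" by (auto simp: min_def max_def)
  from measurable_component_singleton[OF this, of "\<lambda>_. lborel :: real measure"]
  show "(\<lambda>r. r (min i j, max i j)) \<in> borel_measurable (Pi\<^sub>M {(i, j). i \<le> j} (\<lambda>_. lborel :: real measure))"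
    by simp
qed

text \<open>The Gram law above concerns vectors in k-space indexed by a subset of \<open>'k\<close>;
  m \<le> k provides such a subset as the range of an injection \<iota>. The exponent (k - m - 1)/2
  is k/2 - d.\<close>

lemma nn_integral_gram_matrix:
  fixes F :: "real^'m::{finite,linorder}^'m::{finite,linorder} \<Rightarrow> ennreal"
  assumes [measurable]: "F \<in> borel_measurable borel" and mk: "CARD('m) \<le> CARD('k)"
  shows "(\<integral>\<^sup>+\<omega>. F (transpose \<omega> ** \<omega>) \<partial>(lborel :: (real^'m::{finite,linorder}^'k::finite) measure)) =
    ennreal (gram_const CARD('k) CARD('m)) *
    (\<integral>\<^sup>+r. indicator posdef_cone r * ennreal (\<bar>det r\<bar> powr ((real CARD('k) - real CARD('m) - 1) / 2)) * F r \<partial>lborel_sym)"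
proof -
  obtain \<iota> :: "'m \<Rightarrow> 'k" where \<iota>: "inj \<iota>"
    using card_le_inj[of "UNIV :: 'm set" "UNIV :: 'k set"] mk by auto
  define J where "J = range \<iota>"
  have \<iota>J: "bij_betw \<iota> UNIV J" unfolding J_def using \<iota> by (rule inj_on_imp_bij_betw)
  have cJ: "card J = CARD('m)" using \<iota>J bij_betw_same_card by metis
  have \<iota>in: "\<iota> i \<in> J" for i by (simp add: J_def)
  define F0 where "F0 r = F (\<chi> i j. r {\<iota> i, \<iota> j})" for r
  have F0[measurable]: "F0 \<in> borel_measurable (Pi\<^sub>M (pairs J) (\<lambda>_. lborel))"
    unfolding F0_def
  proof (rule measurable_compose[OF _ assms(1)], intro borel_measurable_vec_lambda)
    fix i j
    have "{\<iota> i, \<iota> j} \<in> pairs J" using \<iota>in by simp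
    from measurable_component_singleton[OF this, of "\<lambda>_. lborel :: real measure"]
    show "(\<lambda>r. r {\<iota> i, \<iota> j}) \<in> borel_measurable (Pi\<^sub>M (pairs J) (\<lambda>_. lborel :: real measure))" by simp
  qed
  have "(\<integral>\<^sup>+\<omega>. F (transpose \<omega> ** \<omega>) \<partial>(lborel :: (real^'m::{finite,linorder}^'k) measure))
      = (\<integral>\<^sup>+\<omega>. (\<lambda>V. F (\<chi> i j. V $ i \<bullet> V $ j)) (transpose \<omega>) \<partial>(lborel :: (real^'m::{finite,linorder}^'k) measure))"
    by (intro nn_integral_cong arg_cong[where f=F])
       (simp add: vec_eq_iff matrix_matrix_mult_def transpose_def inner_vec_def)
  also have "\<dots> = (\<integral>\<^sup>+V. F (\<chi> i j. V $ i \<bullet> V $ j) \<partial>(lborel :: (real^'k^'m::{finite,linorder}) measure))"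
    by (rule nn_integral_lborel_transpose) measurable
  also have "\<dots> = (\<integral>\<^sup>+w. F (\<chi> i j. w i \<bullet> w j) \<partial>Pi\<^sub>M UNIV (\<lambda>_. lborel :: (real^'k) measure))"
    by (subst nn_integral_lborel_vec) auto
  also have "\<dots> = (\<integral>\<^sup>+w. F (\<chi> i j. w (\<iota> i) \<bullet> w (\<iota> j)) \<partial>Pi\<^sub>M J (\<lambda>_. lborel :: (real^'k) measure))"
    using \<iota>in by (subst nn_integral_PiM_reindex[OF lborel.sigma_finite_measure_axioms \<iota>J])
      (auto simp: inv_f_f[OF \<iota>])
  also have "\<dots> = (\<integral>\<^sup>+w. F0 (restrict (gram w) (pairs J)) \<partial>Pi\<^sub>M J (\<lambda>_. lborel :: (real^'k) measure))"
    by (simp add: F0_def \<iota>in)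
  also have "\<dots> = ennreal (gram_const CARD('k) (card J)) *
    (\<integral>\<^sup>+r. indicator posdef_cone (padded J r) *
       ennreal (\<bar>det (padded J r)\<bar> powr ((real CARD('k) - real (card J) - 1) / 2)) * F0 r
      \<partial>Pi\<^sub>M (pairs J) (\<lambda>_. lborel))"
    by (rule nn_integral_gram) simp
  also have "(\<integral>\<^sup>+r. indicator posdef_cone (padded J r) *
       ennreal (\<bar>det (padded J r)\<bar> powr ((real CARD('k) - real (card J) - 1) / 2)) * F0 r
      \<partial>Pi\<^sub>M (pairs J) (\<lambda>_. lborel)) =
     (\<integral>\<^sup>+r. indicator posdef_cone r * ennreal (\<bar>det r\<bar> powr ((real CARD('k) - real CARD('m) - 1) / 2)) * F r \<partial>lborel_sym)"
  proof -
    \<comment> \<open>Each unordered pair of indices in the range of \<iota> has exactly one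
      representative (i, j) with i \<le> j, which matches the Gram coordinates with those of
      \<open>lborel_sym\<close>.\<close>
    define h where "h = (\<lambda>(i, j). {\<iota> i, \<iota> j})"
    define P where "P = {(i :: 'm, j). i \<le> j}"
    have h: "bij_betw h P (pairs J)"
    proof (rule bij_betwI')
      fix x y assume "x \<in> P" "y \<in> P"
      then show "h x = h y \<longleftrightarrow> x = y"
        using \<iota> by (auto simp: h_def P_def doubleton_eq_iff inj_eq split: prod.splits)
    next
      fix x assume "x \<in> P" then show "h x \<in> pairs J" by (auto simp: h_def J_def split: prod.splits)
    next
      fix e assume "e \<in> pairs J"
      then obtain i j where "e = {\<iota> i, \<iota> j}" by (auto simp: J_def elim!: pairsE)
      then have "e = h (min i j, max i j)" "(min i j, max i j) \<in> P"
        by (auto simp: h_def P_def min_def max_def insert_commute)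
      then show "\<exists>x\<in>P. e = h x" by blast
    qed
    have hinv: "inv_into P h {\<iota> i, \<iota> j} = (min i j, max i j)" for i j
    proof -
      have "{\<iota> i, \<iota> j} = h (min i j, max i j)" "(min i j, max i j) \<in> P"
        by (auto simp: h_def P_def min_def max_def insert_commute)
      then show ?thesis using h by (metis bij_betw_def inv_into_f_f)
    qed
    have hinv1: "inv_into P h {\<iota> i} = (i, i)" for i using hinv[of i i] by simp
    let ?S = "\<lambda>r. (\<chi> i j. r (min i j, max i j)) :: real^'m::{finite,linorder}^'m::{finite,linorder}"
    have pad: "padded J (\<lambda>e\<in>pairs J. r (inv_into P h e)) =
        (\<chi> a b. if a \<in> range \<iota> \<and> b \<in> range \<iota> then ?S r $ inv \<iota> a $ inv \<iota> b else if a = b then 1 else 0)" for r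
      using hinv hinv1 \<iota> by (auto simp: padded_def vec_eq_iff J_def)
    have F0': "F0 (\<lambda>e\<in>pairs J. r (inv_into P h e)) = F (?S r)" for r
      by (simp add: F0_def hinv \<iota>in)
    have "(\<integral>\<^sup>+r. indicator posdef_cone (padded J r) *
       ennreal (\<bar>det (padded J r)\<bar> powr ((real CARD('k) - real (card J) - 1) / 2)) * F0 r \<partial>Pi\<^sub>M (pairs J) (\<lambda>_. lborel)) =
      (\<integral>\<^sup>+r. indicator posdef_cone (padded J (\<lambda>e\<in>pairs J. r (inv_into P h e))) *
       ennreal (\<bar>det (padded J (\<lambda>e\<in>pairs J. r (inv_into P h e)))\<bar> powr ((real CARD('k) - real (card J) - 1) / 2)) *
       F0 (\<lambda>e\<in>pairs J. r (inv_into P h e)) \<partial>Pi\<^sub>M P (\<lambda>_. lborel))"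
      by (rule nn_integral_PiM_reindex[OF lborel.sigma_finite_measure_axioms h]) auto
    also have "\<dots> = (\<integral>\<^sup>+r. indicator posdef_cone (?S r) *
       ennreal (\<bar>det (?S r)\<bar> powr ((real CARD('k) - real CARD('m) - 1) / 2)) * F (?S r) \<partial>Pi\<^sub>M P (\<lambda>_. lborel))"
      unfolding pad F0' det_block_reindex[OF \<iota>] indicator_def posdef_cone_block_reindex[OF \<iota>] cJ ..
    also have "\<dots> = (\<integral>\<^sup>+r. indicator posdef_cone r * ennreal (\<bar>det r\<bar> powr ((real CARD('k) - real CARD('m) - 1) / 2)) * F r \<partial>lborel_sym)"
      unfolding lborel_sym_def P_def by (subst nn_integral_distr) auto
    finally show ?thesis .
  qed
  finally show ?thesis by (simp only: cJ)
qed

section \<open>Completed measures and continuous images\<close>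

lemma completion_ex_borel_measurable_complex:
  fixes F :: "'a \<Rightarrow> complex"
  assumes "F \<in> borel_measurable (completion M)"
  shows "\<exists>G\<in>borel_measurable M. AE x in M. F x = G x"
proof -
  have "(\<lambda>x. Re (F x)) \<in> borel_measurable (completion M)" "(\<lambda>x. Im (F x)) \<in> borel_measurable (completion M)"
    using assms by auto
  then obtain g h where [measurable]: "g \<in> borel_measurable M" "h \<in> borel_measurable M"
    and ae: "AE x in M. Re (F x) = g x" "AE x in M. Im (F x) = h x"
    using completion_ex_borel_measurable_real by metis
  show ?thesis
  proof (intro bexI)
    show "AE x in M. F x = Complex (g x) (h x)"
      using ae by eventually_elim (simp add: complex_eq_iff)
    show "(\<lambda>x. Complex (g x) (h x)) \<in> borel_measurable M"
      by (simp add: borel_measurable_complex_iff)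
  qed
qed

lemma borel_measurable_completion_AE:
  assumes G: "G \<in> borel_measurable M" and ae: "AE x in M. F x = G x"
  shows "F \<in> borel_measurable (completion M)"
proof (rule borel_measurableI)
  fix U assume U: "open (U :: 'b set)"
  obtain N where N: "N \<in> null_sets M" "{x \<in> space M. F x \<noteq> G x} \<subseteq> N"
    using ae by (auto elim!: AE_E)
  have "F -` U \<inter> space M = (G -` U \<inter> space M - N) \<union> (F -` U \<inter> N \<inter> space M)"
    using N(2) by auto
  moreover have "G -` U \<inter> space M - N \<in> sets (completion M)"
    using N(1) measurable_sets[OF G borel_open[OF U]] by auto
  moreover have "F -` U \<inter> N \<inter> space M \<in> sets (completion M)"
    using N(1) by (intro completion.complete[of _ N]) (auto intro: null_sets_completionI)
  ultimately show "F -` U \<inter> space (completion M) \<in> sets (completion M)" by auto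
qed

lemma
  fixes F G :: "'a \<Rightarrow> complex"
  assumes G: "G \<in> borel_measurable M" and ae: "AE x in M. F x = G x"
  shows integrable_completion_AE: "integrable (completion M) F \<longleftrightarrow> integrable M G"
    and integral_completion_AE: "integral\<^sup>L (completion M) F = integral\<^sup>L M G"
proof -
  note F = borel_measurable_completion_AE[OF assms]
  have G': "G \<in> borel_measurable (completion M)" using G by (rule measurable_completion)
  have ae': "AE x in completion M. F x = G x" using ae by (rule AE_completion)
  show "integrable (completion M) F \<longleftrightarrow> integrable M G"
    using integrable_cong_AE[OF F G' ae'] integrable_completion[OF G] by simp
  show "integral\<^sup>L (completion M) F = integral\<^sup>L M G"
    using integral_cong_AE[OF F G' ae'] integral_completion[OF G] by simp
qed

text \<open>The image of a measurable set need not be measurable, so \<open>R\<close> supplies a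
  measurable subset of the image that captures almost all of the set. Used for the preimages of a
  set E and of its complement, this traps E between two measurable sets whose difference has a null
  preimage.\<close>

lemma borel_measurable_completion_distr:
  fixes F :: "'b \<Rightarrow> 'c::topological_space"
  assumes q: "q \<in> M \<rightarrow>\<^sub>M N"
    and R: "\<And>A. A \<in> sets M \<Longrightarrow> \<exists>B\<in>sets N. B \<subseteq> q ` A \<and> A - q -` B \<in> null_sets M"
    and F: "(\<lambda>x. F (q x)) \<in> borel_measurable (completion M)"
  shows "F \<in> borel_measurable (completion (distr M N q))"
proof (rule borel_measurableI)
  fix U assume U: "open (U :: 'c set)"
  define E where "E = F -` U \<inter> space N"
  \<comment> \<open>Only the preimage of X is known to be measurable. \<open>R\<close> for its
    \<open>main_part\<close> yields a measurable B inside X; the \<open>null_part\<close> is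
    absorbed in a null set Z.\<close>
  have approx: "\<exists>B\<in>sets N. B \<subseteq> X \<and> (q -` X \<inter> space M) - q -` B \<in> null_sets (completion M)"
    if X: "q -` X \<inter> space M \<in> sets (completion M)" for X
  proof -
    let ?Y = "q -` X \<inter> space M"
    obtain B where B: "B \<in> sets N" "B \<subseteq> q ` main_part M ?Y" "main_part M ?Y - q -` B \<in> null_sets M"
      using R[OF main_part_sets[OF X]] by blast
    obtain Z where Z: "Z \<in> null_sets M" "null_part M ?Y \<subseteq> Z" using null_part[OF X] by blast
    have Y: "?Y = main_part M ?Y \<union> null_part M ?Y" using main_part_null_part_Un[OF X] by simp
    have "B \<subseteq> X" using B(2) Y by blast
    moreover have "?Y - q -` B \<subseteq> (main_part M ?Y - q -` B) \<union> Z" using Y Z(2) by blast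
    then have "?Y - q -` B \<in> null_sets (completion M)"
      using B(3) Z(1) unfolding null_sets_completion_iff2 by (metis null_sets.Un)
    ultimately show ?thesis using B(1) by blast
  qed
  have "(\<lambda>x. F (q x)) -` U \<inter> space (completion M) \<in> sets (completion M)"
    using measurable_sets[OF F borel_open[OF U]] .
  moreover have "(\<lambda>x. F (q x)) -` U \<inter> space (completion M) = q -` E \<inter> space M"
    using measurable_space[OF q] by (auto simp: E_def)
  ultimately have E: "q -` E \<inter> space M \<in> sets (completion M)" by simp
  have "q -` (space N - E) \<inter> space M = space (completion M) - (q -` E \<inter> space M)"
    using measurable_space[OF q] by auto
  then have E': "q -` (space N - E) \<inter> space M \<in> sets (completion M)" using E by (simp add: sets.Diff)
  obtain B where B: "B \<in> sets N" "B \<subseteq> E" "(q -` E \<inter> space M) - q -` B \<in> null_sets (completion M)"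
    using approx[OF E] by blast
  obtain C where C: "C \<in> sets N" "C \<subseteq> space N - E" "(q -` (space N - E) \<inter> space M) - q -` C \<in> null_sets (completion M)"
    using approx[OF E'] by blast
  \<comment> \<open>What lies outside both B and C has null preimage, and E differs from B only
    there.\<close>
  have "q -` (space N - B - C) \<inter> space M \<subseteq> ((q -` E \<inter> space M) - q -` B) \<union> ((q -` (space N - E) \<inter> space M) - q -` C)"
    by auto
  then have "q -` (space N - B - C) \<inter> space M \<in> null_sets (completion M)"
    using null_sets_completion_subset null_sets.Un[OF B(3) C(3)] by blast
  moreover have "q -` (space N - B - C) \<inter> space M \<in> sets M"
    using q B(1) C(1) by (intro measurable_sets[OF q]) auto
  ultimately have "q -` (space N - B - C) \<inter> space M \<in> null_sets M" by (simp add: null_sets_completion_iff)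
  then have null: "space N - B - C \<in> null_sets (distr M N q)"
    using q B(1) C(1) by (auto simp: null_sets_def emeasure_distr)
  have "E = B \<union> (E - B)" using B(2) by auto
  moreover have "E - B \<subseteq> space N - B - C" using C(2) by (auto simp: E_def)
  then have "E - B \<in> sets (completion (distr M N q))"
    using null by (intro completion.complete) (auto intro: null_sets_completionI)
  moreover have "B \<in> sets (completion (distr M N q))" using B(1) by simp
  ultimately have "E \<in> sets (completion (distr M N q))" by (metis sets.Un)
  then show "F -` U \<inter> space (completion (distr M N q)) \<in> sets (completion (distr M N q))"
    by (simp add: E_def)
qed

text \<open>If F is measurable for the completed image, it may be replaced by a measurable function
  that agrees with it almost everywhere. If it is not, neither side is integrable and both integrals
  are 0 by convention, so the equivalence and the equality hold for arbitrary F.\<close>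

lemma
  fixes F :: "'b \<Rightarrow> complex"
  assumes q: "q \<in> M \<rightarrow>\<^sub>M N"
    and R: "\<And>A. A \<in> sets M \<Longrightarrow> \<exists>B\<in>sets N. B \<subseteq> q ` A \<and> A - q -` B \<in> null_sets M"
  shows integrable_completion_distr:
      "integrable (completion M) (\<lambda>x. F (q x)) \<longleftrightarrow> integrable (completion (distr M N q)) F"
    and integral_completion_distr:
      "integral\<^sup>L (completion M) (\<lambda>x. F (q x)) = integral\<^sup>L (completion (distr M N q)) F"
proof -
  have *: "(integrable (completion M) (\<lambda>x. F (q x)) \<longleftrightarrow> integrable (completion (distr M N q)) F) \<and>
    integral\<^sup>L (completion M) (\<lambda>x. F (q x)) = integral\<^sup>L (completion (distr M N q)) F"
    if Fm: "F \<in> borel_measurable (completion (distr M N q))"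
  proof -
    obtain G where G: "G \<in> borel_measurable (distr M N q)" "AE x in distr M N q. F x = G x"
      using completion_ex_borel_measurable_complex[OF Fm] by (rule bexE)
    then have GN: "G \<in> borel_measurable N" by simp
    have ae: "AE x in M. F (q x) = G (q x)" using AE_distrD[OF q G(2)] .
    have Gq: "(\<lambda>x. G (q x)) \<in> borel_measurable M" using measurable_compose[OF q GN] .
    show ?thesis
      using integrable_completion_AE[OF Gq ae] integrable_completion_AE[OF G]
        integral_completion_AE[OF Gq ae] integral_completion_AE[OF G]
        integrable_distr_eq[OF q GN] integral_distr[OF q GN] by simp
  qed
  have F: "F \<in> borel_measurable (completion (distr M N q))" if "(\<lambda>x. F (q x)) \<in> borel_measurable (completion M)"
    using borel_measurable_completion_distr[OF q R that] .
  show "integrable (completion M) (\<lambda>x. F (q x)) \<longleftrightarrow> integrable (completion (distr M N q)) F"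
    using * F by (metis borel_measurable_integrable)
  show "integral\<^sup>L (completion M) (\<lambda>x. F (q x)) = integral\<^sup>L (completion (distr M N q)) F"
    using * F by (metis borel_measurable_integrable not_integrable_integral_eq)
qed

text \<open>Where h vanishes, the values of F influence neither side; where h is positive,
  measurability passes from h F to F through division by h.\<close>

lemma
  fixes F :: "'a \<Rightarrow> complex" and h :: "'a \<Rightarrow> real"
  assumes h[measurable]: "h \<in> borel_measurable M" and pos: "\<And>x. 0 \<le> h x"
  shows integrable_completion_density:
      "integrable (completion (density M h)) F \<longleftrightarrow> integrable (completion M) (\<lambda>x. h x *\<^sub>R F x)"
    and integral_completion_density:
      "integral\<^sup>L (completion (density M h)) F = integral\<^sup>L (completion M) (\<lambda>x. h x *\<^sub>R F x)"
proof -
  let ?D = "density M (\<lambda>x. ennreal (h x))"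
  have *: "(integrable (completion ?D) F \<longleftrightarrow> integrable (completion M) (\<lambda>x. h x *\<^sub>R F x)) \<and>
    integral\<^sup>L (completion ?D) F = integral\<^sup>L (completion M) (\<lambda>x. h x *\<^sub>R F x)"
    if Fm: "F \<in> borel_measurable (completion ?D)"
  proof -
    obtain G where G: "G \<in> borel_measurable ?D" "AE x in ?D. F x = G x"
      using completion_ex_borel_measurable_complex[OF Fm] by (rule bexE)
    then have GM[measurable]: "G \<in> borel_measurable M" by simp
    have "AE x in M. 0 < ennreal (h x) \<longrightarrow> F x = G x" using G(2) by (simp add: AE_density)
    then have ae: "AE x in M. h x *\<^sub>R F x = h x *\<^sub>R G x"
    proof eventually_elim
      case (elim x)
      then show ?case using pos[of x] by (cases "h x = 0") auto
    qed
    have hG: "(\<lambda>x. h x *\<^sub>R G x) \<in> borel_measurable M" by measurable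
    show ?thesis
      using integrable_completion_AE[OF G] integral_completion_AE[OF G]
        integrable_completion_AE[OF hG ae] integral_completion_AE[OF hG ae]
        integrable_density[OF GM h] integral_density[OF GM h] pos by simp
  qed
  have F: "F \<in> borel_measurable (completion ?D)" if hF: "(\<lambda>x. h x *\<^sub>R F x) \<in> borel_measurable (completion M)"
  proof -
    obtain K where K[measurable]: "K \<in> borel_measurable M" and ae: "AE x in M. h x *\<^sub>R F x = K x"
      using completion_ex_borel_measurable_complex[OF hF] by (rule bexE)
    show ?thesis
    proof (rule borel_measurable_completion_AE)
      show "(\<lambda>x. (1 / h x) *\<^sub>R K x) \<in> borel_measurable ?D" by simp
      have "AE x in M. 0 < ennreal (h x) \<longrightarrow> F x = (1 / h x) *\<^sub>R K x"
        using ae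
      proof eventually_elim
        case (elim x)
        show ?case by (simp add: elim[symmetric])
      qed
      then show "AE x in ?D. F x = (1 / h x) *\<^sub>R K x" by (simp add: AE_density)
    qed
  qed
  show "integrable (completion ?D) F \<longleftrightarrow> integrable (completion M) (\<lambda>x. h x *\<^sub>R F x)"
    using * F by (metis borel_measurable_integrable)
  show "integral\<^sup>L (completion ?D) F = integral\<^sup>L (completion M) (\<lambda>x. h x *\<^sub>R F x)"
    using * F by (metis borel_measurable_integrable not_integrable_integral_eq)
qed

text \<open>Provides the hypothesis \<open>R\<close> of the preceding lemmas. Countably many compact
  subsets exhaust A up to a null set; their images are compact, so the union of these images is
  Borel, even if the image of A is not.\<close>

lemma continuous_image_inner_approx:
  fixes M :: "'a::{second_countable_topology, complete_space} measure" and q :: "'a \<Rightarrow> 'b::t2_space"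
  assumes M: "sigma_finite_measure M" "sets M = sets (restrict_space borel S)" and S: "S \<in> sets borel"
    and q: "continuous_on S q" and A: "A \<in> sets M"
  shows "\<exists>B\<in>sets borel. B \<subseteq> q ` A \<and> A - q -` B \<in> null_sets M"
proof -
  interpret sigma_finite_measure M by (rule M)
  have sp: "space M = S" using sets_eq_imp_space_eq[OF M(2)] by (simp add: space_restrict_space)
  have Mb: "X \<in> sets M \<longleftrightarrow> X \<in> sets borel \<and> X \<subseteq> S" for X
    using S unfolding M(2) by (auto simp: sets_restrict_space_iff)
  \<comment> \<open>Inner regularity is applied to a finite measure on all Borel sets. Weighting
    \<open>M\<close> by a positive function of finite integral keeps the null sets, and the identity
    map carries the result from S to the whole space.\<close>
  obtain h where h[measurable]: "h \<in> borel_measurable M" and fin: "integral\<^sup>N M h \<noteq> \<infinity>"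
    and pos: "\<And>x. x \<in> space M \<Longrightarrow> 0 < h x \<and> h x < \<infinity>"
    using Ex_finite_integrable_function by blast
  have id: "(\<lambda>x. x) \<in> density M h \<rightarrow>\<^sub>M borel"
    using S by (intro measurableI) (simp_all add: sp Mb sets.Int)
  define M' where "M' = distr (density M h) borel (\<lambda>x. x)"
  have M'e: "emeasure M' X = emeasure (density M h) X" if "X \<in> sets M" for X
    unfolding M'_def using that Mb sp by (subst emeasure_distr[OF id]) (auto intro!: arg_cong[where f="emeasure _"])
  have fin': "emeasure M' (space M') \<noteq> \<infinity>"
    unfolding M'_def using fin by (subst emeasure_distr[OF id]) (auto simp: emeasure_density intro: nn_integral_cong cong: nn_integral_cong)
  interpret M': finite_measure M' by standard (rule fin')
  have Ab: "A \<in> sets borel" "A \<subseteq> S" using A Mb by auto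
  have sM': "sets M' = sets borel" by (simp add: M'_def)
  have "\<exists>K. K \<subseteq> A \<and> compact K \<and> emeasure M' A \<le> emeasure M' K + ennreal (1 / real (Suc n))" for n
  proof (cases "emeasure M' A = 0")
    case True then show ?thesis by (intro exI[of _ "{}"]) auto
  next
    case False
    have "emeasure M' A - ennreal (1 / real (Suc n)) < emeasure M' A"
      using False M'.emeasure_finite[of A]
      by (intro ennreal_between) (simp_all add: zero_less_iff_neq_zero less_top[symmetric])
    also have "emeasure M' A = (SUP K \<in> {K. K \<subseteq> A \<and> compact K}. emeasure M' K)"
      using Ab fin' by (intro inner_regular) (auto simp: M'_def)
    finally obtain K where "K \<subseteq> A" "compact K" "emeasure M' A - ennreal (1 / real (Suc n)) < emeasure M' K"
      by (auto simp: less_SUP_iff)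
    then show ?thesis by (intro exI[of _ K]) (auto simp: ennreal_minus_le_iff add.commute dest!: less_imp_le)
  qed
  then obtain K where K: "\<And>n. K n \<subseteq> A" "\<And>n. compact (K n)"
    "\<And>n. emeasure M' A \<le> emeasure M' (K n) + ennreal (1 / real (Suc n))" by metis
  define B where "B = (\<Union>n. q ` K n)"
  have Kb: "K n \<in> sets borel" for n using K(2) by (simp add: borel_compact)
  have "compact (q ` K n)" for n
    using K(2) order_trans[OF K(1) Ab(2)] by (intro compact_continuous_image continuous_on_subset[OF q])
  then have B: "B \<in> sets borel" unfolding B_def by (intro sets.countable_UN) (auto intro: borel_compact)
  have le: "emeasure M' (A - (\<Union>n. K n)) \<le> ennreal (1 / real (Suc n))" for n
  proof -
    have "emeasure M' (A - (\<Union>n. K n)) \<le> emeasure M' (A - K n)"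
      using Ab Kb by (intro emeasure_mono) (auto simp: M'_def)
    also have "\<dots> = emeasure M' A - emeasure M' (K n)"
      using Ab Kb K(1) M'.emeasure_finite[of "K n"] by (intro emeasure_Diff) (auto simp: sM')
    also have "\<dots> \<le> ennreal (1 / real (Suc n))"
      using K(3)[of n] by (auto simp: ennreal_minus_le_iff)
    finally show ?thesis .
  qed
  have "emeasure M' (A - (\<Union>n. K n)) = 0"
  proof -
    have "(\<lambda>n. ennreal (1 / real (Suc n))) \<longlonglongrightarrow> ennreal 0"
      by (intro tendsto_ennrealI LIMSEQ_Suc lim_1_over_n)
    then have "emeasure M' (A - (\<Union>n. K n)) \<le> ennreal 0"
      by (rule LIMSEQ_le_const) (use le in blast)
    then show ?thesis by simp
  qed
  moreover have AK: "A - (\<Union>n. K n) \<in> sets M" unfolding Mb using Ab Kb by auto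
  ultimately have "A - (\<Union>n. K n) \<in> null_sets (density M h)"
    using M'e[OF AK] by (simp add: null_sets_def)
  then have "AE x in M. x \<in> A - (\<Union>n. K n) \<longrightarrow> h x = 0"
    using null_sets_density_iff[OF h] by simp
  then have "AE x in M. x \<notin> A - (\<Union>n. K n)"
    using AE_space by eventually_elim (use pos in force)
  then have "A - (\<Union>n. K n) \<in> null_sets M" using AK by (simp add: AE_iff_null_sets)
  moreover have "A - q -` B \<in> sets M"
  proof -
    have "q -` B \<inter> S \<in> sets (restrict_space borel S)"
      using measurable_sets[OF borel_measurable_continuous_on_restrict[OF q] B] by (simp add: space_restrict_space)
    then have "q -` B \<inter> S \<in> sets M" using M(2) by simp
    then have "A - (q -` B \<inter> S) \<in> sets M" using A by auto
    moreover have "A - (q -` B \<inter> S) = A - q -` B" using Ab by auto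
    ultimately show ?thesis by simp
  qed
  moreover have "A - q -` B \<subseteq> A - (\<Union>n. K n)" by (auto simp: B_def)
  ultimately have "A - q -` B \<in> null_sets M" by (metis null_sets_subset)
  moreover have "B \<subseteq> q ` A" using K(1) by (auto simp: B_def)
  ultimately show ?thesis using B by blast
qed

section \<open>Invariance of matrix integrals\<close>

lemma prod_pi_powr:
  "m \<le> k \<Longrightarrow> (\<Prod>j<m. pi powr (real (k - j) / 2)) = pi powr (real k * real m / 2 - real m * (real m - 1) / 4)"
proof (induction m)
  case (Suc m)
  have "(\<Prod>j<Suc m. pi powr (real (k - j) / 2)) = pi powr (real k * real m / 2 - real m * (real m - 1) / 4 + real (k - m) / 2)"
    using Suc by (simp add: powr_add)
  also have "real k * real m / 2 - real m * (real m - 1) / 4 + real (k - m) / 2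
      = real k * real (Suc m) / 2 - real (Suc m) * (real (Suc m) - 1) / 4"
    using Suc.prems by (simp add: of_nat_diff field_simps)
  finally show ?case .
qed simp

text \<open>The exponents (k - j)/2 for j < m add up to km/2 - m(m-1)/4, and the subtracted term is
  the power of pi inside \<open>siegel_Gamma\<close>.\<close>

lemma gram_const_eq:
  assumes "m \<le> k"
  shows "gram_const k m = pi powr (real k * real m / 2) / siegel_Gamma m (real k / 2)"
proof -
  have "gram_const k m = (\<Prod>j<m. pi powr (real (k - j) / 2)) / (\<Prod>j<m. Gamma (real (k - j) / 2))"
    by (simp add: gram_const_def sphere_half_area_def prod_dividef)
  also have "(\<Prod>j<m. Gamma (real (k - j) / 2)) = (\<Prod>j<m. Gamma (real k / 2 - real j / 2))"
    using assms by (intro prod.cong refl) (simp add: of_nat_diff diff_divide_distrib)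
  finally show ?thesis
    unfolding prod_pi_powr[OF assms] by (simp add: siegel_Gamma_def powr_diff)
qed

text \<open>Turns a quotient of Stiefel volumes with equal m into a quotient of Gram constants, the
  factors 2^m cancelling.\<close>

lemma stiefel_volume_eq: "m \<le> n \<Longrightarrow> stiefel_volume n m = 2 ^ m * gram_const n m"
  by (simp add: stiefel_volume_def gram_const_eq)

lemma stiefel_volume_pos: "m \<le> n \<Longrightarrow> 0 < stiefel_volume n m"
  by (simp add: stiefel_volume_eq gram_const_pos)

lemma transpose_add: "transpose (A + B) = transpose A + transpose B" for A :: "real^'m^'n"
  by (simp add: transpose_def vec_eq_iff)

lemma gram_matrix_symmetric: "transpose (transpose A ** A) = transpose A ** A" for A :: "real^'m^'n"
  by (simp add: matrix_transpose_mul)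

lemma quadratic_form_gram: "x \<bullet> ((transpose A ** A) *v x) = (A *v x) \<bullet> (A *v x)" for A :: "real^'m^'n"
  by (subst inner_matrix_vector_transpose) (simp only: matrix_vector_mul_assoc)

lemma posdef_cone_add_gram:
  fixes A :: "real^'m^'n"
  assumes "r \<in> posdef_cone" shows "r + transpose A ** A \<in> posdef_cone"
proof -
  have "0 < x \<bullet> ((r + transpose A ** A) *v x)" if "x \<noteq> 0" for x
    using assms that quadratic_form_gram[of x A]
    by (simp add: posdef_cone_def matrix_vector_mult_add_rdistrib inner_add_right add_pos_nonneg)
  then show ?thesis using assms by (simp add: posdef_cone_def transpose_add gram_matrix_symmetric)
qed

lemma gram_matrix_stack:
  "transpose (stack \<omega> t) ** stack \<omega> t = transpose \<omega> ** \<omega> + transpose t ** t"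
  for \<omega> :: "real^'m^'k" and t :: "real^'m^'l"
proof -
  have "(\<Sum>i\<in>UNIV. g i) = (\<Sum>a\<in>UNIV. g (Inl a)) + (\<Sum>b\<in>UNIV. g (Inr b))" for g :: "'k + 'l \<Rightarrow> real"
    by (subst UNIV_Plus_UNIV[symmetric], subst sum.Plus) (simp_all add: o_def)
  then show ?thesis
    by (simp add: vec_eq_iff matrix_matrix_mult_def transpose_def stack_def)
qed

lemma sigma_finite_lborel_PiM_pairs: "sigma_finite_measure (Pi\<^sub>M {(i, j). i \<le> (j :: 'm::{finite,linorder})} (\<lambda>_. lborel :: real measure))"
proof -
  interpret product_sigma_finite "\<lambda>_ :: 'm \<times> 'm. lborel :: real measure" by standard
  show ?thesis by (rule sigma_finite) simp
qed

lemma sets_lborel_sym [simp, measurable_cong]: "sets lborel_sym = sets borel"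
  by (simp add: lborel_sym_def)

lemma space_lborel_sym [simp]: "space lborel_sym = UNIV"
  by (simp add: lborel_sym_def)

lemma lebesgue_sym_eq: "lebesgue_sym = completion lborel_sym"
  by (simp add: lebesgue_sym_def lborel_sym_def)

text \<open>Each independent entry undergoes an affine map of slope 1 or -1. The translations and
  the reflections r -> s - r serve the two kinds of fractional integrals.\<close>

lemma nn_integral_lborel_sym_affine:
  fixes f :: "real^'m::{finite,linorder}^'m::{finite,linorder} \<Rightarrow> ennreal"
  assumes f[measurable]: "f \<in> borel_measurable borel" and s: "transpose s = s" and c: "\<bar>c\<bar> = 1"
  shows "(\<integral>\<^sup>+r. f (s + c *\<^sub>R r) \<partial>lborel_sym) = (\<integral>\<^sup>+r. f r \<partial>lborel_sym)"
proof -
  let ?P = "{(i, j). i \<le> (j :: 'm)}"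
  let ?S = "\<lambda>r. (\<chi> i j. r (min i j, max i j)) :: real^'m::{finite,linorder}^'m::{finite,linorder}"
  have S: "?S (\<lambda>p\<in>?P. s $ fst p $ snd p + c * r p) = s + c *\<^sub>R ?S r" for r
  proof -
    have "(min i j, max i j) \<in> ?P" for i j :: 'm by (auto simp: min_def max_def)
    moreover have "s $ min i j $ max i j = s $ i $ j" for i j
      using s by (auto simp: min_def max_def transpose_def vec_eq_iff)
    ultimately show ?thesis by (auto simp: vec_eq_iff)
  qed
  have "(\<integral>\<^sup>+r. f (s + c *\<^sub>R r) \<partial>lborel_sym) = (\<integral>\<^sup>+r. f (s + c *\<^sub>R ?S r) \<partial>Pi\<^sub>M ?P (\<lambda>_. lborel))"
    unfolding lborel_sym_def by (subst nn_integral_distr) auto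
  also have "\<dots> = (\<integral>\<^sup>+r. (\<lambda>r. f (?S r)) (\<lambda>p\<in>?P. s $ fst p $ snd p + c * r p) \<partial>Pi\<^sub>M ?P (\<lambda>_. lborel))"
    by (simp only: S)
  also have "\<dots> = (\<Prod>p\<in>?P. 1) * (\<integral>\<^sup>+r. f (?S r) \<partial>Pi\<^sub>M ?P (\<lambda>_. lborel))"
  proof (rule nn_integral_PiM_componentwise[where T="\<lambda>p y. s $ fst p $ snd p + c * y" and D="\<lambda>_. 1"])
    fix p :: "'m \<times> 'm" and g :: "real \<Rightarrow> ennreal" assume "g \<in> borel_measurable lborel"
    then have "(\<integral>\<^sup>+x. g x \<partial>lborel) = \<bar>c\<bar> * (\<integral>\<^sup>+x. g (s $ fst p $ snd p + c * x) \<partial>lborel)"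
      using c by (intro nn_integral_real_affine) auto
    then show "(\<integral>\<^sup>+x. g (s $ fst p $ snd p + c * x) \<partial>lborel) = 1 * (\<integral>\<^sup>+x. g x \<partial>lborel)"
      using c by simp
  qed (auto intro: lborel.sigma_finite_measure_axioms)
  also have "\<dots> = (\<integral>\<^sup>+r. f r \<partial>lborel_sym)"
    unfolding lborel_sym_def by (subst nn_integral_distr) auto
  finally show ?thesis .
qed

text \<open>The trace of X'X is the squared norm of X, so the sets of bounded trace pull back to
  bounded sets. Needed for the uniqueness of densities with respect to this image.\<close>

lemma sigma_finite_gram_distr:
  "sigma_finite_measure (distr (lborel :: (real^'m^'n) measure) borel (\<lambda>X. transpose X ** X))" (is "sigma_finite_measure ?D")
proof
  have tr: "(\<Sum>i\<in>UNIV. (transpose X ** X) $ i $ i) = (norm X)\<^sup>2" for X :: "real^'m^'n"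
  proof -
    have "(\<Sum>i\<in>UNIV. (transpose X ** X) $ i $ i) = (\<Sum>i\<in>UNIV. \<Sum>j\<in>UNIV. X $ j $ i * X $ j $ i)"
      by (simp add: matrix_matrix_mult_def transpose_def)
    also have "\<dots> = (\<Sum>j\<in>UNIV. \<Sum>i\<in>UNIV. X $ j $ i * X $ j $ i)" by (rule sum.swap)
    also have "\<dots> = X \<bullet> X" by (simp add: inner_vec_def)
    finally show ?thesis by (simp add: power2_norm_eq_inner)
  qed
  define A :: "nat \<Rightarrow> (real^'m^'m) set" where "A n = {r. (\<Sum>i\<in>UNIV. r $ i $ i) \<le> real n}" for n
  have m: "A n \<in> sets borel" for n unfolding A_def by measurable
  have "emeasure ?D (A n) \<noteq> \<infinity>" for n
  proof -
    have "(\<lambda>X :: real^'m^'n. transpose X ** X) -` A n \<subseteq> cball 0 (sqrt (real n))"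
      by (auto simp: A_def tr dist_norm real_le_rsqrt)
    then have "emeasure lborel ((\<lambda>X :: real^'m^'n. transpose X ** X) -` A n) \<le> emeasure lborel (cball (0 :: real^'m^'n) (sqrt (real n)))"
      by (intro emeasure_mono) auto
    also have "\<dots> < \<infinity>" by (rule emeasure_lborel_cball_finite)
    finally show ?thesis using m by (subst emeasure_distr) auto
  qed
  moreover have "(\<Union>n. A n) = UNIV" using real_arch_simple by (auto simp: A_def)
  ultimately show "\<exists>A. countable A \<and> A \<subseteq> sets ?D \<and> \<Union> A = space ?D \<and> (\<forall>a\<in>A. emeasure ?D a \<noteq> \<infinity>)"
    using m by (intro exI[of _ "range A"]) auto
qed

text \<open>After a transposition, g acts on every column separately with Jacobian 1.\<close>

lemma nn_integral_lborel_orthogonal: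
  fixes g :: "real^'n^'n" and f :: "real^'m^'n \<Rightarrow> ennreal"
  assumes g: "orthogonal_matrix g" and [measurable]: "f \<in> borel_measurable borel"
  shows "(\<integral>\<^sup>+X. f (g ** X) \<partial>lborel) = (\<integral>\<^sup>+X. f X \<partial>lborel)"
proof -
  have dg: "\<bar>det g\<bar> = 1" using det_orthogonal_matrix[OF g] by auto
  then have dg0: "det g \<noteq> 0" by auto
  have gm[measurable]: "(*v) g \<in> borel_measurable borel"
    by (intro borel_measurable_continuous_onI continuous_intros)
  have "(\<integral>\<^sup>+X. f (g ** X) \<partial>lborel) = (\<integral>\<^sup>+X. (\<lambda>V. f (transpose (\<chi> i. g *v V $ i))) (transpose X) \<partial>lborel)"
    by (intro nn_integral_cong arg_cong[where f=f])
       (simp add: vec_eq_iff transpose_def matrix_matrix_mult_def matrix_vector_mult_def)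
  also have "\<dots> = (\<integral>\<^sup>+V. f (transpose (\<chi> i. g *v V $ i)) \<partial>(lborel :: (real^'n^'m) measure))"
    by (rule nn_integral_lborel_transpose) measurable
  also have "\<dots> = (\<Prod>i\<in>(UNIV::'m set). 1) * (\<integral>\<^sup>+V. f (transpose V) \<partial>(lborel :: (real^'n^'m) measure))"
  proof (rule nn_integral_lborel_vec_componentwise[where T="\<lambda>_. (*v) g" and D="\<lambda>_. 1" and f="\<lambda>V. f (transpose V)"])
    fix h :: "real^'n \<Rightarrow> ennreal" assume "h \<in> borel_measurable borel"
    from nn_integral_lborel_matrix[OF dg0 this]
    show "(\<integral>\<^sup>+x. h (g *v x) \<partial>lborel) = 1 * (\<integral>\<^sup>+x. h x \<partial>lborel)" by (simp add: dg)
  qed measurable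
  also have "\<dots> = (\<integral>\<^sup>+X. f X \<partial>lborel)" by (simp add: nn_integral_lborel_transpose)
  finally show ?thesis .
qed

text \<open>Each of the k rows is multiplied by the transpose of A and contributes the factor 1 /
  |det A|.\<close>

lemma nn_integral_lborel_mult_right:
  fixes A :: "real^'m^'m" and f :: "real^'m^'k \<Rightarrow> ennreal"
  assumes A: "det A \<noteq> 0" and [measurable]: "f \<in> borel_measurable borel"
  shows "(\<integral>\<^sup>+\<omega>. f (\<omega> ** A) \<partial>lborel) = ennreal (\<bar>det A\<bar> powr (- real CARD('k))) * (\<integral>\<^sup>+\<omega>. f \<omega> \<partial>lborel)"
proof -
  have [measurable]: "(*v) (transpose A) \<in> borel_measurable borel"
    by (intro borel_measurable_continuous_onI continuous_intros)
  have "(\<integral>\<^sup>+\<omega>. f (\<omega> ** A) \<partial>lborel) = (\<integral>\<^sup>+\<omega>. f (\<chi> i. transpose A *v \<omega> $ i) \<partial>lborel)"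
    by (intro nn_integral_cong arg_cong[where f=f])
       (simp add: vec_eq_iff transpose_def matrix_matrix_mult_def matrix_vector_mult_def mult.commute del: transpose_matrix_vector)
  also have "\<dots> = (\<Prod>i\<in>(UNIV::'k set). ennreal (1 / \<bar>det A\<bar>)) * (\<integral>\<^sup>+\<omega>. f \<omega> \<partial>lborel)"
  proof (rule nn_integral_lborel_vec_componentwise)
    fix h :: "real^'m \<Rightarrow> ennreal" assume h: "h \<in> borel_measurable borel"
    have "ennreal (1 / \<bar>det A\<bar>) * (\<integral>\<^sup>+x. h x \<partial>lborel)
       = ennreal (1 / \<bar>det A\<bar>) * (ennreal \<bar>det A\<bar> * (\<integral>\<^sup>+x. h (transpose A *v x) \<partial>lborel))"
      using nn_integral_lborel_matrix[of "transpose A" h] A h by (simp del: transpose_matrix_vector)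
    also have "\<dots> = ennreal (1 / \<bar>det A\<bar> * \<bar>det A\<bar>) * (\<integral>\<^sup>+x. h (transpose A *v x) \<partial>lborel)"
      by (simp only: ennreal_mult mult.assoc abs_ge_zero zero_le_divide_1_iff)
    also have "\<dots> = (\<integral>\<^sup>+x. h (transpose A *v x) \<partial>lborel)" using A by simp
    finally show "(\<integral>\<^sup>+x. h (transpose A *v x) \<partial>lborel) = ennreal (1 / \<bar>det A\<bar>) * (\<integral>\<^sup>+x. h x \<partial>lborel)" ..
  qed measurable
  also have "(\<Prod>i\<in>(UNIV::'k set). ennreal (1 / \<bar>det A\<bar>)) = ennreal ((1 / \<bar>det A\<bar>) ^ CARD('k))"
    by (simp add: ennreal_power)
  also have "(1 / \<bar>det A\<bar>) ^ CARD('k) = \<bar>det A\<bar> powr (- real CARD('k))"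
    using A by (simp add: powr_minus powr_realpow power_one_over inverse_eq_divide)
  finally show ?thesis .
qed

lemma nn_integral_lborel_stack:
  fixes f :: "real^'m^('k::finite + 'l::finite) \<Rightarrow> ennreal"
  assumes [measurable]: "f \<in> borel_measurable borel"
  shows "(\<integral>\<^sup>+X. f X \<partial>lborel) = (\<integral>\<^sup>+\<omega>. \<integral>\<^sup>+t. f (stack \<omega> t) \<partial>lborel \<partial>lborel)"
proof -
  interpret product_sigma_finite "\<lambda>_ :: 'k + 'l. lborel :: (real^'m) measure" by standard
  have vm[measurable]: "(vec_lambda :: ('k + 'l \<Rightarrow> real^'m) \<Rightarrow> _) \<in> borel_measurable (Pi\<^sub>M UNIV (\<lambda>_. lborel))"
    by (rule borel_measurable_vec_lambda) simp
  have [measurable]: "(\<lambda>(\<omega>, t). stack \<omega> t) \<in> borel_measurable ((borel :: (real^'m^'k) measure) \<Otimes>\<^sub>M (borel :: (real^'m^'l) measure))"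
    unfolding stack_def
  proof (simp only: split_def, rule borel_measurable_vec_lambda)
    fix i :: "'k + 'l"
    show "(\<lambda>p. case i of Inl a \<Rightarrow> fst p $ a | Inr b \<Rightarrow> snd p $ b) \<in> borel_measurable ((borel :: (real^'m^'k) measure) \<Otimes>\<^sub>M (borel :: (real^'m^'l) measure))"
      by (cases i) auto
  qed
  have fs: "(\<lambda>(\<omega>, t). f (stack \<omega> t)) \<in> borel_measurable ((lborel :: (real^'m^'k) measure) \<Otimes>\<^sub>M (lborel :: (real^'m^'l) measure))"
    by measurable
  let ?L = "range (Inl :: 'k \<Rightarrow> 'k + 'l)" and ?R = "range (Inr :: 'l \<Rightarrow> 'k + 'l)"
  have L: "bij_betw Inl UNIV ?L" and R: "bij_betw Inr UNIV ?R" by (auto simp: bij_betw_def)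
  have nR: "- ?L = ?R" using UNIV_sum by auto
  have invL: "inv Inl (Inl a) = a" for a :: 'k by (simp add: inv_f_f)
  have invR: "inv Inr (Inr b) = b" for b :: 'l by (simp add: inv_f_f)
  have mLR: "(\<lambda>(w, z). f (\<chi> i. if i \<in> ?L then w i else z i)) \<in> borel_measurable
      (Pi\<^sub>M ?L (\<lambda>_. lborel :: (real^'m) measure) \<Otimes>\<^sub>M Pi\<^sub>M ?R (\<lambda>_. lborel))"
  proof -
    have "(\<lambda>p. if i \<in> ?L then fst p i else snd p i) \<in> borel_measurable (Pi\<^sub>M ?L (\<lambda>_. lborel :: (real^'m) measure) \<Otimes>\<^sub>M Pi\<^sub>M ?R (\<lambda>_. lborel))" for i
    proof (cases "i \<in> ?L")
      case True
      then show ?thesis using measurable_compose[OF measurable_fst measurable_component_singleton[OF True]] by simp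
    next
      case False
      then have "i \<in> ?R" using nR by auto
      then show ?thesis using False measurable_compose[OF measurable_snd measurable_component_singleton[OF \<open>i \<in> ?R\<close>]] by simp
    qed
    then show ?thesis unfolding split_def by measurable
  qed
  interpret R: sigma_finite_measure "Pi\<^sub>M ?R (\<lambda>_. lborel :: (real^'m) measure)" by (rule sigma_finite) simp
  have "(\<integral>\<^sup>+X. f X \<partial>lborel) = (\<integral>\<^sup>+w. \<integral>\<^sup>+z. f (\<chi> i. if i \<in> ?L then w i else z i)
      \<partial>Pi\<^sub>M ?R (\<lambda>_. lborel) \<partial>Pi\<^sub>M ?L (\<lambda>_. lborel))"
    using nn_integral_lborel_vec_split[of f ?L] by (simp only: nR assms)
  also have "\<dots> = (\<integral>\<^sup>+w. \<integral>\<^sup>+z. f (\<chi> i. if i \<in> ?L then (\<lambda>b\<in>?L. w (inv Inl b)) i else z i)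
      \<partial>Pi\<^sub>M ?R (\<lambda>_. lborel) \<partial>Pi\<^sub>M UNIV (\<lambda>_. lborel))"
    by (rule nn_integral_PiM_reindex[OF lborel.sigma_finite_measure_axioms L]) (auto intro: R.borel_measurable_nn_integral mLR)
  also have "\<dots> = (\<integral>\<^sup>+w. \<integral>\<^sup>+z. f (\<chi> i. if i \<in> ?L then (\<lambda>b\<in>?L. w (inv Inl b)) i else (\<lambda>b\<in>?R. z (inv Inr b)) i)
      \<partial>Pi\<^sub>M UNIV (\<lambda>_. lborel) \<partial>Pi\<^sub>M UNIV (\<lambda>_. lborel))"
  proof -
    have "(\<integral>\<^sup>+z. f (\<chi> i. if i \<in> ?L then (\<lambda>b\<in>?L. w (inv Inl b)) i else z i) \<partial>Pi\<^sub>M ?R (\<lambda>_. lborel)) =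
      (\<integral>\<^sup>+z. f (\<chi> i. if i \<in> ?L then (\<lambda>b\<in>?L. w (inv Inl b)) i else (\<lambda>b\<in>?R. z (inv Inr b)) i) \<partial>Pi\<^sub>M UNIV (\<lambda>_. lborel))"
      for w :: "'k \<Rightarrow> real^'m"
    proof -
    have "(\<lambda>b\<in>?L. w (inv Inl b)) \<in> space (Pi\<^sub>M ?L (\<lambda>_. lborel))" by (simp add: space_PiM)
    from measurable_compose[OF measurable_Pair1'[OF this] mLR]
    have "(\<lambda>z. f (\<chi> i. if i \<in> ?L then (\<lambda>b\<in>?L. w (inv Inl b)) i else z i)) \<in> borel_measurable (Pi\<^sub>M ?R (\<lambda>_. lborel))"
      by (simp only: split_conv)
    then show ?thesis
      by (rule nn_integral_PiM_reindex[where f="\<lambda>z. f (\<chi> i. if i \<in> ?L then (\<lambda>b\<in>?L. w (inv Inl b)) i else z i)",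
            OF lborel.sigma_finite_measure_axioms R finite])
    qed
    then show ?thesis by (simp only: )
  qed
  also have "\<dots> = (\<integral>\<^sup>+w. \<integral>\<^sup>+z. f (stack (vec_lambda w) (vec_lambda z)) \<partial>Pi\<^sub>M UNIV (\<lambda>_. lborel) \<partial>Pi\<^sub>M UNIV (\<lambda>_. lborel))"
  proof -
    have e: "(\<chi> i. if i \<in> ?L then (\<lambda>b\<in>?L. w (inv Inl b)) i else (\<lambda>b\<in>?R. z (inv Inr b)) i) = stack (vec_lambda w) (vec_lambda z)" for w z
    proof (rule vec_eq_iff[THEN iffD2], rule allI)
      fix i show "(\<chi> i. if i \<in> ?L then (\<lambda>b\<in>?L. w (inv Inl b)) i else (\<lambda>b\<in>?R. z (inv Inr b)) i) $ i = stack (vec_lambda w) (vec_lambda z) $ i"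
        by (cases i) (auto simp: stack_def invL invR)
    qed
    show ?thesis by (intro nn_integral_cong arg_cong[where f=f] e)
  qed
  also have "\<dots> = (\<integral>\<^sup>+w. \<integral>\<^sup>+t. f (stack (vec_lambda w) t) \<partial>lborel \<partial>Pi\<^sub>M UNIV (\<lambda>_. lborel))"
  proof (rule nn_integral_cong)
    fix w :: "'k \<Rightarrow> real^'m"
    have "f \<circ> stack (vec_lambda w) \<in> borel_measurable (borel :: (real^'m^'l) measure)"
      using measurable_Pair2[OF fs, of "vec_lambda w"] by (simp add: o_def)
    then show "(\<integral>\<^sup>+z. f (stack (vec_lambda w) (vec_lambda z)) \<partial>Pi\<^sub>M UNIV (\<lambda>_. lborel)) = (\<integral>\<^sup>+t. f (stack (vec_lambda w) t) \<partial>lborel)"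
      using nn_integral_lborel_vec[of "f \<circ> stack (vec_lambda w)"] by simp
  qed
  also have "\<dots> = (\<integral>\<^sup>+\<omega>. \<integral>\<^sup>+t. f (stack \<omega> t) \<partial>lborel \<partial>lborel)"
    using lborel.borel_measurable_nn_integral[OF fs] by (subst nn_integral_lborel_vec) auto
  finally show ?thesis .
qed

text \<open>The number \<open>c\<close> is only a sign: 1 for s + \<omega>'\<omega> in
  \<open>gg_minus\<close>, -1 for r - \<omega>'\<omega> in \<open>gg_plus\<close>. Because c c = 1,
  the substitution r = s + c q turns c (r - s) into q.\<close>

lemma nn_integral_gram_affine:
  fixes f :: "real^'m::{finite,linorder}^'m::{finite,linorder} \<Rightarrow> ennreal"
  assumes [measurable]: "f \<in> borel_measurable borel" and mk: "CARD('m) \<le> CARD('k)"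
    and s: "transpose s = s" and c: "\<bar>c\<bar> = 1"
  shows "(\<integral>\<^sup>+\<omega>. f (s + c *\<^sub>R (transpose \<omega> ** \<omega>)) \<partial>(lborel :: (real^'m::{finite,linorder}^'k::finite) measure)) =
    ennreal (gram_const CARD('k) CARD('m)) *
    (\<integral>\<^sup>+r. indicator posdef_cone (c *\<^sub>R (r - s)) *
       ennreal (\<bar>det (c *\<^sub>R (r - s))\<bar> powr ((real CARD('k) - real CARD('m) - 1) / 2)) * f r \<partial>lborel_sym)"
proof -
  let ?g = "\<lambda>r. indicator posdef_cone (c *\<^sub>R (r - s)) *
       ennreal (\<bar>det (c *\<^sub>R (r - s))\<bar> powr ((real CARD('k) - real CARD('m) - 1) / 2)) * f r"
  have cc: "c * c = 1" using c by (auto simp: abs_if split: if_splits)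
  have [measurable]: "?g \<in> borel_measurable borel" by measurable
  have "(\<integral>\<^sup>+r. ?g r \<partial>lborel_sym) = (\<integral>\<^sup>+r. ?g (s + c *\<^sub>R r) \<partial>lborel_sym)"
    by (rule nn_integral_lborel_sym_affine[symmetric, OF _ s c]) measurable
  also have "\<dots> = (\<integral>\<^sup>+r. indicator posdef_cone r * ennreal (\<bar>det r\<bar> powr ((real CARD('k) - real CARD('m) - 1) / 2)) * f (s + c *\<^sub>R r) \<partial>lborel_sym)"
    by (simp add: cc)
  finally show ?thesis using mk by (subst nn_integral_gram_matrix) auto
qed

lemma distr_gram_affine:
  assumes mk: "CARD('m) \<le> CARD('k)" and s: "transpose s = s" and c: "\<bar>c\<bar> = 1"
  shows "distr (lborel :: (real^'m::{finite,linorder}^'k::finite) measure) borel (\<lambda>\<omega>. s + c *\<^sub>R (transpose \<omega> ** \<omega>)) =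
    density lborel_sym (\<lambda>r. ennreal (gram_const CARD('k) CARD('m) * (indicator posdef_cone (c *\<^sub>R (r - s)) *
       \<bar>det (c *\<^sub>R (r - s))\<bar> powr ((real CARD('k) - real CARD('m) - 1) / 2))))"
    (is "?L = ?R")
proof (rule measure_eqI)
  fix A assume A: "A \<in> sets ?L"
  then have [measurable]: "A \<in> sets borel" by simp
  have C: "gram_const CARD('k) CARD('m) \<ge> 0" using gram_const_pos[OF mk] by simp
  have "emeasure ?L A = (\<integral>\<^sup>+\<omega>. indicator A (s + c *\<^sub>R (transpose \<omega> ** \<omega>)) \<partial>(lborel :: (real^'m::{finite,linorder}^'k) measure))"
    unfolding nn_integral_indicator[OF A, symmetric] by (subst nn_integral_distr) auto
  also have "\<dots> = ennreal (gram_const CARD('k) CARD('m)) *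
    (\<integral>\<^sup>+r. indicator posdef_cone (c *\<^sub>R (r - s)) *
       ennreal (\<bar>det (c *\<^sub>R (r - s))\<bar> powr ((real CARD('k) - real CARD('m) - 1) / 2)) * indicator A r \<partial>lborel_sym)"
    using mk s c by (intro nn_integral_gram_affine) auto
  also have "\<dots> = (\<integral>\<^sup>+r. ennreal (gram_const CARD('k) CARD('m) * (indicator posdef_cone (c *\<^sub>R (r - s)) *
       \<bar>det (c *\<^sub>R (r - s))\<bar> powr ((real CARD('k) - real CARD('m) - 1) / 2))) * indicator A r \<partial>lborel_sym)"
    using C by (subst nn_integral_cmult[symmetric]) (auto intro!: nn_integral_cong simp: ennreal_mult mult.assoc indicator_def)
  also have "\<dots> = emeasure ?R A" by (subst emeasure_density) auto
  finally show "emeasure ?L A = emeasure ?R A" .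
qed simp

lemma integrable_scaleR_iff:
  fixes g :: "'a \<Rightarrow> complex"
  assumes "C \<noteq> 0" shows "integrable M (\<lambda>x. C *\<^sub>R g x) \<longleftrightarrow> integrable M g"
proof
  assume I: "integrable M (\<lambda>x. C *\<^sub>R g x)"
  have "integrable M (\<lambda>x. inverse C *\<^sub>R (C *\<^sub>R g x))" by (intro integrable_scaleR_right I)
  then show "integrable M g" using assms by simp
qed (simp add: integrable_scaleR_right)

lemma integral_scaleR_eq: "integral\<^sup>L M (\<lambda>x. C *\<^sub>R g x) = C *\<^sub>R integral\<^sup>L M g"
  for g :: "'a \<Rightarrow> complex"
  by (simp add: scaleR_conv_of_real)

lemma gram_matrix_mult_left:
  fixes g :: "real^'n^'p" and X :: "real^'m^'n"
  assumes "transpose g ** g = mat 1"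
  shows "transpose (g ** X) ** (g ** X) = transpose X ** X"
proof -
  have "transpose (g ** X) ** (g ** X) = transpose X ** ((transpose g ** g) ** X)"
    by (simp add: matrix_transpose_mul matrix_mul_assoc)
  then show ?thesis by (simp add: assms)
qed

section \<open>The Radon transform of radial functions\<close>

text \<open>The integrand is \<open>f\<^sub>0\<close> at s + \<omega>'\<omega>. For k < m its
  integral is the defining one up to the power of pi. For k \<ge> m the image of Lebesgue measure
  under \<omega> -> s + \<omega>'\<omega> has the kernel of \<open>gg_minus\<close> as density, and
  its constant pi^(km/2) / Gamma_m(k/2) leaves the stated factor.\<close>

lemma radon_radial:
  fixes rot :: "real^'l^('k::finite + 'l::finite) \<Rightarrow> real^('k + 'l)^('k + 'l)"
    and f :: "real^'m::{finite,linorder}^('k + 'l) \<Rightarrow> complex" and t :: "real^'m::{finite,linorder}^'l"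
  assumes rot: "rot \<xi> \<in> frame_rotations \<xi>" and f: "\<And>x. f x = f\<^sub>0 (transpose x ** x)"
  defines "s \<equiv> transpose t ** t"
  shows radon_exists_radial: "radon_exists rot f \<xi> t \<longleftrightarrow> gg_minus_exists TYPE('k) f\<^sub>0 s"
    and radon_radial_eq: "radon rot f \<xi> t = (pi powr (real CARD('k) * real CARD('m) / 2)) *\<^sub>R gg_minus TYPE('k) f\<^sub>0 s"
proof -
  have g: "transpose (rot \<xi>) ** rot \<xi> = mat 1"
    using rot by (auto simp: frame_rotations_def rotation_matrix_def orthogonal_matrix_def)
  then have ri: "radon_integrand rot f \<xi> t = (\<lambda>\<omega>. f\<^sub>0 (s + transpose \<omega> ** \<omega>))"
    by (simp add: radon_integrand_def f gram_matrix_mult_left gram_matrix_stack s_def add.commute)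
  have "(radon_exists rot f \<xi> t \<longleftrightarrow> gg_minus_exists TYPE('k) f\<^sub>0 s) \<and>
    radon rot f \<xi> t = (pi powr (real CARD('k) * real CARD('m) / 2)) *\<^sub>R gg_minus TYPE('k) f\<^sub>0 s"
  proof (cases "CARD('m) \<le> CARD('k)")
    case False
    then show ?thesis
      by (simp add: radon_exists_def radon_def ri gg_minus_exists_def gg_minus_def flip: powr_add)
  next
    case mk: True
    \<comment> \<open>The factor 1 is the sign \<open>c\<close> of
      \<open>distr_gram_affine\<close>.\<close>
    let ?q = "\<lambda>\<omega> :: real^'m::{finite,linorder}^'k. s + 1 *\<^sub>R (transpose \<omega> ** \<omega>)"
    let ?e = "(real CARD('k) - real CARD('m) - 1) / 2"
    define C where "C = gram_const CARD('k) CARD('m)"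
    have C: "C > 0" unfolding C_def by (rule gram_const_pos[OF mk])
    have qc: "continuous_on UNIV ?q" by (intro continuous_intros)
    have qm: "?q \<in> lborel \<rightarrow>\<^sub>M borel" by measurable
    have R: "\<exists>B\<in>sets borel. B \<subseteq> ?q ` A \<and> A - ?q -` B \<in> null_sets lborel" if "A \<in> sets lborel" for A
      by (rule continuous_image_inner_approx[where S=UNIV, OF lborel.sigma_finite_measure_axioms _ _ qc that]) (auto simp: sets_restrict_space)
    let ?h = "\<lambda>r. C * (indicator posdef_cone (1 *\<^sub>R (r - s)) * \<bar>det (1 *\<^sub>R (r - s))\<bar> powr ?e) :: real"
    have h: "?h \<in> borel_measurable lborel_sym" "\<And>r. 0 \<le> ?h r" using C by (measurable, auto)
    have D: "distr (lborel :: (real^'m::{finite,linorder}^'k) measure) borel ?q = density lborel_sym (\<lambda>r. ennreal (?h r))"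
      unfolding C_def by (rule distr_gram_affine[OF mk]) (simp_all add: s_def gram_matrix_symmetric)
    have e: "?e = real CARD('k) / 2 - (real CARD('m) + 1) / 2" by (simp add: field_simps)
    have hf: "(\<lambda>r. ?h r *\<^sub>R f\<^sub>0 r) = (\<lambda>r. C *\<^sub>R (indicator {r. r - s \<in> posdef_cone} r *\<^sub>R
        ((\<bar>det (r - s)\<bar> powr (real CARD('k) / 2 - (real CARD('m) + 1) / 2)) *\<^sub>R f\<^sub>0 r)))"
      unfolding e by (auto simp: fun_eq_iff indicator_def)
    have "radon_exists rot f \<xi> t \<longleftrightarrow> integrable (completion lborel) (\<lambda>\<omega>. f\<^sub>0 (?q \<omega>))"
      by (simp add: radon_exists_def ri)
    also have "\<dots> \<longleftrightarrow> integrable (completion lborel_sym) (\<lambda>r. ?h r *\<^sub>R f\<^sub>0 r)"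
      by (rule trans[OF integrable_completion_distr[where F=f\<^sub>0, OF qm R, unfolded D] integrable_completion_density[OF h]])
    also have "\<dots> \<longleftrightarrow> gg_minus_exists TYPE('k) f\<^sub>0 s"
      unfolding hf using C mk
      by (simp add: integrable_scaleR_iff gg_minus_exists_def set_integrable_def lebesgue_sym_eq del: scaleR_scaleR)
    finally have ex: "radon_exists rot f \<xi> t \<longleftrightarrow> gg_minus_exists TYPE('k) f\<^sub>0 s" .
    have "radon rot f \<xi> t = integral\<^sup>L (completion lborel) (\<lambda>\<omega>. f\<^sub>0 (?q \<omega>))"
      by (simp add: radon_def ri)
    also have "\<dots> = integral\<^sup>L (completion lborel_sym) (\<lambda>r. ?h r *\<^sub>R f\<^sub>0 r)"
      by (rule trans[OF integral_completion_distr[where F=f\<^sub>0, OF qm R, unfolded D] integral_completion_density[OF h]])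
    also have "\<dots> = (pi powr (real CARD('k) * real CARD('m) / 2)) *\<^sub>R gg_minus TYPE('k) f\<^sub>0 s"
      unfolding hf integral_scaleR_eq using mk
      by (simp add: gg_minus_def set_lebesgue_integral_def lebesgue_sym_eq C_def gram_const_eq)
    finally show ?thesis using ex by blast
  qed
  then show "radon_exists rot f \<xi> t \<longleftrightarrow> gg_minus_exists TYPE('k) f\<^sub>0 s"
    "radon rot f \<xi> t = (pi powr (real CARD('k) * real CARD('m) / 2)) *\<^sub>R gg_minus TYPE('k) f\<^sub>0 s"
    by blast+
qed

section \<open>Frames and polar decomposition\<close>

lemma closed_stiefel: "closed (stiefel :: (real^'m^'n) set)"
  unfolding stiefel_def by (rule closed_Collect_eq; intro continuous_intros)

lemma stiefel_orthogonal_mult: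
  "orthogonal_matrix g \<Longrightarrow> g ** v \<in> stiefel \<longleftrightarrow> v \<in> stiefel" for v :: "real^'m^'n"
proof -
  assume "orthogonal_matrix g"
  then have "transpose (g ** v) ** (g ** v) = transpose v ** v"
    by (intro gram_matrix_mult_left) (simp add: orthogonal_matrix)
  then show ?thesis by (simp add: stiefel_def)
qed

text \<open>Complete the columns of u and v, as rows at the same positions \<iota> j, to orthogonal
  matrices B and C. Then B u and C v are the same 0-1 matrix, so C'B carries u to v.\<close>

lemma ex_orthogonal_between_frames:
  fixes u v :: "real^'m^'n"
  assumes u: "u \<in> stiefel" and v: "v \<in> stiefel" and mn: "CARD('m) \<le> CARD('n)"
  shows "\<exists>g. orthogonal_matrix g \<and> v = g ** u"
proof -
  obtain \<iota> :: "'m \<Rightarrow> 'n" where \<iota>: "inj \<iota>"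
    using card_le_inj[of "UNIV :: 'm set" "UNIV :: 'n set"] mn by auto
  have "\<exists>B :: real^'n^'n. B ** transpose B = mat 1 \<and> (\<forall>j. B $ \<iota> j = column j x)" if x: "x \<in> stiefel" for x :: "real^'m^'n"
  proof -
    have ip: "column i x \<bullet> column j x = (if i = j then 1 else 0)" for i j
      using x by (auto simp: stiefel_def vec_eq_iff matrix_matrix_mult_def transpose_def mat_def inner_vec_def column_def)
    obtain B :: "real^'n^'n" where B: "\<forall>i\<in>range \<iota>. B $ i = column (inv \<iota> i) x" and
      BB: "B ** transpose B = (\<chi> i j. if i \<in> range \<iota> \<and> j \<in> range \<iota> then column (inv \<iota> i) x \<bullet> column (inv \<iota> j) x else if i = j then 1 else 0)"
      using ex_orthonormal_rows_completion[of "range \<iota>" "\<lambda>i. column (inv \<iota> i) x"] by blast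
    have "B ** transpose B = mat 1"
      unfolding BB using \<iota> by (auto simp: vec_eq_iff mat_def ip)
    moreover have "B $ \<iota> j = column j x" for j using B \<iota> by simp
    ultimately show ?thesis by blast
  qed
  then obtain B C :: "real^'n^'n" where B: "B ** transpose B = mat 1" "\<And>j. B $ \<iota> j = column j u"
    and C: "C ** transpose C = mat 1" "\<And>j. C $ \<iota> j = column j v"
    using u v by metis
  have oB: "orthogonal_matrix B" and oC: "orthogonal_matrix C"
    using B(1) C(1) matrix_left_right_inverse by (auto simp: orthogonal_matrix_def)
  have "v = (transpose C ** B) ** u"
  proof -
    have "B ** u = C ** v"
    proof -
      have "(B ** u) $ i $ j = (C ** v) $ i $ j" for i j
      proof -
        have "(B ** transpose B) $ i $ \<iota> j = (C ** transpose C) $ i $ \<iota> j" by (simp only: B(1) C(1))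
        then have "B $ i \<bullet> B $ \<iota> j = C $ i \<bullet> C $ \<iota> j"
          by (simp add: matrix_matrix_mult_def transpose_def inner_vec_def)
        then show ?thesis unfolding B(2) C(2) by (simp add: matrix_matrix_mult_def inner_vec_def column_def)
      qed
      then show ?thesis by (simp add: vec_eq_iff)
    qed
    then have "transpose C ** (B ** u) = (transpose C ** C) ** v" by (simp add: matrix_mul_assoc)
    then show ?thesis using oC by (simp add: orthogonal_matrix matrix_mul_assoc)
  qed
  moreover have "orthogonal_matrix (transpose C ** B)"
    using oB oC by (intro orthogonal_matrix_mul) (simp_all add: orthogonal_matrix_transpose)
  ultimately show ?thesis by blast
qed

lemma posdef_gram_imp_full_rank:
  fixes X :: "real^'m^'n"
  assumes "transpose X ** X \<in> posdef_cone" shows "rank X = CARD('m)"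
proof -
  have "x = 0" if "X *v x = 0" for x
  proof -
    have "(transpose X ** X) *v x = 0" using that by (simp add: matrix_vector_mul_assoc[symmetric] del: transpose_matrix_vector)
    then show ?thesis using assms by (force simp: posdef_cone_def)
  qed
  then have "inj ((*v) X)" by (metis inj_matrix_vector_mult matrix_left_invertible_injective matrix_left_invertible_ker)
  then show ?thesis by (simp add: full_rank_injective)
qed

lemma full_rank_imp_posdef_gram:
  fixes X :: "real^'m^'n"
  assumes "rank X = CARD('m)" shows "transpose X ** X \<in> posdef_cone"
proof -
  have "inj ((*v) X)" using assms by (simp add: full_rank_injective)
  then have "X *v x \<noteq> 0" if "x \<noteq> 0" for x using that by (metis injD matrix_vector_mult_0_right)
  then show ?thesis by (simp add: posdef_cone_def gram_matrix_symmetric quadratic_form_gram)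
qed

text \<open>The columns of u form an orthonormal basis of the column space of X, and B = u'X holds
  the coordinates. Here B is invertible but need not be symmetric.\<close>

lemma ex_polar_decomposition:
  fixes X :: "real^'m^'n"
  assumes X: "transpose X ** X \<in> posdef_cone"
  shows "\<exists>u\<in>stiefel. \<exists>B :: real^'m^'m. X = u ** B \<and> det B \<noteq> 0"
proof -
  have dim: "dim (span (columns X)) = CARD('m)"
    using posdef_gram_imp_full_rank[OF X] by (simp add: column_rank_def)
  obtain C where C: "C \<subseteq> span (columns X)" "pairwise orthogonal C" "\<And>x. x \<in> C \<Longrightarrow> norm x = 1"
     "independent C" "card C = dim (span (columns X))" "span C = span (columns X)"
    using orthonormal_basis_subspace[of "span (columns X)"] by (metis subspace_span)
  have "finite C" using C(4) by (rule independent_imp_finite)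
  then obtain e :: "'m \<Rightarrow> real^'n" where e: "bij_betw e UNIV C"
    using finite_same_card_bij[of "UNIV :: 'm set" C] C(5) dim by auto
  define u :: "real^'m^'n" where "u = (\<chi> i j. e j $ i)"
  have ee: "e i \<bullet> e j = (if i = j then 1 else 0)" for i j
  proof (cases "i = j")
    case True then show ?thesis using C(3)[of "e i"] e by (auto simp: norm_eq_1 bij_betw_def)
  next
    case False
    then have "e i \<noteq> e j" "e i \<in> C" "e j \<in> C" using e by (auto simp: bij_betw_def inj_on_def)
    then show ?thesis using C(2) False by (auto simp: pairwise_def orthogonal_def)
  qed
  have u: "transpose u ** u = mat 1"
    using ee by (simp add: vec_eq_iff matrix_matrix_mult_def transpose_def u_def inner_vec_def mat_def)
  define B where "B = transpose u ** X"
  have "X = u ** B"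
  proof -
    have "y = (\<Sum>j\<in>UNIV. (e j \<bullet> y) *\<^sub>R e j)" if "y \<in> span C" for y
      using that
    proof (induction rule: span_induct_alt)
      case (step c x y)
      obtain i where x: "x = e i" using step(1) e by (auto simp: bij_betw_def)
      have "(\<Sum>j\<in>UNIV. (e j \<bullet> x) *\<^sub>R e j) = x"
        unfolding x by (simp add: ee if_distrib[of "\<lambda>c. c *\<^sub>R _"] cong: if_cong)
      moreover have "(\<Sum>j\<in>UNIV. (e j \<bullet> (c *\<^sub>R x + y)) *\<^sub>R e j)
          = c *\<^sub>R (\<Sum>j\<in>UNIV. (e j \<bullet> x) *\<^sub>R e j) + (\<Sum>j\<in>UNIV. (e j \<bullet> y) *\<^sub>R e j)"
        by (simp add: inner_add_right scaleR_add_left sum.distrib scaleR_sum_right)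
      ultimately show ?case using step(2) by simp
    qed simp
    then have "column j X = (\<Sum>a\<in>UNIV. (e a \<bullet> column j X) *\<^sub>R e a)" for j
      unfolding C(6) by (auto simp: columns_def intro: span_base)
    then have col: "column j X $ i = (\<Sum>a\<in>UNIV. (e a \<bullet> column j X) *\<^sub>R e a) $ i" for i j by simp
    have "X $ i $ j = (u ** B) $ i $ j" for i j
    proof -
      have "X $ i $ j = column j X $ i" by (simp add: column_def)
      also have "\<dots> = (\<Sum>a\<in>UNIV. (e a \<bullet> column j X) *\<^sub>R e a) $ i" by (rule col)
      also have "\<dots> = (u ** B) $ i $ j"
        by (simp add: B_def matrix_matrix_mult_def transpose_def u_def column_def inner_vec_def mult.commute)
      finally show ?thesis .
    qed
    then show ?thesis by (simp add: vec_eq_iff)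
  qed
  moreover have "det B \<noteq> 0"
  proof -
    have "transpose X ** X = transpose B ** B"
      by (subst (1 2) \<open>X = u ** B\<close>) (rule gram_matrix_mult_left[OF u])
    then show ?thesis using posdef_cone_det_nonzero[OF X] by (simp add: det_mul)
  qed
  ultimately show ?thesis using u by (intro bexI[of _ u] exI[of _ B]) (simp_all add: stiefel_def)
qed

text \<open>Write X = u B. Equality of the Gram matrices makes Y times the inverse of B a frame too,
  and an orthogonal matrix that carries u to it carries X to Y.\<close>

lemma ex_orthogonal_same_gram:
  fixes X Y :: "real^'m^'n"
  assumes eq: "transpose X ** X = transpose Y ** Y" and X: "transpose X ** X \<in> posdef_cone"
    and mn: "CARD('m) \<le> CARD('n)"
  shows "\<exists>g. orthogonal_matrix g \<and> Y = g ** X"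
proof -
  obtain u B where u: "u \<in> stiefel" "X = u ** B" "det B \<noteq> 0" using ex_polar_decomposition[OF X] by blast
  obtain B' where B': "B ** B' = mat 1" "B' ** B = mat 1"
    using u(3) by (metis invertible_det_nz invertible_def)
  have "transpose (Y ** B') ** (Y ** B') = transpose B' ** (transpose X ** X) ** B'"
    by (simp add: eq matrix_transpose_mul matrix_mul_assoc)
  also have "\<dots> = transpose (u ** (B ** B')) ** (u ** (B ** B'))"
    by (simp add: u(2) matrix_transpose_mul matrix_mul_assoc)
  also have "\<dots> = mat 1" using u(1) by (simp add: B' stiefel_def)
  finally have "Y ** B' \<in> stiefel" by (simp add: stiefel_def)
  then obtain g where g: "orthogonal_matrix g" "Y ** B' = g ** u"
    using ex_orthogonal_between_frames[OF u(1) _ mn] by blast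
  have "Y = (Y ** B') ** B" by (simp add: B' matrix_mul_assoc[symmetric])
  also have "\<dots> = g ** X" by (simp add: g(2) u(2) matrix_mul_assoc)
  finally show ?thesis using g(1) by blast
qed

text \<open>Transitivity of the maps X -> g X A on matrices of full column rank; it carries an
  identity known at one such matrix to all of them.\<close>

lemma ex_orthogonal_linear_equivalence:
  fixes X Y :: "real^'m^'n"
  assumes X: "transpose X ** X \<in> posdef_cone" and Y: "transpose Y ** Y \<in> posdef_cone"
    and mn: "CARD('m) \<le> CARD('n)"
  shows "\<exists>g A. orthogonal_matrix g \<and> det A \<noteq> 0 \<and> Y = g ** (X ** A)"
proof -
  obtain u B where u: "u \<in> stiefel" "X = u ** B" "det B \<noteq> 0" using ex_polar_decomposition[OF X] by blast
  obtain v C where v: "v \<in> stiefel" "Y = v ** C" "det C \<noteq> 0" using ex_polar_decomposition[OF Y] by blast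
  obtain g where g: "orthogonal_matrix g" "v = g ** u"
    using ex_orthogonal_between_frames[OF u(1) v(1) mn] by blast
  obtain B' where B': "B ** B' = mat 1" "B' ** B = mat 1"
    using u(3) by (metis invertible_det_nz invertible_def)
  have "det B' \<noteq> 0" using B'(1) by (metis det_I det_mul mult_zero_right zero_neq_one)
  then have "det (B' ** C) \<noteq> 0" using v(3) by (simp add: det_mul)
  moreover have "g ** (X ** (B' ** C)) = g ** (u ** ((B ** B') ** C))" by (simp add: u(2) matrix_mul_assoc)
  then have "Y = g ** (X ** (B' ** C))" by (simp add: B' v(2) g(2) matrix_mul_assoc)
  ultimately show ?thesis using g(1) by blast
qed

section \<open>The dual Radon transform of radial functions\<close>

text \<open>This is X'\<xi>\<xi>'X, which for a frame \<xi> is the Gram matrix of the columns of X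
  projected to the span of the frame. It is the argument of \<open>\<phi>\<^sub>0\<close> in the
  dual transform.\<close>

definition projected_gram :: "real^'l^'n \<Rightarrow> real^'m^'n \<Rightarrow> real^'m^'m" where
  "projected_gram \<xi> X = transpose (transpose \<xi> ** X) ** (transpose \<xi> ** X)"

lemma projected_gram_orthogonal:
  "projected_gram \<xi> (g ** X) = projected_gram (transpose g ** \<xi>) X"
  by (simp add: projected_gram_def matrix_transpose_mul matrix_mul_assoc)

lemma projected_gram_mult_right:
  "projected_gram \<xi> (X ** A) = transpose A ** projected_gram \<xi> X ** A"
  by (simp add: projected_gram_def matrix_transpose_mul matrix_mul_assoc)

lemma continuous_on_projected_gram [continuous_intros]:
  assumes "continuous_on S f" "continuous_on S h"
  shows "continuous_on S (\<lambda>x. projected_gram (f x) (h x))"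
  unfolding projected_gram_def using assms by (intro continuous_intros)

lemma borel_measurable_projected_gram [measurable (raw)]:
  fixes f :: "'a \<Rightarrow> real^'l^'n" and h :: "'a \<Rightarrow> real^'m^'n"
  assumes "f \<in> borel_measurable M" "h \<in> borel_measurable M"
  shows "(\<lambda>x. projected_gram (f x) (h x)) \<in> borel_measurable M"
  unfolding projected_gram_def using assms by measurable

lemma
  fixes \<mu> :: "(real^'l^'n) measure"
  assumes \<mu>: "invariant_stiefel_measure \<mu>"
  shows space_stiefel_measure: "space \<mu> = stiefel"
    and sets_stiefel_measure: "sets \<mu> = sets (restrict_space borel stiefel)"
    and measurable_stiefel_measure: "f \<in> borel_measurable borel \<Longrightarrow> f \<in> borel_measurable \<mu>"
    and emeasure_stiefel_measure: "emeasure \<mu> (space \<mu>) = ennreal (stiefel_volume CARD('n) CARD('l))"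
    and finite_stiefel_measure: "finite_measure \<mu>"
proof -
  show s: "sets \<mu> = sets (restrict_space borel stiefel)"
    using \<mu> by (simp add: invariant_stiefel_measure_def)
  show sp: "space \<mu> = stiefel" using sets_eq_imp_space_eq[OF s] by (simp add: space_restrict_space)
  show "f \<in> borel_measurable borel \<Longrightarrow> f \<in> borel_measurable \<mu>"
    using measurable_restrict_space1[of f borel borel stiefel] measurable_cong_sets[OF s refl, of borel] by blast
  show e: "emeasure \<mu> (space \<mu>) = ennreal (stiefel_volume CARD('n) CARD('l))"
    using \<mu> unfolding sp by (simp add: invariant_stiefel_measure_def)
  show "finite_measure \<mu>" by standard (simp add: e)
qed

lemma nn_integral_stiefel_invariant:
  fixes \<mu> :: "(real^'l^'n) measure" and h :: "real^'l^'n \<Rightarrow> ennreal"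
  assumes \<mu>: "invariant_stiefel_measure \<mu>" and g: "orthogonal_matrix g" and h: "h \<in> borel_measurable borel"
  shows "(\<integral>\<^sup>+\<xi>. h (g ** \<xi>) \<partial>\<mu>) = (\<integral>\<^sup>+\<xi>. h \<xi> \<partial>\<mu>)"
proof -
  note s = sets_stiefel_measure[OF \<mu>]
  have "(\<lambda>\<xi>. g ** \<xi>) \<in> restrict_space borel stiefel \<rightarrow>\<^sub>M restrict_space borel (stiefel :: (real^'l^'n) set)"
    by (rule measurable_restrict_space3) (use stiefel_orthogonal_mult[OF g] in auto)
  then have m: "(**) g \<in> \<mu> \<rightarrow>\<^sub>M \<mu>" using measurable_cong_sets[OF s s] by blast
  have "(\<integral>\<^sup>+\<xi>. h \<xi> \<partial>\<mu>) = (\<integral>\<^sup>+\<xi>. h \<xi> \<partial>distr \<mu> \<mu> ((**) g))"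
    using \<mu> g by (simp add: invariant_stiefel_measure_def)
  also have "\<dots> = (\<integral>\<^sup>+\<xi>. h (g ** \<xi>) \<partial>\<mu>)"
    using m measurable_stiefel_measure[OF \<mu> h] by (intro nn_integral_distr) auto
  finally show ?thesis ..
qed

text \<open>
  Up to the factor \<open>\<pi>\<^bsup>-km/2\<^esup>\<close>, this is \<open>I\<^sub>+\<^bsup>k/2\<^esup>\<close> of \<open>|s|\<^bsup>\<delta>\<^esup> \<phi>(s)\<close> for every k, so that
  \<open>k < m\<close> and \<open>k \<ge> m\<close> need not be distinguished.
\<close>

definition gg_nn :: "'k::finite itself \<Rightarrow> real \<Rightarrow> (real^'m^'m \<Rightarrow> ennreal) \<Rightarrow> real^'m^'m \<Rightarrow> ennreal" where
  "gg_nn _ \<delta> \<phi> r = (\<integral>\<^sup>+\<omega>. indicator posdef_cone (r - transpose \<omega> ** \<omega>) *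
     ennreal (\<bar>det (r - transpose \<omega> ** \<omega>)\<bar> powr \<delta>) * \<phi> (r - transpose \<omega> ** \<omega>) \<partial>(lborel :: (real^'m^'k) measure))"

lemma borel_measurable_gg_nn [measurable]:
  assumes [measurable]: "\<phi> \<in> borel_measurable borel"
  shows "gg_nn TYPE('k::finite) \<delta> \<phi> \<in> borel_measurable borel"
  unfolding gg_nn_def[abs_def] by measurable

text \<open>Otherwise r = (r - \<omega>'\<omega>) + \<omega>'\<omega> would be positive
  definite.\<close>

lemma gg_nn_outside:
  assumes "r \<notin> posdef_cone" shows "gg_nn TYPE('k::finite) \<delta> \<phi> r = 0"
proof -
  have "r - transpose \<omega> ** \<omega> \<notin> posdef_cone" for \<omega> :: "real^'a^'k"
    using posdef_cone_add_gram[of "r - transpose \<omega> ** \<omega>" \<omega>] assms by auto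
  then show ?thesis by (simp add: gg_nn_def)
qed

lemma matrix_diff_ldistrib: "A ** (B - C) = A ** B - A ** C" for A :: "real^'n^'p" and B C :: "real^'m^'n"
  by (simp add: vec_eq_iff matrix_matrix_mult_def right_diff_distrib sum_subtractf)

lemma matrix_diff_rdistrib: "(B - C) ** A = B ** A - C ** A" for A :: "real^'m^'n" and B C :: "real^'n^'p"
  by (simp add: vec_eq_iff matrix_matrix_mult_def left_diff_distrib sum_subtractf)

text \<open>Substitute \<omega> A for \<omega>: the determinant power yields |det A|^(2\<delta>),
  the k rows of \<omega> yield |det A|^(-k), and dividing leaves the exponent -(2\<delta> +
  k).\<close>

lemma gg_nn_congruence:
  fixes A r :: "real^'m^'m"
  assumes A: "det A \<noteq> 0" and [measurable]: "\<phi> \<in> borel_measurable borel"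
  shows "gg_nn TYPE('k::finite) \<delta> (\<lambda>s. \<phi> (transpose A ** s ** A)) r
    = ennreal (\<bar>det A\<bar> powr (- (2 * \<delta> + real CARD('k)))) * gg_nn TYPE('k) \<delta> \<phi> (transpose A ** r ** A)"
proof -
  let ?r = "transpose A ** r ** A"
  let ?G = "\<lambda>\<omega> :: real^'m^'k. indicator posdef_cone (?r - transpose \<omega> ** \<omega>) *
     ennreal (\<bar>det (?r - transpose \<omega> ** \<omega>)\<bar> powr \<delta>) * \<phi> (?r - transpose \<omega> ** \<omega>)"
  let ?I = "\<lambda>\<omega> :: real^'m^'k. indicator posdef_cone (r - transpose \<omega> ** \<omega>) *
     ennreal (\<bar>det (r - transpose \<omega> ** \<omega>)\<bar> powr \<delta>) * \<phi> (transpose A ** (r - transpose \<omega> ** \<omega>) ** A)"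
  have G: "?G (\<omega> ** A) = ennreal (\<bar>det A\<bar> powr (2 * \<delta>)) * ?I \<omega>" for \<omega>
  proof -
    have e: "?r - transpose (\<omega> ** A) ** (\<omega> ** A) = transpose A ** (r - transpose \<omega> ** \<omega>) ** A"
      by (simp add: matrix_transpose_mul matrix_mul_assoc matrix_diff_ldistrib matrix_diff_rdistrib)
    have d: "\<bar>det (transpose A ** (r - transpose \<omega> ** \<omega>) ** A)\<bar> powr \<delta>
        = \<bar>det A\<bar> powr (2 * \<delta>) * \<bar>det (r - transpose \<omega> ** \<omega>)\<bar> powr \<delta>"
    proof -
      have h: "\<bar>det A\<bar> powr (2 * \<delta>) = (\<bar>det A\<bar> * \<bar>det A\<bar>) powr \<delta>"
        by (simp only: mult_2 powr_add powr_mult abs_ge_zero)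
      show ?thesis unfolding h by (simp only: det_mul det_transpose abs_mult powr_mult mult_ac)
    qed
    have i: "indicator posdef_cone (transpose A ** (r - transpose \<omega> ** \<omega>) ** A) = (indicator posdef_cone (r - transpose \<omega> ** \<omega>) :: ennreal)"
      by (simp add: indicator_def posdef_cone_congruence[OF A])
    show ?thesis unfolding e d i by (simp add: ennreal_mult mult_ac)
  qed
  have "ennreal (\<bar>det A\<bar> powr (2 * \<delta>)) * gg_nn TYPE('k) \<delta> (\<lambda>s. \<phi> (transpose A ** s ** A)) r = (\<integral>\<^sup>+\<omega>. ?G (\<omega> ** A) \<partial>lborel)"
    unfolding G gg_nn_def by (rule nn_integral_cmult[symmetric]) measurable
  also have "\<dots> = ennreal (\<bar>det A\<bar> powr (- real CARD('k))) * gg_nn TYPE('k) \<delta> \<phi> ?r"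
    unfolding gg_nn_def by (rule nn_integral_lborel_mult_right[OF A]) measurable
  finally have "ennreal (\<bar>det A\<bar> powr (- 2 * \<delta>)) * (ennreal (\<bar>det A\<bar> powr (2 * \<delta>)) * gg_nn TYPE('k) \<delta> (\<lambda>s. \<phi> (transpose A ** s ** A)) r)
     = ennreal (\<bar>det A\<bar> powr (- 2 * \<delta>)) * (ennreal (\<bar>det A\<bar> powr (- real CARD('k))) * gg_nn TYPE('k) \<delta> \<phi> ?r)"
    by (simp only: )
  moreover have "ennreal (\<bar>det A\<bar> powr (- 2 * \<delta>)) * ennreal (\<bar>det A\<bar> powr (2 * \<delta>)) = 1"
    using A by (simp add: ennreal_mult[symmetric] powr_add[symmetric])
  moreover have "ennreal (\<bar>det A\<bar> powr (- 2 * \<delta>)) * ennreal (\<bar>det A\<bar> powr (- real CARD('k))) = ennreal (\<bar>det A\<bar> powr (- (2 * \<delta> + real CARD('k))))"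
    by (simp add: ennreal_mult[symmetric] powr_add[symmetric])
  ultimately show ?thesis by (simp only: mult.assoc[symmetric] mult_1_left)
qed

section \<open>Duality between integration over X and over \<xi>\<close>

text \<open>The exchange is made over the product measure of the independent entries, which is
  sigma-finite and has \<open>lborel_sym\<close> as its image.\<close>

lemma nn_integral_lborel_sym_swap:
  fixes F :: "'a::euclidean_space \<Rightarrow> real^'m::{finite,linorder}^'m::{finite,linorder} \<Rightarrow> ennreal"
  assumes [measurable]: "(\<lambda>(x, r). F x r) \<in> borel_measurable (borel \<Otimes>\<^sub>M borel)"
  shows "(\<integral>\<^sup>+x. \<integral>\<^sup>+r. F x r \<partial>lborel_sym \<partial>lborel) = (\<integral>\<^sup>+r. \<integral>\<^sup>+x. F x r \<partial>lborel \<partial>lborel_sym)"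
proof -
  let ?P = "Pi\<^sub>M {(i, j). i \<le> (j :: 'm)} (\<lambda>_. lborel :: real measure)"
  let ?S = "\<lambda>r. (\<chi> i j. r (min i j, max i j)) :: real^'m::{finite,linorder}^'m::{finite,linorder}"
  interpret P: sigma_finite_measure ?P by (rule sigma_finite_lborel_PiM_pairs)
  interpret PP: pair_sigma_finite lborel ?P by standard
  have "(\<integral>\<^sup>+x. \<integral>\<^sup>+r. F x r \<partial>lborel_sym \<partial>lborel) = (\<integral>\<^sup>+x. \<integral>\<^sup>+r. F x (?S r) \<partial>?P \<partial>lborel)"
    unfolding lborel_sym_def by (intro nn_integral_cong, subst nn_integral_distr) auto
  also have "\<dots> = (\<integral>\<^sup>+r. \<integral>\<^sup>+x. F x (?S r) \<partial>lborel \<partial>?P)"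
    by (rule PP.Fubini'[symmetric]) measurable
  also have "\<dots> = (\<integral>\<^sup>+r. \<integral>\<^sup>+x. F x r \<partial>lborel \<partial>lborel_sym)"
    unfolding lborel_sym_def by (subst nn_integral_distr) auto
  finally show ?thesis .
qed

lemma transpose_base_frame_stack:
  fixes \<omega> :: "real^'m^'k" and t :: "real^'m^'l"
  shows "transpose (stack 0 (mat 1) :: real^'l^('k + 'l)) ** stack \<omega> t = t"
proof -
  have "(\<Sum>i\<in>UNIV. g i) = (\<Sum>a\<in>UNIV. g (Inl a)) + (\<Sum>b\<in>UNIV. g (Inr b))" for g :: "'k + 'l \<Rightarrow> real"
    by (subst UNIV_Plus_UNIV[symmetric], subst sum.Plus) (simp_all add: o_def)
  then show ?thesis
    by (simp add: vec_eq_iff matrix_matrix_mult_def transpose_def stack_def mat_def if_distrib[of "\<lambda>c. c * _"] cong: if_cong)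
qed

text \<open>A rotation carries the base frame to \<xi>, so X may be taken as
  \<open>stack \<omega> t\<close> with projected Gram matrix t't and full Gram matrix
  \<omega>'\<omega> + t't. The Gram law in t, the shift s = r - \<omega>'\<omega> and an exchange of
  integrals produce \<open>gg_nn\<close>. The result does not depend on \<xi>.\<close>

lemma nn_integral_projected_gram:
  fixes \<xi> :: "real^'l^('k::finite + 'l::finite)" and \<phi> :: "real^'m::{finite,linorder}^'m::{finite,linorder} \<Rightarrow> ennreal"
  assumes \<xi>: "\<xi> \<in> stiefel" and ml: "CARD('m) \<le> CARD('l)"
    and [measurable]: "a \<in> borel_measurable borel" "\<phi> \<in> borel_measurable borel"
  shows "(\<integral>\<^sup>+X. a (transpose X ** X) * \<phi> (projected_gram \<xi> X) \<partial>lborel) =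
    ennreal (gram_const CARD('l) CARD('m)) *
    (\<integral>\<^sup>+r. a r * gg_nn TYPE('k) ((real CARD('l) - real CARD('m) - 1) / 2) \<phi> r \<partial>lborel_sym)"
proof -
  let ?\<delta> = "(real CARD('l) - real CARD('m) - 1) / 2"
  obtain g where "g \<in> frame_rotations \<xi>" using ex_frame_rotation[OF \<xi>] by blast
  then have g: "orthogonal_matrix g" and g\<xi>: "\<xi> = g ** stack 0 (mat 1)"
    by (auto simp: frame_rotations_def rotation_matrix_def)
  have gg: "transpose g ** g = mat 1" using g by (simp add: orthogonal_matrix)
  have gX: "projected_gram \<xi> (g ** stack \<omega> t) = transpose t ** t" for \<omega> :: "real^'m::{finite,linorder}^'k" and t :: "real^'m::{finite,linorder}^'l"
  proof -
    have "transpose \<xi> ** (g ** stack \<omega> t) = transpose (stack 0 (mat 1) :: real^'l^('k + 'l)) ** ((transpose g ** g) ** stack \<omega> t)"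
      by (simp add: g\<xi> matrix_transpose_mul matrix_mul_assoc)
    then show ?thesis by (simp add: projected_gram_def gg transpose_base_frame_stack)
  qed
  let ?F = "\<lambda>\<omega> :: real^'m::{finite,linorder}^'k. \<lambda>r. indicator posdef_cone (r - transpose \<omega> ** \<omega>) *
      ennreal (\<bar>det (r - transpose \<omega> ** \<omega>)\<bar> powr ?\<delta>) * (a r * \<phi> (r - transpose \<omega> ** \<omega>))"
  have "(\<integral>\<^sup>+X. a (transpose X ** X) * \<phi> (projected_gram \<xi> X) \<partial>lborel)
     = (\<integral>\<^sup>+X. a (transpose (g ** X) ** (g ** X)) * \<phi> (projected_gram \<xi> (g ** X)) \<partial>lborel)"
    by (rule nn_integral_lborel_orthogonal[OF g, symmetric]) measurable
  also have "\<dots> = (\<integral>\<^sup>+X. a (transpose X ** X) * \<phi> (projected_gram \<xi> (g ** X)) \<partial>lborel)"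
    by (simp only: gram_matrix_mult_left[OF gg])
  also have "\<dots> = (\<integral>\<^sup>+\<omega>. \<integral>\<^sup>+t.
      a (transpose \<omega> ** \<omega> + transpose t ** t) * \<phi> (transpose t ** t)
      \<partial>(lborel :: (real^'m::{finite,linorder}^'l) measure) \<partial>(lborel :: (real^'m::{finite,linorder}^'k) measure))"
    by (subst nn_integral_lborel_stack) (auto simp: gram_matrix_stack gX)
  also have "\<dots> = (\<integral>\<^sup>+\<omega>. ennreal (gram_const CARD('l) CARD('m)) *
     (\<integral>\<^sup>+s. indicator posdef_cone s * ennreal (\<bar>det s\<bar> powr ?\<delta>) * (a (transpose \<omega> ** \<omega> + s) * \<phi> s) \<partial>lborel_sym)
     \<partial>(lborel :: (real^'m::{finite,linorder}^'k) measure))"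
    by (intro nn_integral_cong nn_integral_gram_matrix[OF _ ml, where F="\<lambda>s. a (transpose _ ** _ + s) * \<phi> s"]) measurable
  also have "\<dots> = (\<integral>\<^sup>+\<omega>. ennreal (gram_const CARD('l) CARD('m)) * (\<integral>\<^sup>+r. ?F \<omega> r \<partial>lborel_sym) \<partial>lborel)"
  proof -
    have "(\<integral>\<^sup>+s. indicator posdef_cone s * ennreal (\<bar>det s\<bar> powr ?\<delta>) * (a (transpose \<omega> ** \<omega> + s) * \<phi> s) \<partial>lborel_sym)
        = (\<integral>\<^sup>+r. ?F \<omega> r \<partial>lborel_sym)" for \<omega> :: "real^'m::{finite,linorder}^'k"
    proof -
      have "(\<integral>\<^sup>+r. ?F \<omega> r \<partial>lborel_sym) = (\<integral>\<^sup>+s. ?F \<omega> (transpose \<omega> ** \<omega> + 1 *\<^sub>R s) \<partial>lborel_sym)"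
        by (rule nn_integral_lborel_sym_affine[symmetric]) (measurable, simp_all add: gram_matrix_symmetric)
      then show ?thesis by simp
    qed
    then show ?thesis by (simp only: )
  qed
  also have "\<dots> = ennreal (gram_const CARD('l) CARD('m)) * (\<integral>\<^sup>+\<omega>. \<integral>\<^sup>+r. ?F \<omega> r \<partial>lborel_sym \<partial>lborel)"
  proof (rule nn_integral_cmult)
    have "(\<lambda>\<omega>. \<integral>\<^sup>+r. ?F \<omega> ((\<chi> i j. r (min i j, max i j)))
        \<partial>Pi\<^sub>M {(i, j). i \<le> (j :: 'm)} (\<lambda>_. lborel :: real measure)) \<in> borel_measurable lborel"
      by (rule sigma_finite_measure.borel_measurable_nn_integral[OF sigma_finite_lborel_PiM_pairs]) measurable
    moreover have "(\<integral>\<^sup>+r. ?F \<omega> r \<partial>lborel_sym) = (\<integral>\<^sup>+r. ?F \<omega> ((\<chi> i j. r (min i j, max i j)))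
        \<partial>Pi\<^sub>M {(i, j). i \<le> (j :: 'm)} (\<lambda>_. lborel :: real measure))" for \<omega>
      unfolding lborel_sym_def by (rule nn_integral_distr) measurable
    ultimately show "(\<lambda>\<omega>. \<integral>\<^sup>+r. ?F \<omega> r \<partial>lborel_sym) \<in> borel_measurable lborel" by (simp only: )
  qed
  also have "(\<integral>\<^sup>+\<omega>. \<integral>\<^sup>+r. ?F \<omega> r \<partial>lborel_sym \<partial>lborel) = (\<integral>\<^sup>+r. \<integral>\<^sup>+\<omega>. ?F \<omega> r \<partial>lborel \<partial>lborel_sym)"
    by (rule nn_integral_lborel_sym_swap) measurable
  also have "\<dots> = (\<integral>\<^sup>+r. a r * gg_nn TYPE('k) ?\<delta> \<phi> r \<partial>lborel_sym)"
    unfolding gg_nn_def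
    by (intro nn_integral_cong, subst nn_integral_cmult[symmetric]) (measurable, simp add: mult_ac)
  finally show ?thesis .
qed

text \<open>Integration over \<xi> only contributes the total mass of \<mu>, since the integral over
  X is the same for all frames. The resulting integral over r is returned to one over X by the Gram
  law for n rows, whose constant and power |r|^\<kappa> must be divided out.\<close>

lemma nn_integral_projected_gram_average:
  fixes \<mu> :: "(real^'l^('k::finite + 'l::finite)) measure" and \<phi> :: "real^'m::{finite,linorder}^'m::{finite,linorder} \<Rightarrow> ennreal"
  assumes \<mu>: "invariant_stiefel_measure \<mu>" and ml: "CARD('m) \<le> CARD('l)"
    and [measurable]: "a \<in> borel_measurable borel" "\<phi> \<in> borel_measurable borel"
  defines "c \<equiv> stiefel_volume CARD('k + 'l) CARD('l) * gram_const CARD('l) CARD('m) / gram_const CARD('k + 'l) CARD('m)"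
    and "\<kappa> \<equiv> (real CARD('k + 'l) - real CARD('m) - 1) / 2" and "\<delta> \<equiv> (real CARD('l) - real CARD('m) - 1) / 2"
  shows "(\<integral>\<^sup>+X. a (transpose X ** X) * (\<integral>\<^sup>+\<xi>. \<phi> (projected_gram \<xi> X) \<partial>\<mu>) \<partial>lborel) =
    (\<integral>\<^sup>+X. a (transpose X ** X) * (ennreal (c * \<bar>det (transpose X ** X)\<bar> powr (- \<kappa>)) * gg_nn TYPE('k) \<delta> \<phi> (transpose X ** X))
      \<partial>(lborel :: (real^'m::{finite,linorder}^('k + 'l)) measure))"
proof -
  interpret \<mu>: finite_measure \<mu> by (rule finite_stiefel_measure[OF \<mu>])
  interpret P: pair_sigma_finite \<mu> "lborel :: (real^'m::{finite,linorder}^('k + 'l)) measure" by standard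
  have ln: "CARD('l) \<le> CARD('k + 'l)" and mn: "CARD('m) \<le> CARD('k + 'l)" using ml by auto
  define SV where "SV = stiefel_volume CARD('k + 'l) CARD('l)"
  define Cl where "Cl = gram_const CARD('l) CARD('m)"
  define Cn where "Cn = gram_const CARD('k + 'l) CARD('m)"
  have pos: "0 < SV" "0 < Cl" "0 < Cn"
    unfolding SV_def Cl_def Cn_def using stiefel_volume_pos[OF ln] gram_const_pos[OF ml] gram_const_pos[OF mn] by auto
  have c: "c = SV * Cl / Cn" by (simp add: c_def SV_def Cl_def Cn_def)
  have id[measurable]: "(\<lambda>\<xi>. \<xi>) \<in> \<mu> \<rightarrow>\<^sub>M borel" by (rule measurable_stiefel_measure[OF \<mu>]) simp
  have e\<mu>: "emeasure \<mu> (space \<mu>) = ennreal SV"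
    unfolding SV_def by (rule emeasure_stiefel_measure[OF \<mu>])
  let ?I = "\<integral>\<^sup>+r. a r * gg_nn TYPE('k) \<delta> \<phi> r \<partial>lborel_sym"
  have "(\<integral>\<^sup>+X. a (transpose X ** X) * (\<integral>\<^sup>+\<xi>. \<phi> (projected_gram \<xi> X) \<partial>\<mu>) \<partial>(lborel :: (real^'m::{finite,linorder}^('k + 'l)) measure))
     = (\<integral>\<^sup>+X. (\<integral>\<^sup>+\<xi>. a (transpose X ** X) * \<phi> (projected_gram \<xi> X) \<partial>\<mu>) \<partial>(lborel :: (real^'m::{finite,linorder}^('k + 'l)) measure))"
    by (intro nn_integral_cong nn_integral_cmult[symmetric]) measurable
  also have "\<dots> = (\<integral>\<^sup>+\<xi>. (\<integral>\<^sup>+X. a (transpose X ** X) * \<phi> (projected_gram \<xi> X) \<partial>(lborel :: (real^'m::{finite,linorder}^('k + 'l)) measure)) \<partial>\<mu>)"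
    by (rule P.Fubini') measurable
  also have "\<dots> = (\<integral>\<^sup>+\<xi>. ennreal Cl * ?I \<partial>\<mu>)"
    unfolding Cl_def \<delta>_def
    by (intro nn_integral_cong nn_integral_projected_gram ml) (simp_all add: space_stiefel_measure[OF \<mu>])
  also have "\<dots> = ennreal (SV * Cl) * ?I"
    using pos by (simp add: e\<mu> ennreal_mult mult_ac)
  \<comment> \<open>The factors |r|^\<kappa> and |r|^(-\<kappa>) are inserted to exhibit the density
    of the n-row Gram law; off the cone \<open>gg_nn\<close> vanishes anyway.\<close>
  also have "?I = (\<integral>\<^sup>+r. indicator posdef_cone r * ennreal (\<bar>det r\<bar> powr \<kappa>) *
      (a r * (ennreal (\<bar>det r\<bar> powr (- \<kappa>)) * gg_nn TYPE('k) \<delta> \<phi> r)) \<partial>lborel_sym)"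
  proof (rule nn_integral_cong)
    fix r :: "real^'m::{finite,linorder}^'m::{finite,linorder}"
    show "a r * gg_nn TYPE('k) \<delta> \<phi> r = indicator posdef_cone r * ennreal (\<bar>det r\<bar> powr \<kappa>) *
      (a r * (ennreal (\<bar>det r\<bar> powr (- \<kappa>)) * gg_nn TYPE('k) \<delta> \<phi> r))"
    proof (cases "r \<in> posdef_cone")
      case False then show ?thesis by (simp add: gg_nn_outside)
    next
      case True
      have "ennreal (\<bar>det r\<bar> powr \<kappa>) * ennreal (\<bar>det r\<bar> powr (- \<kappa>)) = 1"
        using posdef_cone_det_nonzero[OF True] by (simp add: ennreal_mult[symmetric] powr_add[symmetric])
      then have "ennreal (\<bar>det r\<bar> powr \<kappa>) * ennreal (\<bar>det r\<bar> powr (- \<kappa>)) * (a r * gg_nn TYPE('k) \<delta> \<phi> r) = a r * gg_nn TYPE('k) \<delta> \<phi> r"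
        by simp
      then show ?thesis using True by (simp add: mult_ac)
    qed
  qed
  also have "ennreal (SV * Cl) * \<dots> = ennreal (SV * Cl / Cn) * (ennreal Cn * \<dots>)"
    using pos by (simp add: mult.assoc[symmetric] ennreal_mult[symmetric])
  also have "ennreal Cn * (\<integral>\<^sup>+r. indicator posdef_cone r * ennreal (\<bar>det r\<bar> powr \<kappa>) *
      (a r * (ennreal (\<bar>det r\<bar> powr (- \<kappa>)) * gg_nn TYPE('k) \<delta> \<phi> r)) \<partial>lborel_sym)
    = (\<integral>\<^sup>+X. a (transpose X ** X) * (ennreal (\<bar>det (transpose X ** X)\<bar> powr (- \<kappa>)) * gg_nn TYPE('k) \<delta> \<phi> (transpose X ** X))
      \<partial>(lborel :: (real^'m::{finite,linorder}^('k + 'l)) measure))"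
    unfolding Cn_def \<kappa>_def by (rule nn_integral_gram_matrix[OF _ mn, symmetric]) measurable
  also have "ennreal (SV * Cl / Cn) * \<dots> = (\<integral>\<^sup>+X. a (transpose X ** X) * (ennreal (c * \<bar>det (transpose X ** X)\<bar> powr (- \<kappa>)) * gg_nn TYPE('k) \<delta> \<phi> (transpose X ** X))
      \<partial>(lborel :: (real^'m::{finite,linorder}^('k + 'l)) measure))"
  proof -
    have "0 \<le> c" using pos by (simp add: c)
    then have cz: "ennreal (c * z) = ennreal c * ennreal z" if "0 \<le> z" for z using that by (simp add: ennreal_mult)
    show ?thesis unfolding c[symmetric]
      by (subst nn_integral_cmult[symmetric], measurable) (simp add: cz mult_ac)
  qed
  finally show ?thesis .
qed

text \<open>The Gram law has a density carried by the cone, so the complement of the cone has null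
  preimage.\<close>

lemma AE_gram_posdef:
  assumes mn: "CARD('m) \<le> CARD('n)"
  shows "AE X in (lborel :: (real^'m::{finite,linorder}^'n::finite) measure). transpose X ** X \<in> posdef_cone"
proof -
  have "(\<integral>\<^sup>+X. indicator (- posdef_cone) (transpose X ** X) \<partial>(lborel :: (real^'m::{finite,linorder}^'n) measure))
     = ennreal (gram_const CARD('n) CARD('m)) * (\<integral>\<^sup>+r. indicator posdef_cone r *
        ennreal (\<bar>det r\<bar> powr ((real CARD('n) - real CARD('m) - 1) / 2)) * indicator (- posdef_cone) r
        \<partial>(lborel_sym :: (real^'m::{finite,linorder}^'m::{finite,linorder}) measure))"
    by (rule nn_integral_gram_matrix[OF _ mn, where F="indicator (- posdef_cone)"]) measurable
  also have "(\<lambda>r. indicator posdef_cone r * ennreal (\<bar>det r\<bar> powr ((real CARD('n) - real CARD('m) - 1) / 2)) *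
      indicator (- posdef_cone) r) = (\<lambda>r :: real^'m::{finite,linorder}^'m::{finite,linorder}. 0)"
    by (auto simp: fun_eq_iff indicator_def)
  finally have z: "(\<integral>\<^sup>+X. indicator (- posdef_cone) (transpose X ** X) \<partial>(lborel :: (real^'m::{finite,linorder}^'n) measure)) = 0"
    by simp
  have "(\<lambda>X :: real^'m::{finite,linorder}^'n. indicator (- posdef_cone) (transpose X ** X) :: ennreal) \<in> borel_measurable lborel"
    by measurable
  from nn_integral_0_iff_AE[OF this] z
  have "AE X in (lborel :: (real^'m::{finite,linorder}^'n) measure). indicator (- posdef_cone) (transpose X ** X) = (0 :: ennreal)"
    by simp
  then show ?thesis by eventually_elim (auto simp: indicator_def split: if_splits)
qed

text \<open>The average over \<xi> is unchanged under X -> g X by the invariance of \<mu>, so for X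
  of full rank it is a function of X'X. Duality with indicators for a says that this function and
  the right-hand side are densities of the same measure with respect to the sigma-finite law of X'X,
  hence equal almost everywhere. The exceptional set depends on \<phi>.\<close>

lemma AE_projected_gram_law:
  fixes \<mu> :: "(real^'l^('k::finite + 'l::finite)) measure" and \<phi> :: "real^'m::{finite,linorder}^'m::{finite,linorder} \<Rightarrow> ennreal"
  assumes \<mu>: "invariant_stiefel_measure \<mu>" and ml: "CARD('m) \<le> CARD('l)"
    and \<phi>[measurable]: "\<phi> \<in> borel_measurable borel"
  defines "c \<equiv> stiefel_volume CARD('k + 'l) CARD('l) * gram_const CARD('l) CARD('m) / gram_const CARD('k + 'l) CARD('m)"
    and "\<kappa> \<equiv> (real CARD('k + 'l) - real CARD('m) - 1) / 2" and "\<delta> \<equiv> (real CARD('l) - real CARD('m) - 1) / 2"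
  shows "AE X in (lborel :: (real^'m::{finite,linorder}^('k + 'l)) measure).
    (\<integral>\<^sup>+\<xi>. \<phi> (projected_gram \<xi> X) \<partial>\<mu>) =
    ennreal (c * \<bar>det (transpose X ** X)\<bar> powr (- \<kappa>)) * gg_nn TYPE('k) \<delta> \<phi> (transpose X ** X)"
proof -
  interpret \<mu>: finite_measure \<mu> by (rule finite_stiefel_measure[OF \<mu>])
  have mn: "CARD('m) \<le> CARD('k + 'l)" using ml by auto
  have id[measurable]: "(\<lambda>\<xi>. \<xi>) \<in> \<mu> \<rightarrow>\<^sub>M borel" by (rule measurable_stiefel_measure[OF \<mu>]) simp
  let ?L = "lborel :: (real^'m::{finite,linorder}^('k + 'l)) measure"
  let ?q = "\<lambda>X :: real^'m::{finite,linorder}^('k + 'l). transpose X ** X"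
  define H where "H X = (\<integral>\<^sup>+\<xi>. \<phi> (projected_gram \<xi> X) \<partial>\<mu>)" for X :: "real^'m::{finite,linorder}^('k + 'l)"
  define RHS where "RHS r = ennreal (c * \<bar>det r\<bar> powr (- \<kappa>)) * gg_nn TYPE('k) \<delta> \<phi> r" for r
  have Hm[measurable]: "H \<in> borel_measurable borel" unfolding H_def by measurable
  have Rm[measurable]: "RHS \<in> borel_measurable borel" unfolding RHS_def by measurable
  have inv: "H (g ** X) = H X" if g: "orthogonal_matrix g" for g X
  proof -
    have "H (g ** X) = (\<integral>\<^sup>+\<xi>. (\<lambda>\<xi>. \<phi> (projected_gram \<xi> X)) (transpose g ** \<xi>) \<partial>\<mu>)"
      by (simp only: H_def projected_gram_orthogonal)
    also have "\<dots> = H X" unfolding H_def using g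
      by (intro nn_integral_stiefel_invariant[OF \<mu>]) (simp_all add: orthogonal_matrix_transpose)
    finally show ?thesis .
  qed
  \<comment> \<open>\<open>H0\<close> need not be Borel, but it is measurable for the completion because \<open>H0 \<circ> ?q = H\<close> almost everywhere.\<close>
  define H0 where "H0 r = H (SOME X. ?q X = r)" for r
  have H0: "H0 (?q X) = H X" if pd: "?q X \<in> posdef_cone" for X
  proof -
    have "?q (SOME Y. ?q Y = ?q X) = ?q X" by (rule someI) (rule refl)
    from ex_orthogonal_same_gram[OF this[symmetric] pd mn]
    obtain g where "orthogonal_matrix g" "(SOME Y. ?q Y = ?q X) = g ** X" by blast
    then show ?thesis by (simp add: H0_def inv)
  qed
  have ae: "AE X in ?L. H0 (?q X) = H X"
    using AE_gram_posdef[OF mn] by eventually_elim (rule H0)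
  have qm: "?q \<in> ?L \<rightarrow>\<^sub>M borel" by measurable
  have qc: "continuous_on UNIV ?q" by (intro continuous_intros)
  have R: "\<exists>B\<in>sets borel. B \<subseteq> ?q ` A \<and> A - ?q -` B \<in> null_sets ?L" if "A \<in> sets ?L" for A
    by (rule continuous_image_inner_approx[where S=UNIV, OF lborel.sigma_finite_measure_axioms _ _ qc that])
       (auto simp: sets_restrict_space)
  have "(\<lambda>X. H0 (?q X)) \<in> borel_measurable (completion ?L)"
    by (rule borel_measurable_completion_AE[OF _ ae]) simp
  from borel_measurable_completion_distr[OF qm R this]
  obtain H1 where H1: "H1 \<in> borel_measurable (distr ?L borel ?q)" "AE r in distr ?L borel ?q. H0 r = H1 r"
    using completion_ex_borel_measurable by blast
  have H1m[measurable]: "H1 \<in> borel_measurable borel" using H1(1) by simp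
  have ae1: "AE X in ?L. H X = H1 (?q X)"
    using AE_distrD[OF qm H1(2)] ae by eventually_elim simp
  interpret D: sigma_finite_measure "distr ?L borel ?q" by (rule sigma_finite_gram_distr)
  have "density (distr ?L borel ?q) H1 = density (distr ?L borel ?q) RHS"
  proof (rule measure_eqI)
    fix A assume "A \<in> sets (density (distr ?L borel ?q) H1)"
    then have A[measurable]: "A \<in> sets borel" by simp
    have "emeasure (density (distr ?L borel ?q) H1) A = (\<integral>\<^sup>+X. H1 (?q X) * indicator A (?q X) \<partial>?L)"
      by (subst emeasure_density) (auto simp: nn_integral_distr)
    also have "\<dots> = (\<integral>\<^sup>+X. indicator A (?q X) * H X \<partial>?L)"
      by (rule nn_integral_cong_AE) (use ae1 in eventually_elim, simp add: mult.commute)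
    also have "\<dots> = (\<integral>\<^sup>+X. indicator A (?q X) * RHS (?q X) \<partial>?L)"
      unfolding H_def RHS_def c_def \<kappa>_def \<delta>_def by (rule nn_integral_projected_gram_average[OF \<mu> ml]) measurable
    also have "\<dots> = emeasure (density (distr ?L borel ?q) RHS) A"
      by (subst emeasure_density) (auto simp: nn_integral_distr mult.commute)
    finally show "emeasure (density (distr ?L borel ?q) H1) A = emeasure (density (distr ?L borel ?q) RHS) A" .
  qed simp
  then have "AE r in distr ?L borel ?q. H1 r = RHS r" by (intro D.density_unique) auto
  from AE_distrD[OF qm this] ae1 have "AE X in ?L. H X = RHS (?q X)" by eventually_elim simp
  then show ?thesis by (simp only: H_def RHS_def)
qed

text \<open>The finite intersections of a countable basis. Countability lets the exceptional null
  sets be united, and stability under intersection makes agreement on the generator enough for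
  finite measures.\<close>

lemma ex_countable_generator:
  "\<exists>G :: 'a::second_countable_topology set set. countable G \<and> Int_stable G \<and> UNIV \<in> G \<and> sets borel = sigma_sets UNIV G"
proof -
  obtain B :: "'a set set" where B: "countable B" "topological_basis B" using ex_countable_basis by auto
  define G where "G = Inter ` {F. finite F \<and> F \<subseteq> B}"
  have "countable G" unfolding G_def using countable_Collect_finite_subset[OF B(1)] by (rule countable_image)
  moreover have "Int_stable G"
  proof (rule Int_stableI)
    fix a b assume "a \<in> G" "b \<in> G"
    then obtain F F' where "finite F" "F \<subseteq> B" "a = \<Inter>F" "finite F'" "F' \<subseteq> B" "b = \<Inter>F'" by (auto simp: G_def)
    then show "a \<inter> b \<in> G" unfolding G_def by (intro image_eqI[of _ _ "F \<union> F'"]) auto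
  qed
  moreover have "UNIV \<in> G" unfolding G_def by (rule image_eqI[of _ _ "{}"]) auto
  moreover have "sets borel = sigma_sets UNIV G"
  proof -
    have "G \<subseteq> sets borel"
    proof
      fix a assume "a \<in> G"
      then obtain F where F: "finite F" "F \<subseteq> B" "a = \<Inter>F" by (auto simp: G_def)
      then have "open a" using topological_basis_open[OF B(2)] by (auto intro!: open_Inter)
      then show "a \<in> sets borel" by simp
    qed
    then have "sigma_sets UNIV G \<subseteq> sets borel" using sets.sigma_sets_subset[of G borel] by simp
    moreover have "B \<subseteq> G"
    proof
      fix b assume "b \<in> B"
      then show "b \<in> G" unfolding G_def by (intro image_eqI[of _ _ "{b}"]) auto
    qed
    then have "sigma_sets UNIV B \<subseteq> sigma_sets UNIV G" by (rule sigma_sets_mono')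
    moreover have "sets borel = sigma_sets UNIV B"
      by (subst borel_eq_countable_basis[OF B]) simp
    ultimately show ?thesis by auto
  qed
  ultimately show ?thesis by blast
qed

section \<open>The law of the projected Gram matrix at every x of full rank\<close>

text \<open>The measure against which a function \<phi> integrates to c times \<open>gg_nn\<close>
  of \<phi>. As an image from k-by-m matrices it makes sense for k < m too, when it has no density
  on symmetric matrices.\<close>

definition gg_measure :: "'k::finite itself \<Rightarrow> real \<Rightarrow> real \<Rightarrow> real^'m^'m \<Rightarrow> (real^'m^'m) measure" where
  "gg_measure _ c \<delta> r = distr (density (lborel :: (real^'m^'k) measure)
     (\<lambda>\<omega>. ennreal (c * (indicator posdef_cone (r - transpose \<omega> ** \<omega>) * \<bar>det (r - transpose \<omega> ** \<omega>)\<bar> powr \<delta>))))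
     borel (\<lambda>\<omega>. r - transpose \<omega> ** \<omega>)"

lemma sets_gg_measure [simp, measurable_cong]: "sets (gg_measure TYPE('k::finite) c \<delta> r) = sets borel"
  by (simp add: gg_measure_def)

lemma nn_integral_gg_measure:
  assumes c: "0 \<le> c" and [measurable]: "\<phi> \<in> borel_measurable borel"
  shows "(\<integral>\<^sup>+s. \<phi> s \<partial>gg_measure TYPE('k::finite) c \<delta> r) = ennreal c * gg_nn TYPE('k) \<delta> \<phi> r"
  unfolding gg_measure_def gg_nn_def using c
  by (subst nn_integral_distr, simp, simp, subst nn_integral_density, measurable, subst nn_integral_cmult[symmetric], measurable)
     (auto intro!: nn_integral_cong simp: ennreal_mult mult.assoc indicator_def)

text \<open>On a countable generator the exceptional sets of the almost-everywhere law unite to a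
  null set, so some X of full rank satisfies it for all generators at once. Under x = g X A, the
  invariance of \<mu> removes g, and A acts on both sides as a congruence with the same determinant
  power.\<close>

lemma distr_projected_gram:
  fixes \<mu> :: "(real^'l^('k::finite + 'l::finite)) measure" and x :: "real^'m::{finite,linorder}^('k + 'l)"
  assumes \<mu>: "invariant_stiefel_measure \<mu>" and ml: "CARD('m) \<le> CARD('l)"
    and x: "transpose x ** x \<in> posdef_cone"
  defines "c \<equiv> stiefel_volume CARD('k + 'l) CARD('l) * gram_const CARD('l) CARD('m) / gram_const CARD('k + 'l) CARD('m)"
    and "\<kappa> \<equiv> (real CARD('k + 'l) - real CARD('m) - 1) / 2" and "\<delta> \<equiv> (real CARD('l) - real CARD('m) - 1) / 2"
  shows "distr \<mu> borel (\<lambda>\<xi>. projected_gram \<xi> x) =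
    gg_measure TYPE('k) (c * \<bar>det (transpose x ** x)\<bar> powr (- \<kappa>)) \<delta> (transpose x ** x)"
proof -
  interpret \<mu>: finite_measure \<mu> by (rule finite_stiefel_measure[OF \<mu>])
  have ln: "CARD('l) \<le> CARD('k + 'l)" and mn: "CARD('m) \<le> CARD('k + 'l)" using ml by auto
  have c: "0 \<le> c" unfolding c_def using stiefel_volume_pos[OF ln] gram_const_pos[OF ml] gram_const_pos[OF mn]
    by (simp add: less_imp_le)
  have id[measurable]: "(\<lambda>\<xi>. \<xi>) \<in> \<mu> \<rightarrow>\<^sub>M borel" by (rule measurable_stiefel_measure[OF \<mu>]) simp
  let ?L = "lborel :: (real^'m::{finite,linorder}^('k + 'l)) measure"
  obtain G :: "(real^'m::{finite,linorder}^'m::{finite,linorder}) set set" where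
    G: "countable G" "Int_stable G" "UNIV \<in> G" "sets borel = sigma_sets UNIV G"
    using ex_countable_generator by metis
  have GB: "A \<in> sets borel" if "A \<in> G" for A unfolding G(4) using that by (rule sigma_sets.Basic)
  have "AE X in ?L. \<forall>A\<in>G. (\<integral>\<^sup>+\<xi>. indicator A (projected_gram \<xi> X) \<partial>\<mu>) =
    ennreal (c * \<bar>det (transpose X ** X)\<bar> powr (- \<kappa>)) * gg_nn TYPE('k) \<delta> (indicator A) (transpose X ** X)"
    unfolding AE_ball_countable[OF G(1)] c_def \<kappa>_def \<delta>_def
    by (intro ballI AE_projected_gram_law[OF \<mu> ml] borel_measurable_indicator GB)
  with AE_gram_posdef[OF mn] have ae: "AE X in ?L. transpose X ** X \<in> posdef_cone \<and>
    (\<forall>A\<in>G. (\<integral>\<^sup>+\<xi>. indicator A (projected_gram \<xi> X) \<partial>\<mu>) =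
    ennreal (c * \<bar>det (transpose X ** X)\<bar> powr (- \<kappa>)) * gg_nn TYPE('k) \<delta> (indicator A) (transpose X ** X))"
    by eventually_elim blast
  \<comment> \<open>Lebesgue measure is not the zero measure, so a property that holds almost
    everywhere holds somewhere.\<close>
  have "ae_filter ?L \<noteq> bot"
    using AE_iff_measurable[of UNIV ?L "\<lambda>_. False"] by (simp add: trivial_limit_def)
  from eventually_happens'[OF this ae] obtain X where X: "transpose X ** X \<in> posdef_cone" and
    XG: "\<And>A. A \<in> G \<Longrightarrow> (\<integral>\<^sup>+\<xi>. indicator A (projected_gram \<xi> X) \<partial>\<mu>) =
    ennreal (c * \<bar>det (transpose X ** X)\<bar> powr (- \<kappa>)) * gg_nn TYPE('k) \<delta> (indicator A) (transpose X ** X)"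
    by blast
  let ?cX = "c * \<bar>det (transpose X ** X)\<bar> powr (- \<kappa>)"
  have emd: "emeasure (distr \<mu> borel (\<lambda>\<xi>. projected_gram \<xi> Y)) A = (\<integral>\<^sup>+\<xi>. indicator A (projected_gram \<xi> Y) \<partial>\<mu>)"
    if "A \<in> sets borel" for A and Y :: "real^'m::{finite,linorder}^('k + 'l)"
  proof -
    have "emeasure (distr \<mu> borel (\<lambda>\<xi>. projected_gram \<xi> Y)) A = (\<integral>\<^sup>+s. indicator A s \<partial>distr \<mu> borel (\<lambda>\<xi>. projected_gram \<xi> Y))"
      using that by simp
    also have "\<dots> = (\<integral>\<^sup>+\<xi>. indicator A (projected_gram \<xi> Y) \<partial>\<mu>)"
      using that by (intro nn_integral_distr) auto
    finally show ?thesis .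
  qed
  have emg: "emeasure (gg_measure TYPE('k) c' \<delta> r) A = ennreal c' * gg_nn TYPE('k) \<delta> (indicator A) r"
    if "A \<in> sets borel" "0 \<le> c'" for A c' and r :: "real^'m::{finite,linorder}^'m::{finite,linorder}"
    using nn_integral_gg_measure[of c' "indicator A" \<delta> r, where 'k='k] that by simp
  have law: "distr \<mu> borel (\<lambda>\<xi>. projected_gram \<xi> X) = gg_measure TYPE('k) ?cX \<delta> (transpose X ** X)"
  proof (rule measure_eqI_generator_eq[where E=G and \<Omega>=UNIV and A="\<lambda>_. UNIV"])
    fix A assume "A \<in> G"
    then show "emeasure (distr \<mu> borel (\<lambda>\<xi>. projected_gram \<xi> X)) A = emeasure (gg_measure TYPE('k) ?cX \<delta> (transpose X ** X)) A"
      using XG[OF \<open>A \<in> G\<close>] GB c by (simp add: emd emg)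
  next
    show "emeasure (distr \<mu> borel (\<lambda>\<xi>. projected_gram \<xi> X)) UNIV \<noteq> \<infinity>" for i :: nat
      by (subst emd) auto
  qed (use G in auto)
  obtain g A where g: "orthogonal_matrix g" and A: "det A \<noteq> 0" and xg: "x = g ** (X ** A)"
    using ex_orthogonal_linear_equivalence[OF X x mn] by blast
  have gg: "transpose g ** g = mat 1" using g by (simp add: orthogonal_matrix)
  have xx: "transpose x ** x = transpose A ** (transpose X ** X) ** A"
    unfolding xg gram_matrix_mult_left[OF gg] by (simp add: matrix_transpose_mul matrix_mul_assoc)
  let ?cx = "c * \<bar>det (transpose x ** x)\<bar> powr (- \<kappa>)"
  have cx: "?cX * \<bar>det A\<bar> powr (- (2 * \<delta> + real CARD('k))) = ?cx"
  proof -
    have "\<bar>det (transpose x ** x)\<bar> = (\<bar>det A\<bar> * \<bar>det A\<bar>) * \<bar>det (transpose X ** X)\<bar>"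
      unfolding xx by (simp add: det_mul abs_mult mult_ac)
    then have "\<bar>det (transpose x ** x)\<bar> powr (- \<kappa>) = \<bar>det A\<bar> powr (- \<kappa> + - \<kappa>) * \<bar>det (transpose X ** X)\<bar> powr (- \<kappa>)"
      by (simp only: powr_mult powr_add)
    \<comment> \<open>The exponents match because (n - m - 1) = (n - k - m - 1) + k.\<close>
    moreover have "- \<kappa> + - \<kappa> = - (2 * \<delta> + real CARD('k))" by (simp add: \<kappa>_def \<delta>_def field_simps)
    ultimately show ?thesis by (simp add: mult_ac)
  qed
  show ?thesis
  proof (rule measure_eqI)
    fix B assume "B \<in> sets (distr \<mu> borel (\<lambda>\<xi>. projected_gram \<xi> x))"
    then have B[measurable]: "B \<in> sets borel" by simp
    let ?\<phi> = "\<lambda>s. indicator B (transpose A ** s ** A) :: ennreal"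
    have "emeasure (distr \<mu> borel (\<lambda>\<xi>. projected_gram \<xi> x)) B = (\<integral>\<^sup>+\<xi>. (\<lambda>\<xi>. ?\<phi> (projected_gram \<xi> X)) (transpose g ** \<xi>) \<partial>\<mu>)"
    proof -
      have "projected_gram \<xi> x = transpose A ** projected_gram (transpose g ** \<xi>) X ** A" for \<xi> :: "real^'l^('k + 'l)"
        unfolding xg by (rule trans[OF projected_gram_orthogonal projected_gram_mult_right])
      then show ?thesis unfolding emd[OF B] by (simp only: )
    qed
    also have "\<dots> = (\<integral>\<^sup>+\<xi>. ?\<phi> (projected_gram \<xi> X) \<partial>\<mu>)"
      using g by (intro nn_integral_stiefel_invariant[OF \<mu>]) (simp_all add: orthogonal_matrix_transpose)
    also have "\<dots> = (\<integral>\<^sup>+s. ?\<phi> s \<partial>distr \<mu> borel (\<lambda>\<xi>. projected_gram \<xi> X))"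
      by (rule nn_integral_distr[symmetric]) measurable
    also have "\<dots> = ennreal ?cX * gg_nn TYPE('k) \<delta> ?\<phi> (transpose X ** X)"
      unfolding law using c by (intro nn_integral_gg_measure) auto
    also have "gg_nn TYPE('k) \<delta> ?\<phi> (transpose X ** X) =
       ennreal (\<bar>det A\<bar> powr (- (2 * \<delta> + real CARD('k)))) * gg_nn TYPE('k) \<delta> (indicator B) (transpose x ** x)"
      unfolding xx by (rule gg_nn_congruence[OF A]) simp
    also have "ennreal ?cX * (ennreal (\<bar>det A\<bar> powr (- (2 * \<delta> + real CARD('k)))) * gg_nn TYPE('k) \<delta> (indicator B) (transpose x ** x))
       = ennreal ?cx * gg_nn TYPE('k) \<delta> (indicator B) (transpose x ** x)"
      unfolding cx[symmetric] using c by (simp add: ennreal_mult mult.assoc)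
    also have "\<dots> = emeasure (gg_measure TYPE('k) ?cx \<delta> (transpose x ** x)) B"
      using c by (subst emg) auto
    finally show "emeasure (distr \<mu> borel (\<lambda>\<xi>. projected_gram \<xi> x)) B = emeasure (gg_measure TYPE('k) ?cx \<delta> (transpose x ** x)) B" .
  qed simp
qed

text \<open>The Gram law of \<omega>'\<omega> with the sign -1. The condition on the weight puts s
  in the cone, the Gram density puts r - s there, and together they give the domain and the kernel
  of \<open>gg_plus\<close>.\<close>

lemma gg_measure_eq_density:
  fixes r :: "real^'m::{finite,linorder}^'m::{finite,linorder}"
  assumes mk: "CARD('m) \<le> CARD('k::finite)" and r: "transpose r = r" and c: "0 \<le> c"
  shows "gg_measure TYPE('k) c \<delta> r = density lborel_sym (\<lambda>s. ennreal (c * gram_const CARD('k) CARD('m) *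
    (indicator {s. s \<in> posdef_cone \<and> r - s \<in> posdef_cone} s *
     (\<bar>det (r - s)\<bar> powr ((real CARD('k) - real CARD('m) - 1) / 2) * \<bar>det s\<bar> powr \<delta>))))"
    (is "_ = ?R")
proof (rule measure_eqI)
  fix A assume "A \<in> sets (gg_measure TYPE('k) c \<delta> r)"
  then have A[measurable]: "A \<in> sets borel" by simp
  let ?e = "(real CARD('k) - real CARD('m) - 1) / 2"
  define C where "C = gram_const CARD('k) CARD('m)"
  have C: "0 < C" unfolding C_def by (rule gram_const_pos[OF mk])
  let ?f = "\<lambda>s. indicator posdef_cone s * ennreal (\<bar>det s\<bar> powr \<delta>) * indicator A s"
  have "emeasure (gg_measure TYPE('k) c \<delta> r) A = ennreal c * gg_nn TYPE('k) \<delta> (indicator A) r"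
    using nn_integral_gg_measure[OF c, of "indicator A" \<delta> r, where 'k='k] by simp
  also have "gg_nn TYPE('k) \<delta> (indicator A) r
      = (\<integral>\<^sup>+\<omega>. ?f (r + (- 1) *\<^sub>R (transpose \<omega> ** \<omega>)) \<partial>(lborel :: (real^'m::{finite,linorder}^'k) measure))"
    by (simp add: gg_nn_def)
  also have "\<dots> = ennreal C * (\<integral>\<^sup>+s. indicator posdef_cone ((- 1) *\<^sub>R (s - r)) *
      ennreal (\<bar>det ((- 1) *\<^sub>R (s - r))\<bar> powr ?e) * ?f s \<partial>lborel_sym)"
    unfolding C_def using r by (intro nn_integral_gram_affine[OF _ mk]) auto
  also have "ennreal c * \<dots> = (\<integral>\<^sup>+s. ennreal (c * C) * (indicator posdef_cone ((- 1) *\<^sub>R (s - r)) *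
      ennreal (\<bar>det ((- 1) *\<^sub>R (s - r))\<bar> powr ?e) * ?f s) \<partial>lborel_sym)"
    using C c by (subst nn_integral_cmult) (auto simp: ennreal_mult mult.assoc)
  also have "\<dots> = (\<integral>\<^sup>+s. ennreal (c * C * (indicator {s. s \<in> posdef_cone \<and> r - s \<in> posdef_cone} s *
     (\<bar>det (r - s)\<bar> powr ?e * \<bar>det s\<bar> powr \<delta>))) * indicator A s \<partial>lborel_sym)"
    using C c by (intro nn_integral_cong) (auto simp: indicator_def ennreal_mult mult.assoc)
  also have "\<dots> = emeasure ?R A"
    unfolding C_def by (subst emeasure_density) auto
  finally show "emeasure (gg_measure TYPE('k) c \<delta> r) A = emeasure ?R A" .
qed simp

text \<open>The dual transform integrates \<open>\<phi>\<^sub>0\<close> against the law of the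
  projected Gram matrix. Its total mass factor is the frame volume, which cancels against the
  normalization; the weight |s|^\<delta> in the law is what turns \<open>\<phi>\<^sub>0\<close> into
  \<open>\<Phi>\<^sub>0\<close>.\<close>

lemma dual_radon_radial:
  fixes \<mu> :: "(real^'l^('k::finite + 'l::finite)) measure"
    and \<phi> :: "(real^'l^('k + 'l)) \<times> (real^'m::{finite,linorder}^'l) \<Rightarrow> complex"
    and x :: "real^'m::{finite,linorder}^('k + 'l)"
  assumes \<mu>: "invariant_stiefel_measure \<mu>" and ml: "CARD('m) \<le> CARD('l)"
    and x: "transpose x ** x \<in> posdef_cone"
    and \<phi>: "\<And>\<xi> t. \<xi> \<in> stiefel \<Longrightarrow> \<phi> (\<xi>, t) = \<phi>\<^sub>0 (transpose t ** t)"
    and \<delta>: "\<delta> = (real CARD('l) - real CARD('m) - 1) / 2"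
    and \<Phi>\<^sub>0: "\<And>s. \<Phi>\<^sub>0 s = (\<bar>det s\<bar> powr \<delta>) *\<^sub>R \<phi>\<^sub>0 s"
  defines "r \<equiv> transpose x ** x"
  shows "(dual_radon_exists \<mu> \<phi> x \<longleftrightarrow> gg_plus_exists TYPE('k) \<Phi>\<^sub>0 r) \<and>
    dual_radon \<mu> \<phi> x = (pi powr (real CARD('k) * real CARD('m) / 2) * gram_const CARD('l) CARD('m) / gram_const CARD('k + 'l) CARD('m) *
      \<bar>det r\<bar> powr (- ((real CARD('k + 'l) - real CARD('m) - 1) / 2))) *\<^sub>R gg_plus TYPE('k) \<Phi>\<^sub>0 r"
proof -
  define SV where "SV = stiefel_volume CARD('k + 'l) CARD('l)"
  define Cq where "Cq = gram_const CARD('l) CARD('m) / gram_const CARD('k + 'l) CARD('m)"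
  define D where "D = \<bar>det r\<bar> powr (- ((real CARD('k + 'l) - real CARD('m) - 1) / 2))"
  define c where "c = SV * Cq * D"
  have ln: "CARD('l) \<le> CARD('k + 'l)" and mn: "CARD('m) \<le> CARD('k + 'l)" using ml by auto
  have SV: "0 < SV" unfolding SV_def by (rule stiefel_volume_pos[OF ln])
  have Cq: "0 < Cq" unfolding Cq_def using gram_const_pos[OF ml] gram_const_pos[OF mn] by simp
  have D: "0 < D" unfolding D_def r_def using posdef_cone_det_nonzero[OF x] by simp
  have c: "0 < c" unfolding c_def using SV Cq D by simp
  interpret \<mu>: finite_measure \<mu> by (rule finite_stiefel_measure[OF \<mu>])
  let ?q = "\<lambda>\<xi> :: real^'l^('k + 'l). projected_gram \<xi> x"
  have qm: "?q \<in> \<mu> \<rightarrow>\<^sub>M borel" by (rule measurable_stiefel_measure[OF \<mu>]) measurable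
  have qc: "continuous_on stiefel ?q" by (intro continuous_intros)
  have Rq: "\<exists>B\<in>sets borel. B \<subseteq> ?q ` A \<and> A - ?q -` B \<in> null_sets \<mu>" if "A \<in> sets \<mu>" for A
    by (rule continuous_image_inner_approx[OF \<mu>.sigma_finite_measure_axioms sets_stiefel_measure[OF \<mu>] _ qc that])
       (simp add: borel_closed closed_stiefel)
  have law: "distr \<mu> borel ?q = gg_measure TYPE('k) c \<delta> r"
    using distr_projected_gram[OF \<mu> ml x] unfolding c_def SV_def Cq_def D_def r_def \<delta>
    by (simp only: times_divide_eq_right)
  \<comment> \<open>Radiality of \<phi> is assumed on frames only, so the rewriting is restricted to
    the space of \<mu>.\<close>
  have \<phi>q: "\<phi> (\<xi>, transpose \<xi> ** x) = \<phi>\<^sub>0 (?q \<xi>)" if "\<xi> \<in> space (completion \<mu>)" for \<xi>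
    using that by (simp add: space_stiefel_measure[OF \<mu>] \<phi> projected_gram_def)
  have ex1: "dual_radon_exists \<mu> \<phi> x \<longleftrightarrow> integrable (completion (gg_measure TYPE('k) c \<delta> r)) \<phi>\<^sub>0"
    unfolding dual_radon_exists_def
    by (subst Bochner_Integration.integrable_cong[OF refl \<phi>q])
       (assumption, rule integrable_completion_distr[where F=\<phi>\<^sub>0, OF qm Rq, unfolded law])
  have int1: "dual_radon \<mu> \<phi> x = (1 / SV) *\<^sub>R integral\<^sup>L (completion (gg_measure TYPE('k) c \<delta> r)) \<phi>\<^sub>0"
    unfolding dual_radon_def SV_def
    by (subst Bochner_Integration.integral_cong[OF refl \<phi>q])
       (assumption, simp only: integral_completion_distr[where F=\<phi>\<^sub>0, OF qm Rq, unfolded law])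
  have rs: "transpose r = r" by (simp add: r_def gram_matrix_symmetric)
  have "(dual_radon_exists \<mu> \<phi> x \<longleftrightarrow> gg_plus_exists TYPE('k) \<Phi>\<^sub>0 r) \<and>
    dual_radon \<mu> \<phi> x = (pi powr (real CARD('k) * real CARD('m) / 2) * Cq * D) *\<^sub>R gg_plus TYPE('k) \<Phi>\<^sub>0 r"
  proof (cases "CARD('m) \<le> CARD('k)")
    case mk: True
    define C where "C = gram_const CARD('k) CARD('m)"
    have C: "0 < C" unfolding C_def by (rule gram_const_pos[OF mk])
    let ?h = "\<lambda>s. c * C * (indicator {s. s \<in> posdef_cone \<and> r - s \<in> posdef_cone} s *
     (\<bar>det (r - s)\<bar> powr ((real CARD('k) - real CARD('m) - 1) / 2) * \<bar>det s\<bar> powr \<delta>)) :: real"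
    have h: "?h \<in> borel_measurable lborel_sym" "\<And>s. 0 \<le> ?h s" using c C by (measurable, auto)
    have gm: "gg_measure TYPE('k) c \<delta> r = density lborel_sym (\<lambda>s. ennreal (?h s))"
      unfolding C_def by (rule gg_measure_eq_density[OF mk rs less_imp_le[OF c]])
    have e: "(real CARD('k) - real CARD('m) - 1) / 2 = real CARD('k) / 2 - (real CARD('m) + 1) / 2" by (simp add: field_simps)
    have hf: "(\<lambda>s. ?h s *\<^sub>R \<phi>\<^sub>0 s) = (\<lambda>s. (c * C) *\<^sub>R (indicator {s. s \<in> posdef_cone \<and> r - s \<in> posdef_cone} s *\<^sub>R
        ((\<bar>det (r - s)\<bar> powr (real CARD('k) / 2 - (real CARD('m) + 1) / 2)) *\<^sub>R \<Phi>\<^sub>0 s)))"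
      unfolding e by (auto simp: fun_eq_iff indicator_def \<Phi>\<^sub>0)
    have "dual_radon_exists \<mu> \<phi> x \<longleftrightarrow> gg_plus_exists TYPE('k) \<Phi>\<^sub>0 r"
      unfolding ex1 gm integrable_completion_density[OF h] hf using c C mk
      by (simp add: integrable_scaleR_iff gg_plus_exists_def set_integrable_def lebesgue_sym_eq del: scaleR_scaleR)
    moreover have "dual_radon \<mu> \<phi> x = (pi powr (real CARD('k) * real CARD('m) / 2) * Cq * D) *\<^sub>R gg_plus TYPE('k) \<Phi>\<^sub>0 r"
      unfolding int1 gm integral_completion_density[OF h] hf integral_scaleR_eq using mk SV
      by (simp add: gg_plus_def set_lebesgue_integral_def lebesgue_sym_eq C_def gram_const_eq c_def mult_ac)
    ultimately show ?thesis by blast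
  next
    case mk: False
    \<comment> \<open>For k < m the law is carried by matrices s with r - s of rank at most k < m
      and has no density with respect to \<open>lborel_sym\<close>. It is instead pulled back along
      the second continuous map \<omega> -> r - \<omega>'\<omega>.\<close>
    let ?q2 = "\<lambda>\<omega> :: real^'m::{finite,linorder}^'k. r - transpose \<omega> ** \<omega>"
    let ?h = "\<lambda>\<omega>. c * (indicator posdef_cone (?q2 \<omega>) * \<bar>det (?q2 \<omega>)\<bar> powr \<delta>) :: real"
    let ?M = "density (lborel :: (real^'m::{finite,linorder}^'k) measure) (\<lambda>\<omega>. ennreal (?h \<omega>))"
    have h: "?h \<in> borel_measurable lborel" "\<And>\<omega>. 0 \<le> ?h \<omega>" using c by (measurable, auto)
    have gm: "gg_measure TYPE('k) c \<delta> r = distr ?M borel ?q2" by (simp add: gg_measure_def)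
    have sf: "sigma_finite_measure ?M"
      using h by (subst sigma_finite_measure.sigma_finite_iff_density_finite[OF lborel.sigma_finite_measure_axioms]) auto
    have q2m: "?q2 \<in> ?M \<rightarrow>\<^sub>M borel" by measurable
    have q2c: "continuous_on UNIV ?q2" by (intro continuous_intros)
    have R2: "\<exists>B\<in>sets borel. B \<subseteq> ?q2 ` A \<and> A - ?q2 -` B \<in> null_sets ?M" if "A \<in> sets ?M" for A
      by (rule continuous_image_inner_approx[where S=UNIV, OF sf _ _ q2c that]) (auto simp: sets_restrict_space)
    have hf: "(\<lambda>\<omega>. ?h \<omega> *\<^sub>R \<phi>\<^sub>0 (?q2 \<omega>)) = (\<lambda>\<omega>. c *\<^sub>R (indicator {\<omega>. ?q2 \<omega> \<in> posdef_cone} \<omega> *\<^sub>R \<Phi>\<^sub>0 (?q2 \<omega>)))"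
      by (auto simp: fun_eq_iff indicator_def \<Phi>\<^sub>0)
    have "dual_radon_exists \<mu> \<phi> x \<longleftrightarrow> integrable (completion ?M) (\<lambda>\<omega>. \<phi>\<^sub>0 (?q2 \<omega>))"
      unfolding ex1 gm by (rule integrable_completion_distr[where F=\<phi>\<^sub>0, OF q2m R2, symmetric])
    also have "\<dots> \<longleftrightarrow> integrable (completion lborel) (\<lambda>\<omega>. ?h \<omega> *\<^sub>R \<phi>\<^sub>0 (?q2 \<omega>))"
      by (rule integrable_completion_density[OF h])
    also have "\<dots> \<longleftrightarrow> gg_plus_exists TYPE('k) \<Phi>\<^sub>0 r"
      unfolding hf using c mk
      by (simp add: integrable_scaleR_iff gg_plus_exists_def set_integrable_def del: scaleR_scaleR)
    finally have "dual_radon_exists \<mu> \<phi> x \<longleftrightarrow> gg_plus_exists TYPE('k) \<Phi>\<^sub>0 r" .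
    moreover have "dual_radon \<mu> \<phi> x = (pi powr (real CARD('k) * real CARD('m) / 2) * Cq * D) *\<^sub>R gg_plus TYPE('k) \<Phi>\<^sub>0 r"
    proof -
      have "integral\<^sup>L (completion (gg_measure TYPE('k) c \<delta> r)) \<phi>\<^sub>0 = integral\<^sup>L (completion ?M) (\<lambda>\<omega>. \<phi>\<^sub>0 (?q2 \<omega>))"
        unfolding gm by (rule integral_completion_distr[where F=\<phi>\<^sub>0, OF q2m R2, symmetric])
      also have "\<dots> = integral\<^sup>L (completion lborel) (\<lambda>\<omega>. ?h \<omega> *\<^sub>R \<phi>\<^sub>0 (?q2 \<omega>))"
        by (rule integral_completion_density[OF h])
      also have "\<dots> = c *\<^sub>R (LINT \<omega>:{\<omega>. ?q2 \<omega> \<in> posdef_cone}|lebesgue. \<Phi>\<^sub>0 (?q2 \<omega>))"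
        unfolding hf integral_scaleR_eq by (simp add: set_lebesgue_integral_def)
      finally have i: "dual_radon \<mu> \<phi> x = (1 / SV * c) *\<^sub>R (LINT \<omega>:{\<omega>. ?q2 \<omega> \<in> posdef_cone}|lebesgue. \<Phi>\<^sub>0 (?q2 \<omega>))"
        by (simp add: int1)
      \<comment> \<open>The last power of pi is the prefactor in the definition of
        \<open>gg_plus\<close> for k < m, compensated by the first one.\<close>
      have "1 / SV * c = pi powr (real CARD('k) * real CARD('m) / 2) * Cq * D * pi powr (- (real CARD('k) * real CARD('m) / 2))"
        using SV by (simp add: c_def powr_minus)
      then show ?thesis unfolding i using mk by (simp add: gg_plus_def)
    qed
    ultimately show ?thesis by blast
  qed
  then show ?thesis by (simp only: Cq_def D_def times_divide_eq_right)
qed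

theorem theorem0p6:
  fixes rot :: "real^'l^('k::finite + 'l::finite) \<Rightarrow> real^('k + 'l)^('k + 'l)"
    and \<mu> :: "(real^'l^('k + 'l)) measure"
    and f :: "real^'m::{finite,linorder}^('k + 'l) \<Rightarrow> complex"
    and \<phi> :: "(real^'l^('k + 'l)) \<times> (real^'m::{finite,linorder}^'l) \<Rightarrow> complex"
    and f\<^sub>0 \<phi>\<^sub>0 :: "real^'m::{finite,linorder}^'m::{finite,linorder} \<Rightarrow> complex"
    and k n m :: nat and d \<delta> c :: real and \<Phi>\<^sub>0 :: "real^'m::{finite,linorder}^'m::{finite,linorder} \<Rightarrow> complex"
  assumes k_def: "k = CARD('k)" and n_def: "n = CARD('k + 'l)" and m_def: "m = CARD('m)"
    and "m \<le> n"
    and rot: "\<And>\<xi>. \<xi> \<in> stiefel \<Longrightarrow> rot \<xi> \<in> frame_rotations \<xi>"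
    and \<mu>: "invariant_stiefel_measure \<mu>"
    and d_def: "d = (real m + 1) / 2"
    and \<delta>_def: "\<delta> = (real n - real k) / 2 - d"
    and \<Phi>\<^sub>0_def: "\<And>s. \<Phi>\<^sub>0 s = (\<bar>det s\<bar> powr \<delta>) *\<^sub>R \<phi>\<^sub>0 s"
    and c_def: "c = pi powr (real k * real m / 2) * stiefel_volume (n - k) m / stiefel_volume n m"
  shows
    "(locally_integrable_on lebesgue UNIV f \<and> (\<forall>x. f x = f\<^sub>0 (transpose x ** x)) \<longrightarrow>
       (\<forall>\<xi>\<in>stiefel. \<forall>t. \<forall>s. s = transpose t ** t \<longrightarrow>
          radon_exists rot f \<xi> t \<or> gg_minus_exists TYPE('k) f\<^sub>0 s \<longrightarrow>
          radon_exists rot f \<xi> t \<and> gg_minus_exists TYPE('k) f\<^sub>0 s \<and>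
          radon rot f \<xi> t = (pi powr (real k * real m / 2)) *\<^sub>R gg_minus TYPE('k) f\<^sub>0 s))
     \<and>
     (locally_integrable_on (completion (\<mu> \<Otimes>\<^sub>M lborel)) (stiefel \<times> UNIV) \<phi> \<and>
      (\<forall>\<xi>\<in>stiefel. \<forall>t. \<phi> (\<xi>, t) = \<phi>\<^sub>0 (transpose t ** t)) \<and> k \<le> n - m \<longrightarrow>
       (\<forall>x r. rank x = m \<and> r = transpose x ** x \<longrightarrow>
          dual_radon_exists \<mu> \<phi> x \<or> gg_plus_exists TYPE('k) \<Phi>\<^sub>0 r \<longrightarrow>
          dual_radon_exists \<mu> \<phi> x \<and> gg_plus_exists TYPE('k) \<Phi>\<^sub>0 r \<and>
          dual_radon \<mu> \<phi> x = (c * \<bar>det r\<bar> powr (d - real n / 2)) *\<^sub>R gg_plus TYPE('k) \<Phi>\<^sub>0 r))"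
proof (intro conjI impI; (elim conjE)?)
  assume f: "\<forall>x. f x = f\<^sub>0 (transpose x ** x)"
  show "\<forall>\<xi>\<in>stiefel. \<forall>t. \<forall>s. s = transpose t ** t \<longrightarrow>
          radon_exists rot f \<xi> t \<or> gg_minus_exists TYPE('k) f\<^sub>0 s \<longrightarrow>
          radon_exists rot f \<xi> t \<and> gg_minus_exists TYPE('k) f\<^sub>0 s \<and>
          radon rot f \<xi> t = (pi powr (real k * real m / 2)) *\<^sub>R gg_minus TYPE('k) f\<^sub>0 s"
  proof (intro ballI allI impI)
    fix \<xi> t s assume \<xi>: "\<xi> \<in> stiefel" and s: "s = transpose t ** t"
      and ex: "radon_exists rot f \<xi> t \<or> gg_minus_exists TYPE('k) f\<^sub>0 s"
    show "radon_exists rot f \<xi> t \<and> gg_minus_exists TYPE('k) f\<^sub>0 s \<and>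
          radon rot f \<xi> t = (pi powr (real k * real m / 2)) *\<^sub>R gg_minus TYPE('k) f\<^sub>0 s"
      using ex radon_exists_radial[of rot \<xi> f f\<^sub>0 t, OF rot[OF \<xi>]] radon_radial_eq[of rot \<xi> f f\<^sub>0 t, OF rot[OF \<xi>]] f
      by (simp add: s k_def m_def)
  qed
next
  assume \<phi>: "\<forall>\<xi>\<in>stiefel. \<forall>t. \<phi> (\<xi>, t) = \<phi>\<^sub>0 (transpose t ** t)" and km: "k \<le> n - m"
  have n: "n = CARD('k) + CARD('l)" by (simp add: n_def)
  \<comment> \<open>Since m \<le> n, the truncated difference n - m is the true one, and k \<le> n -
    m says that t has at least as many rows as columns.\<close>
  have ml: "CARD('m) \<le> CARD('l)" using km \<open>m \<le> n\<close> by (simp add: n k_def m_def)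
  have mn: "CARD('m) \<le> CARD('k + 'l)" using ml by simp
  have nk: "n - k = CARD('l)" by (simp add: n k_def)
  have \<delta>: "\<delta> = (real CARD('l) - real CARD('m) - 1) / 2"
    by (simp add: \<delta>_def d_def n k_def m_def field_simps)
  have c: "c = pi powr (real CARD('k) * real CARD('m) / 2) * gram_const CARD('l) CARD('m) / gram_const CARD('k + 'l) CARD('m)"
    unfolding c_def nk using stiefel_volume_eq[OF ml] stiefel_volume_eq[OF mn] by (simp add: n_def m_def k_def)
  \<comment> \<open>With d = (m + 1)/2 this is the negative of the exponent in the n-row Gram law,
    the factor divided out by duality.\<close>
  have e: "d - real n / 2 = - ((real CARD('k + 'l) - real CARD('m) - 1) / 2)"
    by (simp add: d_def n_def m_def field_simps)
  show "\<forall>x r. rank x = m \<and> r = transpose x ** x \<longrightarrow>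
          dual_radon_exists \<mu> \<phi> x \<or> gg_plus_exists TYPE('k) \<Phi>\<^sub>0 r \<longrightarrow>
          dual_radon_exists \<mu> \<phi> x \<and> gg_plus_exists TYPE('k) \<Phi>\<^sub>0 r \<and>
          dual_radon \<mu> \<phi> x = (c * \<bar>det r\<bar> powr (d - real n / 2)) *\<^sub>R gg_plus TYPE('k) \<Phi>\<^sub>0 r"
  proof (intro allI impI; elim conjE)
    fix x :: "real^'m::{finite,linorder}^('k + 'l)" and r
    assume ex: "dual_radon_exists \<mu> \<phi> x \<or> gg_plus_exists TYPE('k) \<Phi>\<^sub>0 r"
      and rank: "rank x = m" and r: "r = transpose x ** x"
    have x: "transpose x ** x \<in> posdef_cone" using rank by (intro full_rank_imp_posdef_gram) (simp add: m_def)
    have "(dual_radon_exists \<mu> \<phi> x \<longleftrightarrow> gg_plus_exists TYPE('k) \<Phi>\<^sub>0 r) \<and>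
      dual_radon \<mu> \<phi> x = (c * \<bar>det r\<bar> powr (d - real n / 2)) *\<^sub>R gg_plus TYPE('k) \<Phi>\<^sub>0 r"
      unfolding c e r by (rule dual_radon_radial[OF \<mu> ml x _ \<delta> \<Phi>\<^sub>0_def]) (use \<phi> in blast)
    with ex show "dual_radon_exists \<mu> \<phi> x \<and> gg_plus_exists TYPE('k) \<Phi>\<^sub>0 r \<and>
          dual_radon \<mu> \<phi> x = (c * \<bar>det r\<bar> powr (d - real n / 2)) *\<^sub>R gg_plus TYPE('k) \<Phi>\<^sub>0 r" by blast
  qed
qed

end
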